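(* There is a deterministic polynomial-time algorithm which, given a monotone $\mathsf{NC}^0_3$ circuit $C:\{0,1\}^n\to\{0,1\}^m$ with $m>n$, outputs a string $y\in\{0,1\}^m$ with $y\notin\mathrm{Range}(C)$.
   Context: $\mathrm{Range}(C)=\{C(x):x\in\{0,1\}^n\}$. A monotone $\mathsf{NC}^0_3$ circuit is a constant-depth, bounded fan-in circuit with only $\wedge,\vee$ gates (no negations) in which each output bit depends on at most $3$ input bits; equivalently each output bit is a monotone Boolean function of at most $3$ of the input variables. *)

theory Defs
  imports "HOL-Computational_Algebra.Polynomial"
begin

section \<open>Monotone circuits\<close>

text \<open>
  A circuit is a straight-line program: the arguments of a gate are positions of earlier gates
  in the list, so wires may be shared. Gates of fan-in 0 are the constants (the empty conjunction
  is true, the empty disjunction is false); with them, the circuits below compute exactly the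
  monotone Boolean functions, including the constant ones.
\<close>

datatype gate = Input nat | And "nat list" | Or "nat list"

datatype circuit =
  Circuit (num_inputs: nat) (gates: "gate list") (outputs: "nat list")

abbreviation num_outputs :: "circuit \<Rightarrow> nat" where
  "num_outputs C \<equiv> length (outputs C)"

fun gate_inputs :: "gate \<Rightarrow> nat list" where
  "gate_inputs (Input i) = []"
| "gate_inputs (And js) = js"
| "gate_inputs (Or js) = js"

fun wf_gate :: "nat \<Rightarrow> nat \<Rightarrow> gate \<Rightarrow> bool" where
  "wf_gate n p (Input i) \<longleftrightarrow> i < n"
| "wf_gate n p (And js) \<longleftrightarrow> (\<forall>j\<in>set js. j < p)"
| "wf_gate n p (Or js) \<longleftrightarrow> (\<forall>j\<in>set js. j < p)"

definition wf_circuit :: "circuit \<Rightarrow> bool" where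
  "wf_circuit C \<longleftrightarrow>
     (\<forall>p < length (gates C). wf_gate (num_inputs C) p (gates C ! p)) \<and>
     (\<forall>p \<in> set (outputs C). p < length (gates C))"

fun gate_value :: "bool list \<Rightarrow> bool list \<Rightarrow> gate \<Rightarrow> bool" where
  "gate_value x vs (Input i) = x ! i"
| "gate_value x vs (And js) = (\<forall>j\<in>set js. vs ! j)"
| "gate_value x vs (Or js) = (\<exists>j\<in>set js. vs ! j)"

definition gate_values :: "bool list \<Rightarrow> gate list \<Rightarrow> bool list" where
  "gate_values x gs = foldl (\<lambda>vs g. vs @ [gate_value x vs g]) [] gs"

definition circuit_eval :: "circuit \<Rightarrow> bool list \<Rightarrow> bool list" where
  "circuit_eval C x = map (\<lambda>p. gate_values x (gates C) ! p) (outputs C)"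

definition circuit_range :: "circuit \<Rightarrow> bool list set" where
  "circuit_range C = {circuit_eval C x | x. length x = num_inputs C}"

fun gate_depth :: "nat list \<Rightarrow> gate \<Rightarrow> nat" where
  "gate_depth ds (Input i) = 0"
| "gate_depth ds (And js) = Suc (Max (insert 0 (set (map ((!) ds) js))))"
| "gate_depth ds (Or js) = Suc (Max (insert 0 (set (map ((!) ds) js))))"

definition gate_depths :: "gate list \<Rightarrow> nat list" where
  "gate_depths gs = foldl (\<lambda>ds g. ds @ [gate_depth ds g]) [] gs"

definition circuit_depth :: "circuit \<Rightarrow> nat" where
  "circuit_depth C = Max (insert 0 (set (gate_depths (gates C))))"

definition circuit_fan_in :: "circuit \<Rightarrow> nat" where
  "circuit_fan_in C = Max (insert 0 (set (map (length \<circ> gate_inputs) (gates C))))"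

definition dependencies :: "circuit \<Rightarrow> nat \<Rightarrow> nat set" where
  "dependencies C j =
     {i. i < num_inputs C \<and>
         (\<exists>x. length x = num_inputs C \<and>
              circuit_eval C (x[i := \<not> x ! i]) ! j \<noteq> circuit_eval C x ! j)}"

text \<open>
  For a single circuit ``constant depth'' and ``bounded fan-in'' have no content of their own;
  the constants d and f that bound them for a class of circuits are therefore parameters.
\<close>

definition monotone_NC0 :: "nat \<Rightarrow> nat \<Rightarrow> nat \<Rightarrow> circuit \<Rightarrow> bool" where
  "monotone_NC0 k d f C \<longleftrightarrow>
     wf_circuit C \<and> circuit_depth C \<le> d \<and> circuit_fan_in C \<le> f \<and>
     (\<forall>j < num_outputs C. card (dependencies C j) \<le> k)"


section \<open>Encoding of circuits as bit strings\<close>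

text \<open>
  Numbers are written in unary, as a prefix-free code. In a well-formed circuit with fewer inputs
  than outputs every number that is written is bounded by the number of wires, gates and outputs,
  so this is at most quadratically longer than an encoding with binary numbers.
\<close>

definition encode_nat :: "nat \<Rightarrow> bool list" where
  "encode_nat a = replicate a True @ [False]"

definition encode_list :: "('a \<Rightarrow> bool list) \<Rightarrow> 'a list \<Rightarrow> bool list" where
  "encode_list e xs = encode_nat (length xs) @ concat (map e xs)"

fun encode_gate :: "gate \<Rightarrow> bool list" where
  "encode_gate (Input i) = [False] @ encode_nat i"
| "encode_gate (And js) = [True, False] @ encode_list encode_nat js"
| "encode_gate (Or js) = [True, True] @ encode_list encode_nat js"

definition encode_circuit :: "circuit \<Rightarrow> bool list" where
  "encode_circuit C =
     encode_nat (num_inputs C) @ encode_list encode_gate (gates C) @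
     encode_list encode_nat (outputs C)"


section \<open>Deterministic multi-tape Turing machines\<close>

text \<open>
  Tapes are infinite in both directions and consist of their contents and a head position.
  Symbols are natural numbers, with 0 the blank and 1, 2 the bits. The states of a machine M are
  the positions in the list M of commands; the state length M is the halting state. A command maps
  the scanned symbols to the next state and, for each tape, the symbol to write and the head move.
\<close>

datatype move = Move_Left | Stay | Move_Right

type_synonym tape = "(int \<Rightarrow> nat) \<times> int"
type_synonym config = "nat \<times> tape list"
type_synonym command = "nat list \<Rightarrow> nat \<times> (nat \<times> move) list"
type_synonym machine = "command list"

definition turing_machine :: "nat \<Rightarrow> nat \<Rightarrow> machine \<Rightarrow> bool" where
  "turing_machine k G M \<longleftrightarrow>
     k \<ge> 2 \<and> G \<ge> 3 \<and>
     (\<forall>c \<in> set M. \<forall>ss. length ss = k \<and> set ss \<subseteq> {..<G} \<longrightarrow>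
        fst (c ss) \<le> length M \<and> length (snd (c ss)) = k \<and> fst ` set (snd (c ss)) \<subseteq> {..<G})"

fun move_head :: "move \<Rightarrow> int \<Rightarrow> int" where
  "move_head Move_Left i = i - 1"
| "move_head Stay i = i"
| "move_head Move_Right i = i + 1"

fun scanned :: "tape \<Rightarrow> nat" where
  "scanned (t, i) = t i"

fun act :: "nat \<times> move \<Rightarrow> tape \<Rightarrow> tape" where
  "act (s, d) (t, i) = (t(i := s), move_head d i)"

fun step :: "machine \<Rightarrow> config \<Rightarrow> config" where
  "step M (q, tps) =
     (if q < length M
      then let (q', as) = (M ! q) (map scanned tps) in (q', map2 act as tps)
      else (q, tps))"

definition word_tape :: "bool list \<Rightarrow> int \<Rightarrow> nat" where
  "word_tape w i =
     (if 0 \<le> i \<and> i < int (length w) then (if w ! nat i then 2 else 1) else 0)"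

definition start_config :: "nat \<Rightarrow> bool list \<Rightarrow> config" where
  "start_config k w = (0, (word_tape w, 0) # replicate (k - 1) (word_tape [], 0))"

text \<open>
  The input is on tape 0 and the output on tape 1. A halted configuration does not change any
  more, so halting after exactly t steps of this function means halting within t steps.
\<close>

definition outputs_within :: "nat \<Rightarrow> machine \<Rightarrow> bool list \<Rightarrow> bool list \<Rightarrow> nat \<Rightarrow> bool" where
  "outputs_within k M w y t \<longleftrightarrow>
     (let (q, tps) = (step M ^^ t) (start_config k w)
      in q = length M \<and> fst (tps ! 1) = word_tape y)"

end

theory Submission
  imports Defs Complex_Main
begin

text \<open>
  As long as there is an output with a label that forces an undetermined input (the value 1 of
  \<open>x \<and> (y \<or> z)\<close> forces \<open>x\<close>), give it this label; this uses up one output per input, so there remain more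
  outputs than undetermined inputs. In the end a remaining output is either constant, and one label
  is impossible, or the majority of three undetermined inputs. In terms of signs, majority is the sign
  of the sum of the three inputs. The rows of these sums are more numerous than the inputs, hence
  linearly dependent, and labelling the outputs with the signs of the coefficients S of a vanishing
  combination is impossible: each row would contribute a positive amount. It suffices that the
  combination u of the rows with coefficients S satisfies \<open>|u| < |S|\<close> in the 1-norm. Such small integers
  S are found by a perceptron that adds up sign vectors s chosen against the current u, where the
  coefficient of greatest modulus in an unknown dependency is guessed and always gets the sign 1.

  The algorithm is written in a language whose only loops have as many iterations as the input is long,
  so that its running time on a Turing machine is polynomial by construction. Outputs are recognised
  to be forcing, and the three inputs of a majority found, by evaluating the circuit on inputs that are
  constant up to at most two positions; monotonicity makes these tests conclusive.
\<close>

section \<open>Control structures with time bounds, compiled to Turing machine commands\<close>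

section \<open>Structured Turing machine programs\<close>

text \<open>Any nonzero integral kernel vector would serve as S, but the general bounds on its
  entries are exponential, and integers are unary counters here. A perceptron needs only additions
  and sign tests. After T rounds the 1-norm of u is of order sqrt T, whereas S has the entry T at
  the guessed position, so polynomially many rounds suffice; \<open>L ^ 4\<close>, with
  \<open>L\<close> the length of the encoding, is a power of \<open>L\<close> beyond the threshold.
  Array cells hold three symbols only, so u is never stored: the signs of all rounds are kept and u
  is recomputed from them.

  Failed forcing tests turn a remaining output into a majority: by monotonicity it is false if at
  most one undetermined input is true, and true if at most one is false; with at most two inputs
  both could happen at once. Constant outputs need no treatment of their own: any undetermined
  input, possibly a dummy, passes a test with them, and they get the label that they never
  take.\<close>

datatype tprog =
    Do "nat \<Rightarrow> nat \<Rightarrow> nat \<times> move"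
  | TSeq tprog tprog
  | TIf nat "nat \<Rightarrow> bool" tprog tprog
  | TWhile nat "nat \<Rightarrow> bool" tprog

fun tsize :: "tprog \<Rightarrow> nat" where
  "tsize (Do f) = 1"
| "tsize (TSeq p q) = tsize p + tsize q"
| "tsize (TIf i P p q) = tsize p + tsize q + 2"
| "tsize (TWhile i P p) = tsize p + 2"

definition stay :: "nat \<Rightarrow> nat list \<Rightarrow> (nat \<times> move) list" where
  "stay k ss = map (\<lambda>j. (ss ! j, Stay)) [0..<k]"

text \<open>Jump targets are absolute, \<open>q\<close> being the address of the first command. A
  block is left by reaching \<open>q + tsize p\<close>, so sequencing is concatenation and a whole
  program ends in the halting state \<open>length M\<close>.\<close>

fun tcode :: "nat \<Rightarrow> nat \<Rightarrow> tprog \<Rightarrow> machine" where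
  "tcode k q (Do f) = [\<lambda>ss. (Suc q, map (\<lambda>j. f j (ss ! j)) [0..<k])]"
| "tcode k q (TSeq p p') = tcode k q p @ tcode k (q + tsize p) p'"
| "tcode k q (TIf i P p p') =
     [\<lambda>ss. (if P (ss ! i) then Suc q else q + tsize p + 2, stay k ss)] @ tcode k (Suc q) p @
     [\<lambda>ss. (q + tsize p + 2 + tsize p', stay k ss)] @ tcode k (q + tsize p + 2) p'"
| "tcode k q (TWhile i P p) =
     [\<lambda>ss. (if P (ss ! i) then Suc q else q + tsize p + 2, stay k ss)] @ tcode k (Suc q) p @
     [\<lambda>ss. (q, stay k ss)]"

fun twf :: "nat \<Rightarrow> nat \<Rightarrow> tprog \<Rightarrow> bool" where
  "twf k G (Do f) \<longleftrightarrow> (\<forall>j<k. \<forall>s<G. fst (f j s) < G)"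
| "twf k G (TSeq p q) \<longleftrightarrow> twf k G p \<and> twf k G q"
| "twf k G (TIf i P p q) \<longleftrightarrow> i < k \<and> twf k G p \<and> twf k G q"
| "twf k G (TWhile i P p) \<longleftrightarrow> i < k \<and> twf k G p"

text \<open>\<open>texec p T t T'\<close>: started on the tapes \<open>T\<close>, the program p halts within t steps on \<open>T'\<close>.\<close>

inductive texec :: "tprog \<Rightarrow> (nat \<Rightarrow> tape) \<Rightarrow> nat \<Rightarrow> (nat \<Rightarrow> tape) \<Rightarrow> bool" where
  Do: "texec (Do f) T 1 (\<lambda>j. act (f j (scanned (T j))) (T j))"
| Seq: "texec p T t T' \<Longrightarrow> texec q T' t' T'' \<Longrightarrow> texec (TSeq p q) T (t + t') T''"
| IfT: "P (scanned (T i)) \<Longrightarrow> texec p T t T' \<Longrightarrow> texec (TIf i P p q) T (t + 2) T'"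
| IfF: "\<not> P (scanned (T i)) \<Longrightarrow> texec q T t T' \<Longrightarrow> texec (TIf i P p q) T (t + 1) T'"
| WhileF: "\<not> P (scanned (T i)) \<Longrightarrow> texec (TWhile i P p) T 1 T"
| WhileT: "P (scanned (T i)) \<Longrightarrow> texec p T t T' \<Longrightarrow> texec (TWhile i P p) T' t' T'' \<Longrightarrow>
           texec (TWhile i P p) T (t + t' + 2) T''"
| Weaken: "texec p T t T' \<Longrightarrow> t \<le> t' \<Longrightarrow> texec p T t' T'"

lemma length_tcode [simp]: "length (tcode k q p) = tsize p"
  by (induction p arbitrary: q) auto

definition tapes :: "nat \<Rightarrow> (nat \<Rightarrow> tape) \<Rightarrow> tape list" where
  "tapes k T = map T [0..<k]"

lemma scanned_tapes: "i < k \<Longrightarrow> map scanned (tapes k T) ! i = scanned (T i)"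
  by (simp add: tapes_def)

lemma act_stay [simp]: "act (scanned tp, Stay) tp = tp"
  by (cases tp) simp

lemma map2_act_tapes:
  "map2 act (map f [0..<k]) (tapes k T) = tapes k (\<lambda>j. act (f j) (T j))"
  by (rule nth_equalityI) (simp_all add: tapes_def)

lemma map2_stay: "map2 act (stay k (map scanned (tapes k T))) (tapes k T) = tapes k T"
  by (rule nth_equalityI) (simp_all add: stay_def tapes_def)

lemma funpow_one: "((f :: 'a \<Rightarrow> 'a) ^^ 1) x = f x"
  by simp

lemma step_Cons:
  assumes "M = pre @ f # post" and "length pre = q" and "f (map scanned tps) = (q', as)"
  shows "step M (q, tps) = (q', map2 act as tps)"
  using assms by (auto simp: nth_append)

lemma funpow_le_add:
  fixes f :: "'a \<Rightarrow> 'a"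
  assumes "(f ^^ a) x = y" "(f ^^ b) y = z"
  shows "(f ^^ (a + b)) x = z"
  using assms by (metis add.commute comp_apply funpow_add)

text \<open>Only some number of steps within the bound can be claimed: other commands may follow the
  block, so the machine cannot idle until time \<open>t\<close>.\<close>

lemma texec_steps:
  assumes "texec p T t T'" "twf k G p" "M = M1 @ tcode k q p @ M2" "length M1 = q"
  shows "\<exists>t0\<le>t. (step M ^^ t0) (q, tapes k T) = (q + tsize p, tapes k T')"
  using assms
proof (induction arbitrary: M1 M2 q rule: texec.induct)
  case (Do f T)
  have "step M (q, tapes k T) = (Suc q, map2 act (map (\<lambda>j. f j (map scanned (tapes k T) ! j)) [0..<k]) (tapes k T))"
    by (rule step_Cons[where pre = M1 and post = M2]) (use Do in auto)
  also have "map (\<lambda>j. f j (map scanned (tapes k T) ! j)) [0..<k] = map (\<lambda>j. f j (scanned (T j))) [0..<k]"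
    by (simp add: scanned_tapes)
  finally have "(step M ^^ 1) (q, tapes k T) = (q + tsize (Do f), tapes k (\<lambda>j. act (f j (scanned (T j))) (T j)))"
    by (simp add: map2_act_tapes)
  then show ?case by blast
next
  case (Seq p T t T' p' t' T'')
  obtain a where a: "a \<le> t" "(step M ^^ a) (q, tapes k T) = (q + tsize p, tapes k T')"
    using Seq.IH(1)[of M1 q "tcode k (q + tsize p) p' @ M2"] Seq.prems by auto
  obtain b where b: "b \<le> t'" "(step M ^^ b) (q + tsize p, tapes k T') = (q + tsize p + tsize p', tapes k T'')"
    using Seq.IH(2)[of "M1 @ tcode k q p" "q + tsize p" M2] Seq.prems by auto
  show ?case using funpow_le_add[OF a(2) b(2)] a(1) b(1)
    by (intro exI[of _ "a + b"]) auto
next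
  case (IfT P T i p t T' p')
  have i: "i < k" using IfT.prems by simp
  have s1: "(step M ^^ 1) (q, tapes k T) = (Suc q, tapes k T)"
    unfolding funpow_one
    by (subst step_Cons[where pre = M1]) (use IfT i in \<open>auto simp: scanned_tapes map2_stay\<close>)
  obtain a where a: "a \<le> t" "(step M ^^ a) (Suc q, tapes k T) = (Suc q + tsize p, tapes k T')"
    using IfT.IH[of "M1 @ [\<lambda>ss. (if P (ss ! i) then Suc q else q + tsize p + 2, stay k ss)]" "Suc q"
        "[\<lambda>ss. (q + tsize p + 2 + tsize p', stay k ss)] @ tcode k (q + tsize p + 2) p' @ M2"] IfT.prems
    by auto
  have s2: "(step M ^^ 1) (Suc q + tsize p, tapes k T') = (q + tsize (TIf i P p p'), tapes k T')"
    unfolding funpow_one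
    by (subst step_Cons[where pre = "M1 @ [\<lambda>ss. (if P (ss ! i) then Suc q else q + tsize p + 2, stay k ss)] @ tcode k (Suc q) p"])
      (use IfT in \<open>auto simp: map2_stay\<close>)
  show ?case using funpow_le_add[OF funpow_le_add[OF s1 a(2)] s2] a(1)
    by (intro exI[of _ "1 + a + 1"]) auto
next
  case (IfF P T i p' t T' p)
  have i: "i < k" using IfF.prems by simp
  have s1: "(step M ^^ 1) (q, tapes k T) = (q + tsize p + 2, tapes k T)"
    unfolding funpow_one
    by (subst step_Cons[where pre = M1]) (use IfF i in \<open>auto simp: scanned_tapes map2_stay\<close>)
  obtain a where a: "a \<le> t" "(step M ^^ a) (q + tsize p + 2, tapes k T) = (q + tsize p + 2 + tsize p', tapes k T')"
    using IfF.IH[of "M1 @ [\<lambda>ss. (if P (ss ! i) then Suc q else q + tsize p + 2, stay k ss)] @ tcode k (Suc q) p @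
        [\<lambda>ss. (q + tsize p + 2 + tsize p', stay k ss)]" "q + tsize p + 2" M2] IfF.prems
    by auto
  show ?case using funpow_le_add[OF s1 a(2)] a(1)
    by (intro exI[of _ "1 + a"]) auto
next
  case (WhileF P T i p)
  have i: "i < k" using WhileF.prems by simp
  have s1: "(step M ^^ 1) (q, tapes k T) = (q + tsize p + 2, tapes k T)"
    unfolding funpow_one
    by (subst step_Cons[where pre = M1]) (use WhileF i in \<open>auto simp: scanned_tapes map2_stay\<close>)
  then show ?case by (intro exI[of _ 1]) auto
next
  case (WhileT P T i p t T' t' T'')
  have i: "i < k" using WhileT.prems by simp
  have s1: "(step M ^^ 1) (q, tapes k T) = (Suc q, tapes k T)"
    unfolding funpow_one
    by (subst step_Cons[where pre = M1]) (use WhileT i in \<open>auto simp: scanned_tapes map2_stay\<close>)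
  obtain a where a: "a \<le> t" "(step M ^^ a) (Suc q, tapes k T) = (Suc q + tsize p, tapes k T')"
    using WhileT.IH(1)[of "M1 @ [\<lambda>ss. (if P (ss ! i) then Suc q else q + tsize p + 2, stay k ss)]" "Suc q"
        "[\<lambda>ss. (q, stay k ss)] @ M2"] WhileT.prems
    by auto
  have s2: "(step M ^^ 1) (Suc q + tsize p, tapes k T') = (q, tapes k T')"
    unfolding funpow_one
    by (subst step_Cons[where pre = "M1 @ [\<lambda>ss. (if P (ss ! i) then Suc q else q + tsize p + 2, stay k ss)] @ tcode k (Suc q) p"])
      (use WhileT in \<open>auto simp: map2_stay\<close>)
  obtain b where b: "b \<le> t'" "(step M ^^ b) (q, tapes k T') = (q + tsize (TWhile i P p), tapes k T'')"
    using WhileT.IH(2)[OF WhileT.prems] by auto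
  show ?case using funpow_le_add[OF funpow_le_add[OF funpow_le_add[OF s1 a(2)] s2] b(2)] a(1) b(1)
    by (intro exI[of _ "1 + a + 1 + b"]) auto
next
  case (Weaken p T t T' t')
  from Weaken.IH[OF Weaken.prems] Weaken.hyps show ?case by (meson order_trans)
qed

lemma stay_wf:
  assumes "length ss = k" "set ss \<subseteq> {..<G}"
  shows "length (stay k ss) = k" "s \<in> set (stay k ss) \<Longrightarrow> fst s < G"
proof -
  have "ss ! j < G" if "j < k" for j
    using assms that nth_mem[of j ss] by blast
  then show "length (stay k ss) = k" "s \<in> set (stay k ss) \<Longrightarrow> fst s < G"
    by (auto simp: stay_def)
qed

lemma tcode_wf:
  assumes "twf k G p" "c \<in> set (tcode k q p)" "length ss = k" "set ss \<subseteq> {..<G}"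
  shows "fst (c ss) \<le> q + tsize p \<and> length (snd (c ss)) = k \<and> (\<forall>s \<in> set (snd (c ss)). fst s < G)"
  using assms(1,2)
proof (induction p arbitrary: q)
  case (Do f)
  have "ss ! j < G" if "j < k" for j
    using assms(3,4) that nth_mem[of j ss] by blast
  then show ?case using Do by auto
next
  case (TSeq p1 p2)
  from TSeq.prems(2) consider "c \<in> set (tcode k q p1)" | "c \<in> set (tcode k (q + tsize p1) p2)"
    by auto
  then show ?case
  proof cases
    case 1
    with TSeq.IH(1)[of q] TSeq.prems show ?thesis by fastforce
  next
    case 2
    with TSeq.IH(2)[of "q + tsize p1"] TSeq.prems show ?thesis by fastforce
  qed
next
  case (TIf i P p1 p2)
  from TIf.prems(2) consider "c \<in> set (tcode k (Suc q) p1)" | "c \<in> set (tcode k (q + tsize p1 + 2) p2)"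
    | "snd (c ss) = stay k ss" "fst (c ss) \<le> q + tsize (TIf i P p1 p2)"
    by auto
  then show ?case
  proof cases
    case 1
    with TIf.IH(1)[of "Suc q"] TIf.prems show ?thesis by fastforce
  next
    case 2
    with TIf.IH(2)[of "q + tsize p1 + 2"] TIf.prems show ?thesis by fastforce
  next
    case 3
    with stay_wf[OF assms(3,4)] show ?thesis by auto
  qed
next
  case (TWhile i P p)
  from TWhile.prems(2) consider "c \<in> set (tcode k (Suc q) p)"
    | "snd (c ss) = stay k ss" "fst (c ss) \<le> q + tsize (TWhile i P p)"
    by auto
  then show ?case
  proof cases
    case 1
    with TWhile.IH[of "Suc q"] TWhile.prems show ?thesis by fastforce
  next
    case 2
    with stay_wf[OF assms(3,4)] show ?thesis by auto
  qed
qed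

lemma turing_machine_tcode:
  assumes "twf k G p" "k \<ge> 2" "G \<ge> 3"
  shows "turing_machine k G (tcode k 0 p)"
  using assms(2,3) tcode_wf[OF assms(1), of _ 0] unfolding turing_machine_def by auto

lemma step_halted: "(step M ^^ t) (length M, tps) = (length M, tps)"
  by (induction t) auto

lemma texec_outputs_within:
  assumes "texec p T t T'" "twf k G p" "start_config k w = (0, tapes k T)" "k \<ge> 2"
    "fst (T' 1) = word_tape y"
  shows "outputs_within k (tcode k 0 p) w y t"
proof -
  obtain t0 where t0: "t0 \<le> t" "(step (tcode k 0 p) ^^ t0) (0, tapes k T) = (tsize p, tapes k T')"
    using texec_steps[OF assms(1,2), of "tcode k 0 p" "[]" 0 "[]"] by auto
  have "(step (tcode k 0 p) ^^ (t0 + (t - t0))) (0, tapes k T) = (tsize p, tapes k T')"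
    by (rule funpow_le_add[OF t0(2)]) (metis step_halted length_tcode)
  moreover have "tapes k T' ! 1 = T' 1"
    using assms(4) by (simp add: tapes_def)
  ultimately show ?thesis
    using t0(1) assms(3,5) by (simp add: outputs_within_def)
qed

section \<open>Loop programs over counters and ternary arrays, and their compilation\<close>

section \<open>A loop language with automatic polynomial time bounds\<close>

type_synonym state = "(nat \<Rightarrow> nat) \<times> (nat \<Rightarrow> nat \<Rightarrow> nat)"

datatype com =
    Skip
  | Inc nat
  | Dec nat
  | Clear nat
  | Copy nat nat
  | Put nat nat nat
  | IfZ nat com com
  | IfA nat nat nat com com
  | Semi com com  (infixr \<open>;;\<close> 60)
  | Loop com

fun sem :: "nat \<Rightarrow> com \<Rightarrow> state \<Rightarrow> state" where
  "sem L Skip s = s"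
| "sem L (Inc x) (c, a) = (c(x := Suc (c x)), a)"
| "sem L (Dec x) (c, a) = (c(x := c x - 1), a)"
| "sem L (Clear x) (c, a) = (c(x := 0), a)"
| "sem L (Copy x y) (c, a) = (c(x := c y), a)"
| "sem L (Put A x v) (c, a) = (c, a(A := (a A)(c x := v)))"
| "sem L (IfZ x p q) s = (if fst s x = 0 then sem L p s else sem L q s)"
| "sem L (IfA A x v p q) s = (if snd s A (fst s x) = v then sem L p s else sem L q s)"
| "sem L (p ;; q) s = sem L q (sem L p s)"
| "sem L (Loop p) s = (sem L p ^^ L) s"

text \<open>\<open>d\<close> bounds the nesting of loops, as every nesting level owns a control
  tape. Copying clears its target first, hence \<open>x \<noteq> y\<close>.\<close>

fun wf_com :: "nat \<Rightarrow> nat \<Rightarrow> nat \<Rightarrow> com \<Rightarrow> bool" where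
  "wf_com NA NX d Skip \<longleftrightarrow> True"
| "wf_com NA NX d (Inc x) \<longleftrightarrow> x < NX"
| "wf_com NA NX d (Dec x) \<longleftrightarrow> x < NX"
| "wf_com NA NX d (Clear x) \<longleftrightarrow> x < NX"
| "wf_com NA NX d (Copy x y) \<longleftrightarrow> x < NX \<and> y < NX \<and> x \<noteq> y"
| "wf_com NA NX d (Put A x v) \<longleftrightarrow> A < NA \<and> x < NX \<and> v < 3"
| "wf_com NA NX d (IfZ x p q) \<longleftrightarrow> x < NX \<and> wf_com NA NX d p \<and> wf_com NA NX d q"
| "wf_com NA NX d (IfA A x v p q) \<longleftrightarrow> A < NA \<and> x < NX \<and> wf_com NA NX d p \<and> wf_com NA NX d q"
| "wf_com NA NX d (p ;; q) \<longleftrightarrow> wf_com NA NX d p \<and> wf_com NA NX d q"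
| "wf_com NA NX d (Loop p) \<longleftrightarrow> d > 0 \<and> wf_com NA NX (d - 1) p"

text \<open>\<open>ops c L\<close> bounds the number of increments, hence the growth of the counters.\<close>

fun ops :: "com \<Rightarrow> nat \<Rightarrow> nat" where
  "ops (IfZ x p q) L = ops p L + ops q L"
| "ops (IfA A x v p q) L = ops p L + ops q L"
| "ops (p ;; q) L = ops p L + ops q L"
| "ops (Loop p) L = L * ops p L"
| "ops _ L = 1"

text \<open>\<open>b\<close> bounds the counters during the run; it enters because reaching an array
  cell takes time linear in its index. The costs of both branches are added, since a maximum of
  polynomials need not be a polynomial.\<close>

fun cost :: "com \<Rightarrow> nat \<Rightarrow> nat \<Rightarrow> nat" where
  "cost (IfZ x p q) L b = cost p L b + cost q L b + 2"
| "cost (IfA A x v p q) L b = cost p L b + cost q L b + 6 * b + 4"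
| "cost (p ;; q) L b = cost p L b + cost q L b"
| "cost (Loop p) L b = L * (cost p L b + 3) + 3 * L + 6"
| "cost _ L b = 9 * b + 9"

definition is_poly :: "(nat \<Rightarrow> nat) \<Rightarrow> bool" where
  "is_poly f \<longleftrightarrow> (\<exists>p. \<forall>x. f x = poly p x)"

lemma is_poly_const [intro]: "is_poly (\<lambda>_. c)"
  unfolding is_poly_def by (rule exI[of _ "[:c:]"]) simp

lemma is_poly_id [intro]: "is_poly (\<lambda>x. x)"
  unfolding is_poly_def by (rule exI[of _ "[:0, 1:]"]) simp

lemma is_poly_add [intro]: "is_poly f \<Longrightarrow> is_poly g \<Longrightarrow> is_poly (\<lambda>x. f x + g x)"
  unfolding is_poly_def by (metis poly_add)

lemma is_poly_mult [intro]: "is_poly f \<Longrightarrow> is_poly g \<Longrightarrow> is_poly (\<lambda>x. f x * g x)"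
  unfolding is_poly_def by (metis poly_mult)

lemmas is_poly_intros = is_poly_const is_poly_id is_poly_add is_poly_mult

lemma is_poly_ops:
  assumes "is_poly f"
  shows "is_poly (\<lambda>L. ops c (f L))"
  by (induction c) (simp_all only: ops.simps, (assumption | rule is_poly_intros assms)+)

lemma is_poly_cost:
  assumes "is_poly f"
  shows "is_poly (\<lambda>L. cost c L (f L))"
  by (induction c) (simp_all only: cost.simps, (assumption | rule is_poly_intros assms)+)

subsection \<open>Tape layout\<close>

definition atape :: "(nat \<Rightarrow> nat) \<Rightarrow> tape" where
  "atape f = ((\<lambda>p. if p \<ge> 0 then f (nat p) else 0), 0)"

text \<open>The value is stored in the head position alone; the only mark, at position 0, makes the
  zero test possible.\<close>

definition ctape :: "int \<Rightarrow> tape" where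
  "ctape v = ((\<lambda>p. if p = 0 then 1 else 0), v)"

text \<open>A ruler as long as the input: a loop counts its iterations by walking along it and
  notices the end by the blank.\<close>

definition ltape :: "nat \<Rightarrow> int \<Rightarrow> tape" where
  "ltape L v = ((\<lambda>p. if 0 \<le> p \<and> p < int L then 1 else 0), v)"

text \<open>Tape \<open>NA + NX\<close> is a scratch counter; the tapes after it control the loops, one per nesting level.\<close>

definition layout :: "nat \<Rightarrow> nat \<Rightarrow> nat \<Rightarrow> state \<Rightarrow> (nat \<Rightarrow> int) \<Rightarrow> nat \<Rightarrow> tape" where
  "layout NA NX L s e j =
     (if j < NA then atape (snd s j)
      else if j < NA + NX then ctape (int (fst s (j - NA)))
      else if j = NA + NX then ctape 0
      else ltape L (e (j - (NA + NX + 1))))"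

fun dir :: "move \<Rightarrow> int" where
  "dir Move_Left = -1" | "dir Stay = 0" | "dir Move_Right = 1"

definition Moves :: "(nat \<Rightarrow> move) \<Rightarrow> tprog" where
  "Moves \<delta> = Do (\<lambda>j s. (s, \<delta> j))"

lemma move_head_dir: "move_head m i = i + dir m"
  by (cases m) auto

lemma act_scanned: "act (scanned tp, m) tp = (fst tp, snd tp + dir m)"
  by (cases tp) (simp add: move_head_dir)

lemma texec_Moves: "texec (Moves \<delta>) T 1 (\<lambda>j. (fst (T j), snd (T j) + dir (\<delta> j)))"
  using texec.Do[of "\<lambda>j s. (s, \<delta> j)" T] unfolding Moves_def act_scanned .

lemma texec_conv: "texec p T t T' \<Longrightarrow> t \<le> t' \<Longrightarrow> T' = T'' \<Longrightarrow> texec p T t' T''"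
  using texec.Weaken by blast

text \<open>The one loop behind clearing, copying and array access: the counter on \<open>X\<close>
  runs down to its mark and carries other heads along. A round costs one move and two steps of
  control, the last test one step.\<close>

lemma texec_count_down:
  assumes "T X = ctape (int v)" "\<delta> X = Move_Left"
  shows "texec (TWhile X (\<lambda>s. s \<noteq> 1) (Moves \<delta>)) T (3 * v + 1)
           (\<lambda>j. (fst (T j), snd (T j) + int v * dir (\<delta> j)))"
  using assms(1)
proof (induction v arbitrary: T)
  case 0
  have "texec (TWhile X (\<lambda>s. s \<noteq> 1) (Moves \<delta>)) T 1 T"
    by (rule texec.WhileF) (simp add: 0 ctape_def)
  then show ?case by simp
next
  case (Suc v)
  let ?T = "\<lambda>j. (fst (T j), snd (T j) + dir (\<delta> j))"
  have "texec (TWhile X (\<lambda>s. s \<noteq> 1) (Moves \<delta>)) ?T (3 * v + 1)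
           (\<lambda>j. (fst (?T j), snd (?T j) + int v * dir (\<delta> j)))"
    by (rule Suc.IH) (simp add: Suc.prems assms(2) ctape_def)
  from texec.WhileT[OF _ texec_Moves this]
  have "texec (TWhile X (\<lambda>s. s \<noteq> 1) (Moves \<delta>)) T (1 + (3 * v + 1) + 2)
           (\<lambda>j. (fst (?T j), snd (?T j) + int v * dir (\<delta> j)))"
    by (simp add: Suc.prems ctape_def)
  then show ?case by (rule texec_conv) (auto simp: fun_eq_iff algebra_simps)
qed

lemma texec_loop_back:
  assumes "T X = ltape L (int v - 1)" "v \<le> L" "\<delta> = (\<lambda>j. if j = X then Move_Left else Stay)"
  shows "texec (TWhile X (\<lambda>s. s = 1) (Moves \<delta>)) T (3 * v + 1) (T(X := ltape L (-1)))"
  using assms(1,2)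
proof (induction v arbitrary: T)
  case 0
  have "texec (TWhile X (\<lambda>s. s = 1) (Moves \<delta>)) T 1 T"
    by (rule texec.WhileF) (simp add: 0 ltape_def)
  then show ?case using 0 by (simp add: fun_upd_idem)
next
  case (Suc v)
  let ?T = "\<lambda>j. (fst (T j), snd (T j) + dir (\<delta> j))"
  have "texec (TWhile X (\<lambda>s. s = 1) (Moves \<delta>)) ?T (3 * v + 1) (?T(X := ltape L (-1)))"
    by (rule Suc.IH) (use Suc.prems in \<open>auto simp: assms(3) ltape_def\<close>)
  from texec.WhileT[OF _ texec_Moves this]
  have "texec (TWhile X (\<lambda>s. s = 1) (Moves \<delta>)) T (1 + (3 * v + 1) + 2) (?T(X := ltape L (-1)))"
    using Suc.prems by (simp add: ltape_def)
  moreover have "?T(X := ltape L (-1)) = T(X := ltape L (-1))"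
    by (auto simp: fun_eq_iff assms(3))
  ultimately show ?case by (auto intro: texec.Weaken simp del: fun_upd_apply)
qed

subsection \<open>Compilation\<close>

definition right :: "nat \<Rightarrow> tprog" where
  "right X = Moves (\<lambda>j. if j = X then Move_Right else Stay)"

definition left :: "nat \<Rightarrow> tprog" where
  "left X = Moves (\<lambda>j. if j = X then Move_Left else Stay)"

definition zero :: "nat \<Rightarrow> tprog" where
  "zero X = TWhile X (\<lambda>s. s \<noteq> 1) (left X)"

text \<open>The head of the array tape A is moved to the cell whose index is on X; the scratch counter Z
  remembers the way back.\<close>

definition goto :: "nat \<Rightarrow> nat \<Rightarrow> nat \<Rightarrow> tprog" where
  "goto Z A X = TWhile X (\<lambda>s. s \<noteq> 1)
     (Moves (\<lambda>j. if j = X then Move_Left else if j = A \<or> j = Z then Move_Right else Stay))"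

definition goback :: "nat \<Rightarrow> nat \<Rightarrow> nat \<Rightarrow> tprog" where
  "goback Z A X = TWhile Z (\<lambda>s. s \<noteq> 1)
     (Moves (\<lambda>j. if j = X then Move_Right else if j = A \<or> j = Z then Move_Left else Stay))"

text \<open>Reading a counter destroys it, so its value passes through the scratch counter, from
  which the original and the copy are filled together.\<close>

definition copy :: "nat \<Rightarrow> nat \<Rightarrow> nat \<Rightarrow> tprog" where
  "copy Z X Y = TSeq (zero X) (TSeq
     (TWhile Y (\<lambda>s. s \<noteq> 1) (Moves (\<lambda>j. if j = Y then Move_Left else if j = Z then Move_Right else Stay)))
     (TWhile Z (\<lambda>s. s \<noteq> 1) (Moves (\<lambda>j. if j = Z then Move_Left else if j = X \<or> j = Y then Move_Right else Stay))))"

text \<open>\<open>d\<close> is the number of enclosing loops and selects the control tape.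
  \<open>IfA\<close> moves the array head back inside both branches, because the decision is made
  while it is away. After a loop the head on the ruler is rewound through position -1 to 0, so that
  an outer loop can enter the loop again.\<close>

fun comp :: "nat \<Rightarrow> nat \<Rightarrow> nat \<Rightarrow> com \<Rightarrow> tprog" where
  "comp NA NX d Skip = Moves (\<lambda>j. Stay)"
| "comp NA NX d (Inc x) = right (NA + x)"
| "comp NA NX d (Dec x) = TIf (NA + x) (\<lambda>s. s = 1) (Moves (\<lambda>j. Stay)) (left (NA + x))"
| "comp NA NX d (Clear x) = zero (NA + x)"
| "comp NA NX d (Copy x y) = copy (NA + NX) (NA + x) (NA + y)"
| "comp NA NX d (Put A x v) =
     TSeq (goto (NA + NX) A (NA + x))
       (TSeq (Do (\<lambda>j s. (if j = A then v else s, Stay))) (goback (NA + NX) A (NA + x)))"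
| "comp NA NX d (IfZ x p q) = TIf (NA + x) (\<lambda>s. s = 1) (comp NA NX d p) (comp NA NX d q)"
| "comp NA NX d (IfA A x v p q) =
     TSeq (goto (NA + NX) A (NA + x))
       (TIf A (\<lambda>s. s = v)
         (TSeq (goback (NA + NX) A (NA + x)) (comp NA NX d p))
         (TSeq (goback (NA + NX) A (NA + x)) (comp NA NX d q)))"
| "comp NA NX d (p ;; q) = TSeq (comp NA NX d p) (comp NA NX d q)"
| "comp NA NX d (Loop p) =
     (let X = NA + NX + 1 + d in
      TSeq (TWhile X (\<lambda>s. s = 1) (TSeq (comp NA NX (Suc d) p) (right X)))
        (TSeq (left X) (TSeq (TWhile X (\<lambda>s. s = 1) (left X)) (right X))))"

lemma twf_Moves [simp]: "twf k G (Moves \<delta>)"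
  by (simp add: Moves_def)

lemma twf_comp:
  assumes "wf_com NA NX n c" "NA + NX + 1 + d + n \<le> k"
  shows "twf k 3 (comp NA NX d c)"
  using assms
  by (induction c arbitrary: d n)
    (auto simp: Let_def left_def right_def zero_def goto_def goback_def copy_def)

definition cbound :: "state \<Rightarrow> nat \<Rightarrow> bool" where
  "cbound s b \<longleftrightarrow> (\<forall>x. fst s x \<le> b)"

lemma cbound_sem: "cbound s b \<Longrightarrow> cbound (sem L c s) (b + ops c L)"
proof (induction c arbitrary: s b)
  case (Semi p q)
  then show ?case by (metis ab_semigroup_add_class.add_ac(1) ops.simps(3) sem.simps(9))
next
  case (Loop p)
  have "cbound ((sem L p ^^ n) s) (b + n * ops p L)" for n
  proof (induction n)
    case (Suc n)
    then show ?case using Loop.IH[OF Suc] by (simp add: algebra_simps)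
  qed (simp add: Loop.prems)
  then show ?case by simp
next
  case (IfZ x p q)
  have "cbound (sem L p s) (b + ops p L)" "cbound (sem L q s) (b + ops q L)"
    using IfZ by auto
  then show ?case by (fastforce simp: cbound_def intro: order_trans)
next
  case (IfA A x v p q)
  have "cbound (sem L p s) (b + ops p L)" "cbound (sem L q s) (b + ops q L)"
    using IfA by auto
  then show ?case by (fastforce simp: cbound_def intro: order_trans)
qed (cases s; auto simp: cbound_def le_SucI intro: le_diff_conv[THEN iffD2] le_trans[OF diff_le_self])+

lemma texec_goto:
  assumes "T X = ctape (int v)" "X \<noteq> A" "X \<noteq> Z" "A \<noteq> Z" "T Z = ctape 0"
  shows "texec (goto Z A X) T (3 * v + 1)
    (T(X := ctape 0, A := (fst (T A), snd (T A) + int v), Z := ctape (int v)))"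
proof -
  have "(\<lambda>j. (fst (T j), snd (T j) + int v * dir (if j = X then Move_Left else if j = A \<or> j = Z then Move_Right else Stay)))
    = T(X := ctape 0, A := (fst (T A), snd (T A) + int v), Z := ctape (int v))"
    using assms by (auto simp: fun_eq_iff ctape_def)
  with texec_count_down[of T X v "\<lambda>j. if j = X then Move_Left else if j = A \<or> j = Z then Move_Right else Stay"] assms
  show ?thesis by (simp add: goto_def)
qed

lemma texec_goback:
  assumes "T X = ctape 0" "X \<noteq> A" "X \<noteq> Z" "A \<noteq> Z" "T Z = ctape (int v)"
  shows "texec (goback Z A X) T (3 * v + 1)
    (T(X := ctape (int v), A := (fst (T A), snd (T A) - int v), Z := ctape 0))"
proof -
  have "(\<lambda>j. (fst (T j), snd (T j) + int v * dir (if j = X then Move_Right else if j = A \<or> j = Z then Move_Left else Stay)))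
    = T(X := ctape (int v), A := (fst (T A), snd (T A) - int v), Z := ctape 0)"
    using assms by (auto simp: fun_eq_iff ctape_def)
  with texec_count_down[of T Z v "\<lambda>j. if j = X then Move_Right else if j = A \<or> j = Z then Move_Left else Stay"] assms
  show ?thesis by (simp add: goback_def)
qed

lemma texec_zero:
  assumes "T X = ctape (int v)"
  shows "texec (zero X) T (3 * v + 1) (T(X := ctape 0))"
proof -
  have "(\<lambda>j. (fst (T j), snd (T j) + int v * dir (if j = X then Move_Left else Stay))) = T(X := ctape 0)"
    using assms by (auto simp: fun_eq_iff ctape_def)
  with texec_count_down[of T X v "\<lambda>j. if j = X then Move_Left else Stay"] assms
  show ?thesis by (simp add: zero_def left_def)
qed

lemma texec_copy:
  assumes "T X = ctape (int u)" "T Y = ctape (int v)" "T Z = ctape 0" "X \<noteq> Y" "X \<noteq> Z" "Y \<noteq> Z"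
  shows "texec (copy Z X Y) T (3 * u + 1 + (3 * v + 1 + (3 * v + 1))) (T(X := ctape (int v)))"
proof -
  let ?T1 = "T(X := ctape 0)"
  let ?T2 = "?T1(Y := ctape 0, Z := ctape (int v))"
  have 1: "texec (zero X) T (3 * u + 1) ?T1" by (rule texec_zero) fact
  have 2: "texec (TWhile Y (\<lambda>s. s \<noteq> 1) (Moves (\<lambda>j. if j = Y then Move_Left else if j = Z then Move_Right else Stay)))
      ?T1 (3 * v + 1) ?T2"
  proof -
    have "(\<lambda>j. (fst (?T1 j), snd (?T1 j) + int v * dir (if j = Y then Move_Left else if j = Z then Move_Right else Stay))) = ?T2"
      using assms by (auto simp: fun_eq_iff ctape_def)
    with texec_count_down[of ?T1 Y v "\<lambda>j. if j = Y then Move_Left else if j = Z then Move_Right else Stay"] assms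
    show ?thesis by simp
  qed
  have 3: "texec (TWhile Z (\<lambda>s. s \<noteq> 1) (Moves (\<lambda>j. if j = Z then Move_Left else if j = X \<or> j = Y then Move_Right else Stay)))
      ?T2 (3 * v + 1) (T(X := ctape (int v)))"
  proof -
    have "(\<lambda>j. (fst (?T2 j), snd (?T2 j) + int v * dir (if j = Z then Move_Left else if j = X \<or> j = Y then Move_Right else Stay))) = T(X := ctape (int v))"
      using assms by (auto simp: fun_eq_iff ctape_def)
    with texec_count_down[of ?T2 Z v "\<lambda>j. if j = Z then Move_Left else if j = X \<or> j = Y then Move_Right else Stay"] assms
    show ?thesis by simp
  qed
  show ?thesis unfolding copy_def
    using texec.Seq[OF 1 texec.Seq[OF 2 3]] by simp
qed

lemma layout_counter:
  "x < NX \<Longrightarrow> layout NA NX L (c(x := v), a) e = (layout NA NX L (c, a) e)(NA + x := ctape (int v))"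
  by (auto simp: fun_eq_iff layout_def)

lemma layout_array:
  "A < NA \<Longrightarrow> layout NA NX L (c, a(A := f)) e = (layout NA NX L (c, a) e)(A := atape f)"
  by (auto simp: fun_eq_iff layout_def)

lemma layout_loop:
  "layout NA NX L s (e(d := v)) = (layout NA NX L s e)(NA + NX + 1 + d := ltape L v)"
  by (auto simp: fun_eq_iff layout_def)

lemma layout_at [simp]:
  "x < NX \<Longrightarrow> layout NA NX L s e (NA + x) = ctape (int (fst s x))"
  "layout NA NX L s e (NA + NX) = ctape 0"
  "A < NA \<Longrightarrow> layout NA NX L s e A = atape (snd s A)"
  "layout NA NX L s e (Suc (NA + NX + d)) = ltape L (e d)"
  by (auto simp: layout_def)

lemma texec_right: "texec (right X) T 1 (T(X := (fst (T X), snd (T X) + 1)))"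
proof -
  have "(\<lambda>j. (fst (T j), snd (T j) + dir (if j = X then Move_Right else Stay))) = T(X := (fst (T X), snd (T X) + 1))"
    by auto
  then show ?thesis using texec_Moves[of "\<lambda>j. if j = X then Move_Right else Stay" T]
    by (simp add: right_def)
qed

lemma texec_left: "texec (left X) T 1 (T(X := (fst (T X), snd (T X) - 1)))"
proof -
  have "(\<lambda>j. (fst (T j), snd (T j) + dir (if j = X then Move_Left else Stay))) = T(X := (fst (T X), snd (T X) - 1))"
    by auto
  then show ?thesis using texec_Moves[of "\<lambda>j. if j = X then Move_Left else Stay" T]
    by (simp add: left_def)
qed

lemma texec_idle: "texec (Moves (\<lambda>j. Stay)) T 1 T"
  using texec_Moves[of "\<lambda>j. Stay" T] by simp

text \<open>\<open>e\<close> gives the positions on the rulers: those below \<open>d\<close> belong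
  to the enclosing loops and are arbitrary, the deeper ones rest at 0. The distance from
  \<open>b0\<close> to \<open>b\<close> is the room for the growth of the counters.\<close>

lemma texec_comp:
  assumes "wf_com NA NX n c" "cbound s b0" "b0 + ops c L \<le> b" "\<forall>j\<ge>d. e j = 0"
  shows "texec (comp NA NX d c) (layout NA NX L s e) (cost c L b) (layout NA NX L (sem L c s) e)"
  using assms
proof (induction c arbitrary: s b0 d e n)
  case Skip
  show ?case by (auto intro: texec.Weaken[OF texec_idle])
next
  case (Inc x)
  obtain c a where s: "s = (c, a)" by (cases s)
  have "(layout NA NX L s e)(NA + x := (fst (layout NA NX L s e (NA + x)), snd (layout NA NX L s e (NA + x)) + 1)) =
      layout NA NX L (sem L (Inc x) s) e"
    using Inc by (simp add: s layout_counter) (simp add: ctape_def add.commute)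
  then show ?case unfolding comp.simps by (rule texec_conv[OF texec_right, rotated]) simp
next
  case (Dec x)
  obtain c a where s: "s = (c, a)" by (cases s)
  show ?case
  proof (cases "c x = 0")
    case True
    have "texec (comp NA NX d (Dec x)) (layout NA NX L s e) (1 + 2) (layout NA NX L s e)"
      unfolding comp.simps
      by (rule texec.IfT[OF _ texec_idle]) (use Dec True in \<open>simp add: s ctape_def\<close>)
    moreover have "sem L (Dec x) s = s" using True by (simp add: s fun_upd_idem)
    ultimately show ?thesis by (auto intro: texec.Weaken)
  next
    case False
    have A: "texec (comp NA NX d (Dec x)) (layout NA NX L s e) (1 + 1)
        ((layout NA NX L s e)(NA + x := (fst (layout NA NX L s e (NA + x)), snd (layout NA NX L s e (NA + x)) - 1)))"
      unfolding comp.simps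
      by (rule texec.IfF[OF _ texec_left]) (use Dec False in \<open>simp add: s ctape_def\<close>)
    have B: "(layout NA NX L s e)(NA + x := (fst (layout NA NX L s e (NA + x)), snd (layout NA NX L s e (NA + x)) - 1)) =
        layout NA NX L (sem L (Dec x) s) e"
      using Dec False by (simp add: s layout_counter) (simp add: ctape_def of_nat_diff)
    show ?thesis by (rule texec_conv[OF A _ B]) simp
  qed
next
  case (Clear x)
  obtain c a where s: "s = (c, a)" by (cases s)
  have "texec (zero (NA + x)) (layout NA NX L s e) (3 * c x + 1) ((layout NA NX L s e)(NA + x := ctape 0))"
    by (rule texec_zero) (use Clear in \<open>simp add: s\<close>)
  moreover have "c x \<le> b0" using Clear by (simp add: cbound_def s)
  ultimately show ?case using Clear by (auto simp: s layout_counter simp del: fun_upd_apply intro: texec.Weaken)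
next
  case (Copy x y)
  obtain c a where s: "s = (c, a)" by (cases s)
  have "texec (copy (NA + NX) (NA + x) (NA + y)) (layout NA NX L s e)
      (3 * c x + 1 + (3 * c y + 1 + (3 * c y + 1))) ((layout NA NX L s e)(NA + x := ctape (int (c y))))"
    by (rule texec_copy) (use Copy in \<open>auto simp: s\<close>)
  moreover have "c x \<le> b0" "c y \<le> b0" using Copy by (auto simp: cbound_def s)
  ultimately show ?case using Copy by (auto simp: s layout_counter simp del: fun_upd_apply intro: texec.Weaken)
next
  case (Put A x v)
  obtain c a where s: "s = (c, a)" by (cases s)
  let ?T = "layout NA NX L s e" and ?X = "NA + x" and ?Z = "NA + NX"
  let ?T1 = "?T(?X := ctape 0, A := (fst (?T A), snd (?T A) + int (c x)), ?Z := ctape (int (c x)))"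
  let ?T2 = "?T1(A := ((fst (?T A))(snd (?T A) + int (c x) := v), snd (?T A) + int (c x)))"
  let ?T3 = "?T2(?X := ctape (int (c x)), A := (fst (?T2 A), snd (?T2 A) - int (c x)), ?Z := ctape 0)"
  have 1: "texec (goto ?Z A ?X) ?T (3 * c x + 1) ?T1"
    by (rule texec_goto) (use Put in \<open>auto simp: s\<close>)
  have "texec (Do (\<lambda>j s. (if j = A then v else s, Stay))) ?T1 1
      (\<lambda>j. act (if j = A then v else scanned (?T1 j), Stay) (?T1 j))"
    by (rule texec.Do)
  also have "(\<lambda>j. act (if j = A then v else scanned (?T1 j), Stay) (?T1 j)) = ?T2"
    using Put by (auto simp: fun_eq_iff)
  finally have 2: "texec (Do (\<lambda>j s. (if j = A then v else s, Stay))) ?T1 1 ?T2" .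
  have 3: "texec (goback ?Z A ?X) ?T2 (3 * c x + 1) ?T3"
    by (rule texec_goback) (use Put in \<open>auto simp: s\<close>)
  have "?T3 = layout NA NX L (sem L (Put A x v) s) e"
    using Put by (auto simp: fun_eq_iff s layout_array layout_def atape_def)
  moreover have "c x \<le> b0" using Put by (auto simp: cbound_def s)
  ultimately show ?case using texec.Seq[OF 1 texec.Seq[OF 2 3]] Put
    by (auto simp del: fun_upd_apply intro: texec.Weaken)
next
  case (IfZ x p q)
  show ?case
  proof (cases "fst s x = 0")
    case True
    have "texec (comp NA NX d p) (layout NA NX L s e) (cost p L b) (layout NA NX L (sem L p s) e)"
      by (rule IfZ.IH(1)[of n s b0]) (use IfZ.prems in auto)
    from texec.IfT[OF _ this, of "\<lambda>s. s = 1" "NA + x" "comp NA NX d q"]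
    show ?thesis using True IfZ.prems by (auto simp: ctape_def intro: texec.Weaken)
  next
    case False
    have "texec (comp NA NX d q) (layout NA NX L s e) (cost q L b) (layout NA NX L (sem L q s) e)"
      by (rule IfZ.IH(2)[of n s b0]) (use IfZ.prems in auto)
    from texec.IfF[OF _ this, of "\<lambda>s. s = 1" "NA + x" "comp NA NX d p"]
    show ?thesis using False IfZ.prems by (auto simp: ctape_def intro: texec.Weaken)
  qed
next
  case (IfA A x v p q)
  obtain c a where s: "s = (c, a)" by (cases s)
  let ?T = "layout NA NX L s e" and ?X = "NA + x" and ?Z = "NA + NX"
  let ?T1 = "?T(?X := ctape 0, A := (fst (?T A), snd (?T A) + int (c x)), ?Z := ctape (int (c x)))"
  let ?T3 = "?T1(?X := ctape (int (c x)), A := (fst (?T1 A), snd (?T1 A) - int (c x)), ?Z := ctape 0)"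
  have wf: "A < NA" "x < NX" using IfA.prems by auto
  have 1: "texec (goto ?Z A ?X) ?T (3 * c x + 1) ?T1"
    by (rule texec_goto) (use wf in \<open>auto simp: s\<close>)
  have "texec (goback ?Z A ?X) ?T1 (3 * c x + 1) ?T3"
    by (rule texec_goback) (use wf in \<open>auto simp: s\<close>)
  moreover have "?T3 = ?T"
    using wf by (auto simp: fun_eq_iff s layout_def)
  ultimately have 3: "texec (goback ?Z A ?X) ?T1 (3 * c x + 1) ?T" by metis
  have sc: "scanned (?T1 A) = a A (c x)"
    using wf by (auto simp: s atape_def)
  have cx: "c x \<le> b0" using IfA.prems by (auto simp: cbound_def s)
  show ?case
  proof (cases "a A (c x) = v")
    case True
    have 4: "texec (comp NA NX d p) ?T (cost p L b) (layout NA NX L (sem L p s) e)"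
      by (rule IfA.IH(1)[of n s b0]) (use IfA.prems in auto)
    have "texec (TIf A (\<lambda>s. s = v) (TSeq (goback ?Z A ?X) (comp NA NX d p)) (TSeq (goback ?Z A ?X) (comp NA NX d q)))
        ?T1 (3 * c x + 1 + cost p L b + 2) (layout NA NX L (sem L p s) e)"
      by (rule texec.IfT[OF _ texec.Seq[OF 3 4]]) (use sc True in simp)
    from texec.Seq[OF 1 this] show ?thesis
      using True cx IfA.prems by (auto simp: s simp del: fun_upd_apply intro: texec.Weaken)
  next
    case False
    have 4: "texec (comp NA NX d q) ?T (cost q L b) (layout NA NX L (sem L q s) e)"
      by (rule IfA.IH(2)[of n s b0]) (use IfA.prems in auto)
    have "texec (TIf A (\<lambda>s. s = v) (TSeq (goback ?Z A ?X) (comp NA NX d p)) (TSeq (goback ?Z A ?X) (comp NA NX d q)))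
        ?T1 (3 * c x + 1 + cost q L b + 1) (layout NA NX L (sem L q s) e)"
      by (rule texec.IfF[OF _ texec.Seq[OF 3 4]]) (use sc False in simp)
    from texec.Seq[OF 1 this] show ?thesis
      using False cx IfA.prems by (auto simp: s simp del: fun_upd_apply intro: texec.Weaken)
  qed
next
  case (Semi p q)
  have 1: "texec (comp NA NX d p) (layout NA NX L s e) (cost p L b) (layout NA NX L (sem L p s) e)"
    by (rule Semi.IH(1)[of n s b0]) (use Semi.prems in auto)
  have 2: "texec (comp NA NX d q) (layout NA NX L (sem L p s) e) (cost q L b) (layout NA NX L (sem L q (sem L p s)) e)"
    by (rule Semi.IH(2)[of n _ "b0 + ops p L"]) (use Semi.prems cbound_sem in auto)
  show ?case using texec.Seq[OF 1 2] by simp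
next
  case (Loop p)
  let ?X = "NA + NX + 1 + d"
  let ?body = "TSeq (comp NA NX (Suc d) p) (right ?X)"
  let ?s = "\<lambda>i. (sem L p ^^ i) s"
  let ?T = "\<lambda>i. layout NA NX L (?s i) (e(d := int i))"
  have bd: "cbound (?s i) (b0 + i * ops p L)" for i
  proof (induction i)
    case (Suc i)
    then show ?case using cbound_sem[OF Suc, of L p] by (simp add: algebra_simps)
  qed (simp add: Loop.prems)
  have body: "texec ?body (?T i) (cost p L b + 1) (?T (Suc i))" if "i < L" for i
  proof -
    \<comment> \<open>The earlier iterations have used at most \<open>i * ops p L\<close> of the
      room, which leaves enough for this one.\<close>
    have "Suc i * ops p L \<le> L * ops p L" using that by (intro mult_right_mono) auto
    then have "b0 + i * ops p L + ops p L \<le> b" using Loop.prems(3) by (simp add: algebra_simps)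
    have "texec (comp NA NX (Suc d) p) (?T i) (cost p L b) (layout NA NX L (sem L p (?s i)) (e(d := int i)))"
      by (rule Loop.IH[of "n - 1", OF _ bd[of i]]) (use Loop.prems \<open>b0 + i * ops p L + ops p L \<le> b\<close> in auto)
    then have 1: "texec (comp NA NX (Suc d) p) (?T i) (cost p L b) (layout NA NX L (?s (Suc i)) (e(d := int i)))"
      by simp
    let ?T' = "layout NA NX L (?s (Suc i)) (e(d := int i))"
    have "?T'(?X := (fst (?T' ?X), snd (?T' ?X) + 1)) = ?T (Suc i)"
      by (simp only: layout_loop) (auto simp: fun_eq_iff ltape_def)
    then show ?thesis using texec.Seq[OF 1 texec_right[of ?X ?T']] by metis
  qed
  have loop: "texec (TWhile ?X (\<lambda>s. s = 1) ?body) (?T i) ((L - i) * (cost p L b + 3) + 1) (?T L)" if "i \<le> L" for i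
    using that
  proof (induction i rule: inc_induct)
    case base
    have "texec (TWhile ?X (\<lambda>s. s = 1) ?body) (?T L) 1 (?T L)"
      by (rule texec.WhileF) (simp add: ltape_def)
    then show ?case by (simp del: fun_upd_apply)
  next
    case (step i)
    have "texec (TWhile ?X (\<lambda>s. s = 1) ?body) (?T i) (cost p L b + 1 + ((L - Suc i) * (cost p L b + 3) + 1) + 2) (?T L)"
      by (rule texec.WhileT[OF _ body step.IH]) (use step in \<open>auto simp: ltape_def\<close>)
    moreover have "L - i = Suc (L - Suc i)" using step by simp
    ultimately show ?case by (auto intro: texec.Weaken simp del: fun_upd_apply)
  qed
  let ?T1 = "layout NA NX L (?s L) (e(d := int L - 1))" and ?T2 = "layout NA NX L (?s L) (e(d := -1))"
  have e0: "e(d := 0) = e" using Loop.prems by (auto simp: fun_eq_iff)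
  have 1: "texec (TWhile ?X (\<lambda>s. s = 1) ?body) (layout NA NX L s e) (L * (cost p L b + 3) + 1) (?T L)"
    using loop[of 0] e0 by simp
  have "texec (left ?X) (?T L) 1 ((?T L)(?X := (fst (?T L ?X), snd (?T L ?X) - 1)))"
    by (rule texec_left)
  moreover have "(?T L)(?X := (fst (?T L ?X), snd (?T L ?X) - 1)) = ?T1"
    by (simp only: layout_loop) (auto simp: fun_eq_iff ltape_def)
  ultimately have 2: "texec (left ?X) (?T L) 1 ?T1" by metis
  have "texec (TWhile ?X (\<lambda>s. s = 1) (left ?X)) ?T1 (3 * L + 1) (?T1(?X := ltape L (-1)))"
    unfolding left_def by (rule texec_loop_back) auto
  moreover have "?T1(?X := ltape L (-1)) = ?T2"
    by (simp only: layout_loop) (auto simp: fun_eq_iff)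
  ultimately have 3: "texec (TWhile ?X (\<lambda>s. s = 1) (left ?X)) ?T1 (3 * L + 1) ?T2" by metis
  have "?T2(?X := (fst (?T2 ?X), snd (?T2 ?X) + 1)) = layout NA NX L (?s L) (e(d := 0))"
    by (simp only: layout_loop) (auto simp: fun_eq_iff ltape_def)
  then have 4: "texec (right ?X) ?T2 1 (layout NA NX L (?s L) e)"
    using texec_right[of ?X ?T2] e0 by metis
  have "texec (comp NA NX d (Loop p)) (layout NA NX L s e)
     (L * (cost p L b + 3) + 1 + (1 + (3 * L + 1 + 1))) (layout NA NX L (sem L (Loop p) s) e)"
    using texec.Seq[OF 1 texec.Seq[OF 2 texec.Seq[OF 3 4]]] by (simp add: Let_def)
  then show ?case by (rule texec.Weaken) simp
qed

subsection \<open>Initialisation and the complete machine\<close>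

text \<open>The input length is given only by the extent of the word, so all rulers are written in
  parallel during one walk over the input. No symbol of the word is 0, hence a blank marks either
  end.\<close>

definition prepare :: "nat \<Rightarrow> nat \<Rightarrow> tprog" where
  "prepare NA NX =
     TSeq (Do (\<lambda>j s. (if NA \<le> j \<and> j \<le> NA + NX then 1 else s, Stay)))
      (TSeq (TWhile 0 (\<lambda>s. s \<noteq> 0)
          (Do (\<lambda>j s. (if NA + NX < j then 1 else s, if j = 0 \<or> NA + NX < j then Move_Right else Stay))))
      (TSeq (Moves (\<lambda>j. if j = 0 \<or> NA + NX < j then Move_Left else Stay))
      (TSeq (TWhile 0 (\<lambda>s. s \<noteq> 0) (Moves (\<lambda>j. if j = 0 \<or> NA + NX < j then Move_Left else Stay)))
      (Moves (\<lambda>j. if j = 0 \<or> NA + NX < j then Move_Right else Stay)))))"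

definition init_state :: "bool list \<Rightarrow> state" where
  "init_state w = ((\<lambda>_. 0), (\<lambda>A i. if A = 0 then word_tape w (int i) else 0))"

definition start_tapes :: "bool list \<Rightarrow> nat \<Rightarrow> tape" where
  "start_tapes w j = (if j = 0 then word_tape w else word_tape [], 0)"

lemma start_config_tapes: "k \<ge> 1 \<Longrightarrow> start_config k w = (0, tapes k (start_tapes w))"
  unfolding start_config_def tapes_def
  by (auto simp: start_tapes_def nth_Cons intro!: nth_equalityI split: nat.splits)

lemma texec_prepare:
  assumes NA: "NA \<ge> 1"
  shows "texec (prepare NA NX) (start_tapes w) (6 * length w + 5)
    (layout NA NX (length w) (init_state w) (\<lambda>_. 0))"
proof -
  let ?L = "length w"
  \<comment> \<open>\<open>c\<close> is the number of marks written on each ruler so far,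
    \<open>h\<close> the common head position of the input tape and the rulers.\<close>
  define U where "U = (\<lambda>(c::nat) (h::int) j. if j = 0 then (word_tape w, h) else if j < NA then (\<lambda>_. 0, 0)
     else if j \<le> NA + NX then ctape 0 else ltape c h)"
  have U0: "U c h 0 = (word_tape w, h)" for c h by (simp add: U_def)
  have "texec (Do (\<lambda>j s. (if NA \<le> j \<and> j \<le> NA + NX then 1 else s, Stay))) (start_tapes w) 1 
     (\<lambda>j. act (if NA \<le> j \<and> j \<le> NA + NX then 1 else scanned (start_tapes w j), Stay) (start_tapes w j))"
    by (rule texec.Do)
  also have "(\<lambda>j. act (if NA \<le> j \<and> j \<le> NA + NX then 1 else scanned (start_tapes w j), Stay) (start_tapes w j)) = U 0 0"
    using NA by (auto simp: fun_eq_iff start_tapes_def U_def word_tape_def ctape_def ltape_def)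
  finally have 1: "texec (Do (\<lambda>j s. (if NA \<le> j \<and> j \<le> NA + NX then 1 else s, Stay))) (start_tapes w) 1 (U 0 0)" .
  let ?b = "Do (\<lambda>j s. (if NA + NX < j then 1 else s, if j = 0 \<or> NA + NX < j then Move_Right else Stay))"
  have body: "texec ?b (U i (int i)) 1 (U (Suc i) (int (Suc i)))" for i
  proof -
    have "texec ?b (U i (int i)) 1 (\<lambda>j. act (if NA + NX < j then 1 else scanned (U i (int i) j),
         if j = 0 \<or> NA + NX < j then Move_Right else Stay) (U i (int i) j))"
      by (rule texec.Do)
    also have "(\<lambda>j. act (if NA + NX < j then 1 else scanned (U i (int i) j),
         if j = 0 \<or> NA + NX < j then Move_Right else Stay) (U i (int i) j)) = U (Suc i) (int (Suc i))"
      using NA by (auto simp: fun_eq_iff U_def ctape_def ltape_def)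
    finally show ?thesis .
  qed
  have "texec (TWhile 0 (\<lambda>s. s \<noteq> 0) ?b) (U i (int i)) (3 * (?L - i) + 1) (U ?L (int ?L))" if "i \<le> ?L" for i
    using that
  proof (induction i rule: inc_induct)
    case base
    have "texec (TWhile 0 (\<lambda>s. s \<noteq> 0) ?b) (U ?L (int ?L)) 1 (U ?L (int ?L))"
      by (rule texec.WhileF) (simp add: U0 word_tape_def)
    then show ?case by simp
  next
    case (step i)
    have "texec (TWhile 0 (\<lambda>s. s \<noteq> 0) ?b) (U i (int i)) (1 + (3 * (?L - Suc i) + 1) + 2) (U ?L (int ?L))"
      by (rule texec.WhileT[OF _ body step.IH]) (use step in \<open>simp add: U0 word_tape_def\<close>)
    then show ?case using step by (auto intro: texec.Weaken)
  qed
  from this[of 0] have 2: "texec (TWhile 0 (\<lambda>s. s \<noteq> 0) ?b) (U 0 0) (3 * ?L + 1) (U ?L (int ?L))"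
    by simp
  let ?l = "Moves (\<lambda>j. if j = 0 \<or> NA + NX < j then Move_Left else Stay)"
  have l: "texec ?l (U ?L h) 1 (U ?L (h - 1))" for h
  proof -
    have "(\<lambda>j. (fst (U ?L h j), snd (U ?L h j) + dir (if j = 0 \<or> NA + NX < j then Move_Left else Stay))) = U ?L (h - 1)"
      using NA by (auto simp: fun_eq_iff U_def ctape_def ltape_def)
    then show ?thesis using texec_Moves[of "\<lambda>j. if j = 0 \<or> NA + NX < j then Move_Left else Stay" "U ?L h"] by simp
  qed
  have "texec (TWhile 0 (\<lambda>s. s \<noteq> 0) ?l) (U ?L (int i - 1)) (3 * i + 1) (U ?L (-1))" if "i \<le> ?L" for i
    using that
  proof (induction i)
    case 0
    have "texec (TWhile 0 (\<lambda>s. s \<noteq> 0) ?l) (U ?L (-1)) 1 (U ?L (-1))"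
      by (rule texec.WhileF) (simp add: U0 word_tape_def)
    then show ?case by simp
  next
    case (Suc i)
    have "texec (TWhile 0 (\<lambda>s. s \<noteq> 0) ?l) (U ?L (int i)) (1 + (3 * i + 1) + 2) (U ?L (-1))"
      by (rule texec.WhileT[OF _ l]) (use Suc in \<open>simp_all add: U0 word_tape_def\<close>)
    then show ?case by (auto intro: texec.Weaken)
  qed
  from this[of ?L] have 3: "texec (TWhile 0 (\<lambda>s. s \<noteq> 0) ?l) (U ?L (int ?L - 1)) (3 * ?L + 1) (U ?L (-1))"
    by simp
  let ?r = "Moves (\<lambda>j. if j = 0 \<or> NA + NX < j then Move_Right else Stay)"
  have 4: "texec ?r (U ?L (-1)) 1 (U ?L 0)"
  proof -
    have "(\<lambda>j. (fst (U ?L (-1) j), snd (U ?L (-1) j) + dir (if j = 0 \<or> NA + NX < j then Move_Right else Stay))) = U ?L 0"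
      using NA by (auto simp: fun_eq_iff U_def ctape_def ltape_def)
    then show ?thesis using texec_Moves[of "\<lambda>j. if j = 0 \<or> NA + NX < j then Move_Right else Stay" "U ?L (-1)"] by simp
  qed
  have "U ?L 0 = layout NA NX ?L (init_state w) (\<lambda>_. 0)"
    using NA by (auto simp: fun_eq_iff U_def layout_def init_state_def atape_def word_tape_def)
  with texec.Seq[OF 1 texec.Seq[OF 2 texec.Seq[OF l[of "int ?L"] texec.Seq[OF 3 4]]]]
  show ?thesis by (auto simp: prepare_def intro: texec.Weaken)
qed

theorem loop_program_machine:
  assumes "wf_com NA NX n c" "NA \<ge> 2"
  obtains k M p where "turing_machine k 3 M"
    "\<And>w y. snd (sem (length w) c (init_state w)) 1 = (\<lambda>i. word_tape y (int i)) \<Longrightarrow>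
       outputs_within k M w y (poly p (length w))"
proof -
  let ?k = "NA + NX + 1 + n"
  let ?P = "TSeq (prepare NA NX) (comp NA NX 0 c)"
  have twf: "twf ?k 3 ?P"
    using twf_comp[OF assms(1), of 0 ?k] assms(2) by (auto simp: prepare_def)
  \<comment> \<open>All counters start at 0, hence never exceed \<open>ops c L\<close>, which can be
    taken for \<open>b\<close>.\<close>
  have "is_poly (\<lambda>L. (6 * L + 5) + cost c L (ops c L))"
    by (intro is_poly_add is_poly_mult is_poly_const is_poly_id is_poly_cost is_poly_ops)
  then obtain p where p: "\<And>L. (6 * L + 5) + cost c L (ops c L) = poly p L"
    unfolding is_poly_def by auto
  show ?thesis
  proof (rule that[of ?k "tcode ?k 0 ?P" p])
    show "turing_machine ?k 3 (tcode ?k 0 ?P)"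
      by (rule turing_machine_tcode[OF twf]) (use assms(2) in auto)
    fix w y :: "bool list"
    let ?L = "length w"
    assume y: "snd (sem ?L c (init_state w)) 1 = (\<lambda>i. word_tape y (int i))"
    have "texec (comp NA NX 0 c) (layout NA NX ?L (init_state w) (\<lambda>_. 0)) (cost c ?L (ops c ?L))
      (layout NA NX ?L (sem ?L c (init_state w)) (\<lambda>_. 0))"
      by (rule texec_comp[OF assms(1), of _ 0]) (auto simp: cbound_def init_state_def)
    from texec.Seq[OF texec_prepare this] assms(2)
    have "texec ?P (start_tapes w) (poly p ?L) (layout NA NX ?L (sem ?L c (init_state w)) (\<lambda>_. 0))"
      by (simp add: p)
    then show "outputs_within ?k (tcode ?k 0 ?P) w y (poly p ?L)"
    proof (rule texec_outputs_within[OF _ twf])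
      show "start_config ?k w = (0, tapes ?k (start_tapes w))"
        by (rule start_config_tapes) simp
      show "fst (layout NA NX ?L (sem ?L c (init_state w)) (\<lambda>_. 0) 1) = word_tape y"
        using assms(2) y by (auto simp: layout_def atape_def fun_eq_iff word_tape_def)
    qed (use assms(2) in auto)
  qed
qed

section \<open>Linear algebra: short combinations of dependent rows with small integral
  coefficients\<close>

section \<open>Small kernel vectors by a perceptron\<close>

text \<open>Elimination by induction on the equations: an equation with a nonzero coefficient is
  solved for the pivot unknown \<open>j0\<close> and substituted into the others, at the price of
  one equation and one unknown.\<close>

lemma homogeneous_system_nontrivial:
  fixes r :: "'j \<Rightarrow> 'i \<Rightarrow> real"
  assumes "finite I" "finite J" "card I < card J"
  shows "\<exists>l. (\<exists>j\<in>J. l j \<noteq> 0) \<and> (\<forall>i\<in>I. (\<Sum>j\<in>J. l j * r j i) = 0)"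
  using assms
proof (induction I arbitrary: J r rule: finite_induct)
  case empty
  then obtain j where "j \<in> J" by (metis card.empty card_gt_0_iff ex_in_conv)
  then show ?case by (intro exI[of _ "\<lambda>_. 1"]) auto
next
  case (insert i0 I)
  show ?case
  proof (cases "\<exists>j0\<in>J. r j0 i0 \<noteq> 0")
    case False
    obtain l where "\<exists>j\<in>J. l j \<noteq> 0" "\<forall>i\<in>I. (\<Sum>j\<in>J. l j * r j i) = 0"
      using insert.IH[of J r] insert.prems insert.hyps by auto
    with False show ?thesis by (intro exI[of _ l]) auto
  next
    case True
    then obtain j0 where j0: "j0 \<in> J" "r j0 i0 \<noteq> 0" by blast
    define K where "K = J - {j0}"
    have J: "J = insert j0 K" "j0 \<notin> K" "finite K" using j0 insert.prems by (auto simp: K_def)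
    define r' where "r' = (\<lambda>j i. r j i - r j i0 / r j0 i0 * r j0 i)"
    have "card I < card K" using insert.prems insert.hyps J by simp
    then obtain l where l: "\<exists>j\<in>K. l j \<noteq> 0" "\<forall>i\<in>I. (\<Sum>j\<in>K. l j * r' j i) = 0"
      using insert.IH[OF J(3)] by blast
    define l' where "l' = l(j0 := - (\<Sum>j\<in>K. l j * r j i0) / r j0 i0)"
    have eq: "(\<Sum>j\<in>J. l' j * r j i) = (\<Sum>j\<in>K. l j * r' j i)" for i
    proof -
      have "(\<Sum>j\<in>K. l' j * r j i) = (\<Sum>j\<in>K. l j * r j i)"
        using J by (intro sum.cong) (auto simp: l'_def)
      moreover have "(\<Sum>j\<in>K. l j * r' j i) =
          (\<Sum>j\<in>K. l j * r j i) - (\<Sum>j\<in>K. l j * r j i0) / r j0 i0 * r j0 i"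
        unfolding r'_def sum_divide_distrib sum_distrib_right sum_subtractf[symmetric]
        by (intro sum.cong) (auto simp: algebra_simps)
      ultimately show ?thesis using J by (simp add: l'_def)
    qed
    have "r' j i0 = 0" for j using j0 by (simp add: r'_def)
    then have "(\<Sum>j\<in>J. l' j * r j i) = 0" if "i \<in> insert i0 I" for i
      using that l(2) by (auto simp: eq)
    moreover have "\<exists>j\<in>J. l' j \<noteq> 0"
      using l(1) J by (auto simp: l'_def)
    ultimately show ?thesis by blast
  qed
qed

text \<open>Division by an entry of greatest modulus. Its index \<open>j0\<close> is what the
  algorithm guesses; the bound 1 on the other entries lets sign vectors compete with
  \<open>l\<close>.\<close>

lemma kernel_vector_normalized:
  fixes r :: "'j \<Rightarrow> 'i \<Rightarrow> real"
  assumes "finite I" "finite J" "card I < card J"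
  obtains l j0 where "j0 \<in> J" "l j0 = 1" "\<And>j. j \<in> J \<Longrightarrow> \<bar>l j\<bar> \<le> 1"
    "\<And>i. i \<in> I \<Longrightarrow> (\<Sum>j\<in>J. l j * r j i) = 0"
proof -
  obtain l where l: "\<exists>j\<in>J. l j \<noteq> 0" "\<forall>i\<in>I. (\<Sum>j\<in>J. l j * r j i) = 0"
    using homogeneous_system_nontrivial[OF assms, of r] by blast
  have fin: "finite ((\<lambda>j. \<bar>l j\<bar>) ` J)" "(\<lambda>j. \<bar>l j\<bar>) ` J \<noteq> {}"
    using assms l by auto
  obtain j0 where j0: "j0 \<in> J" "\<bar>l j0\<bar> = Max ((\<lambda>j. \<bar>l j\<bar>) ` J)"
    using Max_in[OF fin] by auto
  have max: "\<bar>l j\<bar> \<le> \<bar>l j0\<bar>" if "j \<in> J" for j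
    using that fin by (simp add: j0)
  have nz: "l j0 \<noteq> 0" using l(1) max by fastforce
  show ?thesis
  proof (rule that[of j0 "\<lambda>j. l j / l j0"])
    show "\<bar>l j / l j0\<bar> \<le> 1" if "j \<in> J" for j
      using max[OF that] nz by (simp add: abs_divide)
    show "(\<Sum>j\<in>J. l j / l j0 * r j i) = 0" if "i \<in> I" for i
    proof -
      have "(\<Sum>j\<in>J. l j / l j0 * r j i) = (\<Sum>j\<in>J. l j * r j i) / l j0"
        by (simp add: sum_divide_distrib)
      then show ?thesis using l(2) that by simp
    qed
  qed (use j0 nz in auto)
qed

text \<open>
  In each round the sign vector s minimises the inner product with the current row combination u over
  all sign vectors with a 1 at j0. A kernel vector competes in this minimisation with value 0, hence
  the squared length of u grows by a bounded amount per round.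
\<close>

definition perceptron_sign :: "('j \<Rightarrow> 'i \<Rightarrow> int) \<Rightarrow> 'i set \<Rightarrow> 'j \<Rightarrow> ('i \<Rightarrow> int) \<Rightarrow> 'j \<Rightarrow> int" where
  "perceptron_sign r I j0 u j = (if j = j0 then 1 else if (\<Sum>i\<in>I. r j i * u i) > 0 then -1 else 1)"

primrec perceptron :: "('j \<Rightarrow> 'i \<Rightarrow> int) \<Rightarrow> 'i set \<Rightarrow> 'j set \<Rightarrow> 'j \<Rightarrow> nat \<Rightarrow> 'i \<Rightarrow> int" where
  "perceptron r I J j0 0 = (\<lambda>_. 0)"
| "perceptron r I J j0 (Suc t) = (\<lambda>i. perceptron r I J j0 t i +
     (\<Sum>j\<in>J. perceptron_sign r I j0 (perceptron r I J j0 t) j * r j i))"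

lemma perceptron_eq_sum:
  "perceptron r I J j0 t i =
   (\<Sum>\<tau><t. \<Sum>j\<in>J. perceptron_sign r I j0 (perceptron r I J j0 \<tau>) j * r j i)"
  by (induction t) auto

lemma sum_squares_le_square_sum_abs:
  fixes f :: "'i \<Rightarrow> int"
  assumes "finite I"
  shows "(\<Sum>i\<in>I. (f i)\<^sup>2) \<le> (\<Sum>i\<in>I. \<bar>f i\<bar>)\<^sup>2"
  using assms
proof (induction I rule: finite_induct)
  case (insert i I)
  have "0 \<le> 2 * \<bar>f i\<bar> * (\<Sum>i\<in>I. \<bar>f i\<bar>)" by (simp add: sum_nonneg)
  moreover have "(\<Sum>i\<in>insert i I. \<bar>f i\<bar>)\<^sup>2 = (f i)\<^sup>2 + (\<Sum>i\<in>I. \<bar>f i\<bar>)\<^sup>2 + 2 * \<bar>f i\<bar> * (\<Sum>i\<in>I. \<bar>f i\<bar>)"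
    using insert by (simp add: power2_sum)
  moreover have "(\<Sum>i\<in>insert i I. (f i)\<^sup>2) = (f i)\<^sup>2 + (\<Sum>i\<in>I. (f i)\<^sup>2)"
    using insert by simp
  ultimately show ?case using insert.IH by linarith
qed simp

lemma perceptron_bound:
  fixes r :: "'j \<Rightarrow> 'i \<Rightarrow> int"
  assumes fin: "finite I" "finite J"
    and j0: "j0 \<in> J" and l: "l j0 = (1::real)" "\<And>j. j \<in> J \<Longrightarrow> \<bar>l j\<bar> \<le> 1"
      "\<And>i. i \<in> I \<Longrightarrow> (\<Sum>j\<in>J. l j * of_int (r j i)) = 0"
    and row: "\<And>j. j \<in> J \<Longrightarrow> (\<Sum>i\<in>I. \<bar>r j i\<bar>) \<le> b"
  shows "(\<Sum>i\<in>I. (perceptron r I J j0 t i)\<^sup>2) \<le> int t * (int (card J) * b)\<^sup>2"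
proof (induction t)
  case (Suc t)
  let ?u = "perceptron r I J j0 t"
  define s where "s = perceptron_sign r I j0 ?u"
  define d where "d = (\<lambda>i. \<Sum>j\<in>J. s j * r j i)"
  let ?g = "\<lambda>j. \<Sum>i\<in>I. r j i * ?u i"
  have s1: "\<bar>s j\<bar> = 1" for j by (simp add: s_def perceptron_sign_def)
  have cross: "(\<Sum>i\<in>I. ?u i * d i) = (\<Sum>j\<in>J. s j * ?g j)"
    unfolding d_def sum_distrib_left by (subst sum.swap) (intro sum.cong; simp add: mult_ac)
  \<comment> \<open>Termwise: at \<open>j0\<close> both coefficients are 1; elsewhere
    \<open>s j * ?g j\<close> is minus the modulus of \<open>?g j\<close>, the least value that a
    coefficient of modulus at most 1 can produce.\<close>
  have "(\<Sum>j\<in>J. of_int (s j) * of_int (?g j)) \<le> (\<Sum>j\<in>J. l j * of_int (?g j))"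
  proof (rule sum_mono)
    fix j assume j: "j \<in> J"
    show "of_int (s j) * of_int (?g j) \<le> l j * of_int (?g j)"
    proof (cases "j = j0")
      case True
      then show ?thesis by (simp add: s_def perceptron_sign_def l)
    next
      case False
      have "\<bar>l j * of_int (?g j)\<bar> \<le> 1 * \<bar>of_int (?g j)\<bar>"
        unfolding abs_mult by (rule mult_right_mono[OF l(2)[OF j]]) simp
      then have "- \<bar>of_int (?g j)\<bar> \<le> l j * of_int (?g j)" by linarith
      moreover have "real_of_int (s j) * of_int (?g j) = - \<bar>of_int (?g j)\<bar> \<or> real_of_int (s j) * of_int (?g j) \<le> - \<bar>of_int (?g j)\<bar>"
        using False by (auto simp: s_def perceptron_sign_def simp del: of_int_sum of_int_mult)
      ultimately show ?thesis by linarith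
    qed
  qed
  also have "(\<Sum>j\<in>J. l j * of_int (?g j)) = (\<Sum>i\<in>I. (\<Sum>j\<in>J. l j * of_int (r j i)) * of_int (?u i))"
    unfolding of_int_sum sum_distrib_left sum_distrib_right
    by (subst sum.swap) (intro sum.cong; simp add: mult_ac)
  also have "\<dots> = 0" using l(3) by simp
  finally have "real_of_int (\<Sum>j\<in>J. s j * ?g j) \<le> 0" by simp
  then have neg: "(\<Sum>i\<in>I. ?u i * d i) \<le> 0" by (simp only: cross of_int_le_0_iff)
  have "(\<Sum>i\<in>I. \<bar>d i\<bar>) \<le> (\<Sum>i\<in>I. \<Sum>j\<in>J. \<bar>s j * r j i\<bar>)"
    unfolding d_def by (intro sum_mono sum_abs)
  also have "\<dots> = (\<Sum>j\<in>J. \<Sum>i\<in>I. \<bar>r j i\<bar>)"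
    by (subst sum.swap) (simp add: abs_mult s1)
  also have "\<dots> \<le> (\<Sum>j\<in>J. b)" by (intro sum_mono row)
  finally have d1: "(\<Sum>i\<in>I. \<bar>d i\<bar>) \<le> int (card J) * b" by simp
  \<comment> \<open>A polynomial bound is enough, so the 2-norm of the increment is crudely bounded
    by its 1-norm.\<close>
  have "(\<Sum>i\<in>I. (d i)\<^sup>2) \<le> (\<Sum>i\<in>I. \<bar>d i\<bar>)\<^sup>2"
    by (rule sum_squares_le_square_sum_abs[OF fin(1)])
  also have "\<dots> \<le> (int (card J) * b)\<^sup>2"
    by (rule power_mono[OF d1]) (simp add: sum_nonneg)
  finally have d2: "(\<Sum>i\<in>I. (d i)\<^sup>2) \<le> (int (card J) * b)\<^sup>2" .
  have "(\<Sum>i\<in>I. (perceptron r I J j0 (Suc t) i)\<^sup>2) = (\<Sum>i\<in>I. (?u i + d i)\<^sup>2)"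
    by (simp add: d_def s_def)
  also have "\<dots> = (\<Sum>i\<in>I. (?u i)\<^sup>2) + (\<Sum>i\<in>I. (d i)\<^sup>2) + 2 * (\<Sum>i\<in>I. ?u i * d i)"
    unfolding power2_sum sum.distrib sum_distrib_left by (simp add: mult.assoc)
  also have "\<dots> \<le> int (Suc t) * (int (card J) * b)\<^sup>2"
    using Suc d2 neg by (simp add: algebra_simps)
  finally show ?case .
qed simp

text \<open>Cauchy-Schwarz against the all-ones vector; in the induction the mixed products are
  split by 2ab \<le> a^2 + b^2.\<close>

lemma square_sum_le_card_sum_squares:
  fixes f :: "'i \<Rightarrow> int"
  assumes "finite I"
  shows "(\<Sum>i\<in>I. \<bar>f i\<bar>)\<^sup>2 \<le> int (card I) * (\<Sum>i\<in>I. (f i)\<^sup>2)"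
  using assms
proof (induction I rule: finite_induct)
  case (insert i I)
  have "(\<Sum>k\<in>I. 2 * (\<bar>f i\<bar> * \<bar>f k\<bar>)) \<le> (\<Sum>k\<in>I. (f i)\<^sup>2 + (f k)\<^sup>2)"
  proof (rule sum_mono)
    fix k
    have "0 \<le> (\<bar>f i\<bar> - \<bar>f k\<bar>)\<^sup>2" by simp
    then show "2 * (\<bar>f i\<bar> * \<bar>f k\<bar>) \<le> (f i)\<^sup>2 + (f k)\<^sup>2" by (simp add: power2_diff)
  qed
  then have "2 * (\<bar>f i\<bar> * (\<Sum>k\<in>I. \<bar>f k\<bar>)) \<le> int (card I) * (f i)\<^sup>2 + (\<Sum>k\<in>I. (f k)\<^sup>2)"
    by (simp add: sum.distrib sum_distrib_left mult_ac)
  moreover have "(\<bar>f i\<bar> + (\<Sum>k\<in>I. \<bar>f k\<bar>))\<^sup>2 =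
      (f i)\<^sup>2 + 2 * (\<bar>f i\<bar> * (\<Sum>k\<in>I. \<bar>f k\<bar>)) + (\<Sum>k\<in>I. \<bar>f k\<bar>)\<^sup>2"
    by (simp add: power2_sum)
  moreover have "int (card (insert i I)) * (\<Sum>k\<in>insert i I. (f k)\<^sup>2) =
      int (card I) * (f i)\<^sup>2 + (f i)\<^sup>2 + int (card I) * (\<Sum>k\<in>I. (f k)\<^sup>2) + (\<Sum>k\<in>I. (f k)\<^sup>2)"
    using insert by (simp add: distrib_left distrib_right)
  ultimately show ?case using insert by simp
qed simp

text \<open>Two growth rates are compared: the squared 1-norm of the vector is at most
  \<open>T\<close> times the left-hand side of the last assumption, hence below the square of
  \<open>T\<close>, while the sign at \<open>j0\<close> is 1 in each round and adds up to
  \<open>T\<close>. All rows vanish on the columns outside \<open>U\<close>, so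
  \<open>card U < card J\<close> is enough for their dependence.\<close>

lemma perceptron_succeeds:
  fixes r :: "'j \<Rightarrow> 'i \<Rightarrow> int"
  assumes fin: "finite I" "finite J" and U: "U \<subseteq> I" "card U < card J"
    and zero: "\<And>j i. j \<in> J \<Longrightarrow> i \<in> I \<Longrightarrow> i \<notin> U \<Longrightarrow> r j i = 0"
    and row: "\<And>j. j \<in> J \<Longrightarrow> (\<Sum>i\<in>I. \<bar>r j i\<bar>) \<le> b"
    and T: "int (card I) * (int (card J) * b)\<^sup>2 < int T"
  obtains j0 where "j0 \<in> J"
    "(\<Sum>i\<in>I. \<bar>perceptron r I J j0 T i\<bar>) <
     (\<Sum>j\<in>J. \<bar>\<Sum>\<tau><T. perceptron_sign r I j0 (perceptron r I J j0 \<tau>) j\<bar>)"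
proof -
  have "finite U" using U(1) fin(1) by (rule finite_subset)
  then obtain j0 l where j0: "j0 \<in> J" "l j0 = (1::real)" "\<And>j. j \<in> J \<Longrightarrow> \<bar>l j\<bar> \<le> 1"
    and ker: "\<And>i. i \<in> U \<Longrightarrow> (\<Sum>j\<in>J. l j * of_int (r j i)) = 0"
    by (rule kernel_vector_normalized[OF _ fin(2) U(2), where r = "\<lambda>j i. of_int (r j i)"]) (rule that)
  have ker': "(\<Sum>j\<in>J. l j * of_int (r j i)) = 0" if "i \<in> I" for i
    using ker[of i] zero[OF _ that] by (cases "i \<in> U") auto
  let ?u = "perceptron r I J j0 T"
  let ?S = "\<lambda>j. \<Sum>\<tau><T. perceptron_sign r I j0 (perceptron r I J j0 \<tau>) j"
  have "(\<Sum>i\<in>I. \<bar>?u i\<bar>)\<^sup>2 \<le> int (card I) * (\<Sum>i\<in>I. (?u i)\<^sup>2)"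
    by (rule square_sum_le_card_sum_squares[OF fin(1)])
  also have "\<dots> \<le> int (card I) * (int T * (int (card J) * b)\<^sup>2)"
    by (rule mult_left_mono, rule perceptron_bound[OF fin j0 ker' row]) simp_all
  also have "\<dots> = int T * (int (card I) * (int (card J) * b)\<^sup>2)"
    by (simp add: mult_ac)
  also have "\<dots> < int T * int T"
  proof -
    have "0 \<le> int (card I) * (int (card J) * b)\<^sup>2" by simp
    with T have "0 < int T" by linarith
    with T show ?thesis by (intro mult_strict_left_mono)
  qed
  finally have "(\<Sum>i\<in>I. \<bar>?u i\<bar>)\<^sup>2 < (int T)\<^sup>2"
    by (simp only: power2_eq_square)
  then have "(\<Sum>i\<in>I. \<bar>?u i\<bar>) < int T"
    by (rule power_less_imp_less_base) simp
  also have "int T = \<bar>?S j0\<bar>" by (simp add: perceptron_sign_def)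
  also have "\<dots> \<le> (\<Sum>j\<in>J. \<bar>?S j\<bar>)"
    by (rule member_le_sum) (use j0 fin in auto)
  finally show ?thesis by (rule that[OF j0(1)])
qed

text \<open>The sum over j of S j times the value of row j at \<open>x\<close> is also the inner product of \<open>x\<close> with the
  combination of the rows with coefficients S, hence at most the length of the latter.\<close>

lemma sign_pattern_infeasible:
  fixes r :: "'j \<Rightarrow> 'i \<Rightarrow> int" and S :: "'j \<Rightarrow> int" and x :: "'i \<Rightarrow> int"
  assumes "\<And>i. i \<in> I \<Longrightarrow> \<bar>x i\<bar> \<le> 1"
    and less: "(\<Sum>i\<in>I. \<bar>\<Sum>j\<in>J. S j * r j i\<bar>) < (\<Sum>j\<in>J. \<bar>S j\<bar>)"
    and "\<And>j. j \<in> J \<Longrightarrow> S j > 0 \<Longrightarrow> (\<Sum>i\<in>I. r j i * x i) \<ge> 1"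
    and "\<And>j. j \<in> J \<Longrightarrow> S j < 0 \<Longrightarrow> (\<Sum>i\<in>I. r j i * x i) \<le> -1"
  shows False
proof -
  have "(\<Sum>j\<in>J. \<bar>S j\<bar>) \<le> (\<Sum>j\<in>J. S j * (\<Sum>i\<in>I. r j i * x i))"
  proof (rule sum_mono)
    fix j assume j: "j \<in> J"
    consider "S j > 0" | "S j < 0" | "S j = 0" by linarith
    then show "\<bar>S j\<bar> \<le> S j * (\<Sum>i\<in>I. r j i * x i)"
    proof cases
      case 1
      have "S j * 1 \<le> S j * (\<Sum>i\<in>I. r j i * x i)"
        by (rule mult_left_mono) (use assms(3)[OF j 1] 1 in auto)
      with 1 show ?thesis by simp
    next
      case 2
      have "S j * (-1) \<le> S j * (\<Sum>i\<in>I. r j i * x i)"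
        by (rule mult_left_mono_neg) (use assms(4)[OF j 2] 2 in auto)
      with 2 show ?thesis by simp
    qed simp
  qed
  also have "\<dots> = (\<Sum>i\<in>I. (\<Sum>j\<in>J. S j * r j i) * x i)"
    unfolding sum_distrib_left sum_distrib_right
    by (subst sum.swap) (intro sum.cong; simp add: mult_ac)
  also have "\<dots> \<le> (\<Sum>i\<in>I. \<bar>\<Sum>j\<in>J. S j * r j i\<bar>)"
  proof (rule sum_mono)
    fix i assume "i \<in> I"
    then have "\<bar>(\<Sum>j\<in>J. S j * r j i) * x i\<bar> \<le> \<bar>\<Sum>j\<in>J. S j * r j i\<bar> * 1"
      unfolding abs_mult by (intro mult_left_mono assms(1)) auto
    then show "(\<Sum>j\<in>J. S j * r j i) * x i \<le> \<bar>\<Sum>j\<in>J. S j * r j i\<bar>" by linarith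
  qed
  finally show False using less by simp
qed

section \<open>Partial assignments forced by output labels, and the majorities that resist\<close>

section \<open>Forcing variables\<close>

text \<open>As on the tapes, 1 and 2 are the bits and 0 means undetermined, so \<open>3 - b\<close> negates b.\<close>

definition fill :: "(nat \<Rightarrow> nat) \<Rightarrow> nat \<Rightarrow> nat \<Rightarrow> nat \<Rightarrow> nat \<Rightarrow> nat" where
  "fill asg b k k' v = (if asg v = 0 then if v = k \<or> v = k' then 3 - b else b else asg v)"

text \<open>Strict decrease rules out that a change is undone later. So a fixed point of a
  composition is a common fixed point of its parts.\<close>

definition settles :: "('s \<Rightarrow> nat) \<Rightarrow> ('s \<Rightarrow> 's) \<Rightarrow> bool" where
  "settles \<mu> f \<longleftrightarrow> (\<forall>s. f s = s \<or> \<mu> (f s) < \<mu> s)"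

lemma settles_fold:
  assumes "\<forall>x\<in>set xs. settles \<mu> (f x)"
  shows "settles \<mu> (fold f xs) \<and> (\<forall>s. fold f xs s = s \<longrightarrow> (\<forall>x\<in>set xs. f x s = s))"
  using assms
proof (induction xs)
  case (Cons x xs)
  then have IH: "settles \<mu> (fold f xs)" "\<And>s. fold f xs s = s \<Longrightarrow> \<forall>x\<in>set xs. f x s = s"
    and x: "settles \<mu> (f x)" by auto
  have 1: "fold f (x # xs) s = s \<or> \<mu> (fold f (x # xs) s) < \<mu> s" for s
    using IH(1) x unfolding settles_def fold_simps by (metis order_less_trans)
  have 2: "f x s = s" if "fold f (x # xs) s = s" for s
    using IH(1) x that unfolding settles_def fold_simps by (metis order_less_trans order_less_irrefl)
  have "\<forall>y\<in>set (x # xs). f y s = s" if "fold f (x # xs) s = s" for s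
    using 2[OF that] IH(2)[of s] that by auto
  with 1 show ?case unfolding settles_def by blast
qed (simp add: settles_def)

lemma settles_comp:
  assumes "settles \<mu> f" "settles \<mu> g"
  shows "settles \<mu> (\<lambda>s. g (f s))" "g (f s) = s \<Longrightarrow> f s = s \<and> g s = s"
proof -
  show "settles \<mu> (\<lambda>s. g (f s))"
    using assms unfolding settles_def by (metis order_less_trans)
  show "f s = s \<and> g s = s" if "g (f s) = s"
    using assms that unfolding settles_def by (metis order_less_trans order_less_irrefl)
qed

text \<open>Every round before stability lowers the measure, which leaves at most \<open>N\<close>
  such rounds.\<close>

lemma settles_iterate:
  assumes "settles \<mu> f" "\<mu> s \<le> N"
  shows "f ((f ^^ N) s) = (f ^^ N) s"
proof (rule ccontr)
  assume neq: "f ((f ^^ N) s) \<noteq> (f ^^ N) s"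
  have neq': "f ((f ^^ k) s) \<noteq> (f ^^ k) s" if "k \<le> N" for k
  proof
    assume eq: "f ((f ^^ k) s) = (f ^^ k) s"
    have "(f ^^ i) ((f ^^ k) s) = (f ^^ k) s" for i by (induction i) (simp_all add: eq)
    from this[of "N - k"] have "(f ^^ N) s = (f ^^ k) s"
      using that by (metis comp_apply funpow_add le_add_diff_inverse2)
    with eq neq show False by simp
  qed
  have "\<mu> ((f ^^ k) s) + k \<le> \<mu> s" if "k \<le> Suc N" for k
    using that
  proof (induction k)
    case (Suc k)
    then show ?case using neq'[of k] assms(1) unfolding settles_def by fastforce
  qed simp
  from this[of "Suc N"] assms(2) show False by simp
qed

text \<open>
  \<open>F x j\<close> is output j on the input \<open>x\<close>. Inputs are indexed by all numbers below L, which exceeds the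
  number n of real inputs; a dummy input can be forced only by contradictory labels.
\<close>

locale monotone_system =
  fixes F :: "(nat \<Rightarrow> bool) \<Rightarrow> nat \<Rightarrow> bool" and n m L :: nat and deps :: "nat \<Rightarrow> nat set"
  assumes mono: "j < m \<Longrightarrow> (\<And>i. x i \<Longrightarrow> x' i) \<Longrightarrow> F x j \<Longrightarrow> F x' j"
    and deps: "j < m \<Longrightarrow> (\<And>i. i \<in> deps j \<Longrightarrow> x i = x' i) \<Longrightarrow> F x j = F x' j"
    and deps_real: "j < m \<Longrightarrow> deps j \<subseteq> {..<n}"
    and card_deps: "j < m \<Longrightarrow> card (deps j) \<le> 3"
    and stretch: "n < m" and L: "2 * m < L" "8 \<le> L"
begin

lemma n_less_L: "n < L" using stretch L by simp

text \<open>For \<open>b = 1\<close>, input \<open>i\<close> is the only true one among the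
  undetermined inputs; if this makes output \<open>j\<close> true, then label 1 forces
  \<open>i\<close> to be false. The case \<open>b = 2\<close> is dual.\<close>

definition force :: "nat \<Rightarrow> nat \<Rightarrow> nat \<Rightarrow> (nat \<Rightarrow> nat) \<times> (nat \<Rightarrow> nat) \<Rightarrow> (nat \<Rightarrow> nat) \<times> (nat \<Rightarrow> nat)" where
  "force i j b s =
     (if fst s i = 0 \<and> snd s j = 0 \<and> j < m \<and> F (\<lambda>v. fill (fst s) b i i v = 2) j = (b = 1)
      then ((fst s)(i := b), (snd s)(j := b)) else s)"

definition pass :: "(nat \<Rightarrow> nat) \<times> (nat \<Rightarrow> nat) \<Rightarrow> (nat \<Rightarrow> nat) \<times> (nat \<Rightarrow> nat)" where
  "pass = fold (\<lambda>i. fold (\<lambda>j s. force i j 2 (force i j 1 s)) [0..<L]) [0..<L]"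

definition forced :: "(nat \<Rightarrow> nat) \<times> (nat \<Rightarrow> nat)" where
  "forced = (pass ^^ L) (\<lambda>_. 0, \<lambda>_. 0)"

abbreviation "asg \<equiv> fst forced"
abbreviation "lab \<equiv> snd forced"

definition free_count :: "(nat \<Rightarrow> nat) \<times> (nat \<Rightarrow> nat) \<Rightarrow> nat" where
  "free_count s = card {i. i < L \<and> fst s i = 0}"

lemma settles_force: "i < L \<Longrightarrow> b \<noteq> 0 \<Longrightarrow> settles free_count (force i j b)"
  unfolding settles_def
proof
  fix s
  assume i: "i < L" "b \<noteq> 0"
  show "force i j b s = s \<or> free_count (force i j b s) < free_count s"
  proof (cases "force i j b s = s")
    case False
    then have "fst s i = 0" "fst (force i j b s) = (fst s)(i := b)"
      by (auto simp: force_def split: if_splits)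
    then have "{k. k < L \<and> fst (force i j b s) k = 0} = {k. k < L \<and> fst s k = 0} - {i}"
      using i by (auto simp: fun_upd_apply)
    moreover have "i \<in> {k. k < L \<and> fst s k = 0}" using i \<open>fst s i = 0\<close> by simp
    ultimately have "{k. k < L \<and> fst (force i j b s) k = 0} \<subset> {k. k < L \<and> fst s k = 0}" by blast
    then show ?thesis unfolding free_count_def by (intro disjI2 psubset_card_mono) auto
  qed simp
qed

text \<open>At most \<open>L\<close> inputs can become determined, so \<open>L\<close> passes reach
  a fixed point of \<open>pass\<close>, and there no single test can have an effect.\<close>

lemma forced_stable:
  assumes "i < L" "j < L" "b \<in> {1, 2}"
  shows "force i j b forced = forced"
proof -
  have 1: "settles free_count (\<lambda>s. force i j 2 (force i j 1 s))" if "i < L" for i j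
    by (rule settles_comp(1)[where f = "force i j 1" and g = "force i j 2"]; rule settles_force) (use that in auto)
  have 2: "settles free_count (fold (\<lambda>j s. force i j 2 (force i j 1 s)) [0..<L])" if "i < L" for i
    using settles_fold[of "[0..<L]" free_count "\<lambda>j s. force i j 2 (force i j 1 s)"] 1[OF that] by simp
  have 3: "settles free_count pass \<and> (\<forall>s. pass s = s \<longrightarrow>
      (\<forall>i\<in>set [0..<L]. fold (\<lambda>j s. force i j 2 (force i j 1 s)) [0..<L] s = s))"
    unfolding pass_def by (rule settles_fold) (use 2 in auto)
  have "free_count (\<lambda>_. 0, \<lambda>_. 0) \<le> L" by (simp add: free_count_def)
  with 3 have "pass forced = forced" unfolding forced_def by (intro settles_iterate[of free_count]) auto
  from 3[THEN conjunct2, rule_format, OF this, of i] assms(1)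
  have "fold (\<lambda>j s. force i j 2 (force i j 1 s)) [0..<L] forced = forced" by simp
  with settles_fold[of "[0..<L]" free_count "\<lambda>j s. force i j 2 (force i j 1 s)",
      THEN conjunct2, rule_format, of forced j] 1[OF assms(1)] assms(2)
  have "force i j 2 (force i j 1 forced) = forced" by simp
  with settles_comp(2)[OF settles_force settles_force, of i 1 i 2 j j forced] assms
  show ?thesis by auto
qed

definition consistent :: "(nat \<Rightarrow> nat) \<Rightarrow> (nat \<Rightarrow> bool) \<Rightarrow> bool" where
  "consistent l x \<longleftrightarrow> (\<forall>j<m. l j \<noteq> 0 \<longrightarrow> F x j = (l j = 2))"

text \<open>The equality of the cardinalities preserves the surplus of outputs over inputs. The last
  clause becomes vacuous once the labels contradict each other, so it survives a label that is
  impossible for its output.\<close>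

definition force_inv :: "(nat \<Rightarrow> nat) \<times> (nat \<Rightarrow> nat) \<Rightarrow> bool" where
  "force_inv s \<longleftrightarrow> (\<forall>i. fst s i \<le> 2 \<and> snd s i \<le> 2) \<and>
     (\<forall>i. fst s i \<noteq> 0 \<longrightarrow> i < L) \<and> (\<forall>j. snd s j \<noteq> 0 \<longrightarrow> j < m) \<and>
     card {i. fst s i \<noteq> 0} = card {j. snd s j \<noteq> 0} \<and>
     (\<forall>x i. consistent (snd s) x \<longrightarrow> fst s i \<noteq> 0 \<longrightarrow> x i = (fst s i = 2))"

lemma force_inv_force:
  assumes inv: "force_inv s" and "i < L" "b \<in> {1, 2}"
  shows "force_inv (force i j b s)"
proof (cases "force i j b s = s")
  case False
  then have h: "fst s i = 0" "snd s j = 0" "j < m" "F (\<lambda>v. fill (fst s) b i i v = 2) j = (b = 1)"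
    and eq: "force i j b s = ((fst s)(i := b), (snd s)(j := b))"
    by (auto simp: force_def split: if_splits)
  have fin: "finite {i. fst s i \<noteq> 0}" "finite {j. snd s j \<noteq> 0}"
    using inv by (auto simp: force_inv_def intro: finite_subset[of _ "{..<L}"] finite_subset[of _ "{..<m}"])
  have sets: "{k. ((fst s)(i := b)) k \<noteq> 0} = insert i {k. fst s k \<noteq> 0}"
    "{k. ((snd s)(j := b)) k \<noteq> 0} = insert j {k. snd s k \<noteq> 0}"
    using assms(3) by (auto simp: fun_upd_apply)
  have card: "card {k. ((fst s)(i := b)) k \<noteq> 0} = card {k. ((snd s)(j := b)) k \<noteq> 0}"
    unfolding sets using fin h inv by (simp add: force_inv_def)
  have cons: "x k = (((fst s)(i := b)) k = 2)"
    if x: "consistent ((snd s)(j := b)) x" and k: "((fst s)(i := b)) k \<noteq> 0" for x k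
  proof -
    have "consistent (snd s) x" using x h by (auto simp: consistent_def fun_upd_apply split: if_splits)
    then have agree: "x v = (fst s v = 2)" if "fst s v \<noteq> 0" for v
      using inv that by (simp add: force_inv_def)
    have Fx: "F x j = (b = 2)" using x h(3) assms(3) by (auto simp: consistent_def fun_upd_apply)
    have "x i = (b = 2)"
    proof (rule ccontr)
      assume neg: "x i \<noteq> (b = 2)"
      show False
      \<comment> \<open>A wrong value at \<open>i\<close> places \<open>x\<close> below the test
        input if \<open>b = 2\<close> and above it if \<open>b = 1\<close>; by monotonicity the
        label of \<open>j\<close> then contradicts the outcome of the test.\<close>
      proof (cases "b = 2")
        case True
        have "F x j \<Longrightarrow> F (\<lambda>v. fill (fst s) b i i v = 2) j"
          by (rule mono[OF h(3)]) (use True neg agree in \<open>auto simp: fill_def\<close>)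
        with h(4) Fx True show False by simp
      next
        case False
        have "x v" if "fill (fst s) b i i v = 2" for v
          using False neg agree[of v] assms(3) that by (auto simp: fill_def split: if_splits)
        from mono[OF h(3) this] h(4) Fx False assms(3) show False by simp
      qed
    qed
    with agree k show ?thesis by (cases "k = i") auto
  qed
  show ?thesis using inv h card cons assms(2,3) unfolding eq force_inv_def
    by (auto simp: fun_upd_apply)
qed (use inv in simp)

lemma fold_invariant: "P s \<Longrightarrow> (\<And>x s. x \<in> set xs \<Longrightarrow> P s \<Longrightarrow> P (f x s)) \<Longrightarrow> P (fold f xs s)"
  by (induction xs arbitrary: s) auto

lemma force_inv_forced: "force_inv forced"
proof -
  have step: "force_inv (pass s)" if "force_inv s" for s
    unfolding pass_def using that
    by (intro fold_invariant[where P = force_inv] force_inv_force) auto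
  have "force_inv (\<lambda>_. 0, \<lambda>_. 0)" by (simp add: force_inv_def)
  then have "force_inv ((pass ^^ k) (\<lambda>_. 0, \<lambda>_. 0))" for k
    by (induction k) (simp_all add: step)
  then show ?thesis by (simp add: forced_def)
qed

lemma forced_agree: "consistent lab x \<Longrightarrow> asg i \<noteq> 0 \<Longrightarrow> x i = (asg i = 2)"
  using force_inv_forced by (auto simp: force_inv_def)

lemma forced_le: "asg i \<le> 2" "lab j \<le> 2" and forced_less: "lab j \<noteq> 0 \<Longrightarrow> j < m"
  using force_inv_forced by (auto simp: force_inv_def)

text \<open>Flipping a dummy changes no output and so preserves consistency, whereas consistency
  fixes the value of every determined input.\<close>

lemma dummy_contradiction:
  assumes "asg i \<noteq> 0" "n \<le> i"
  shows "\<not> consistent lab x"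
proof
  assume x: "consistent lab x"
  let ?x = "x(i := \<not> x i)"
  have "F ?x j = F x j" if "j < m" for j
    by (rule deps[OF that]) (use deps_real[OF that] assms(2) in \<open>auto simp: fun_upd_apply\<close>)
  then have "consistent lab ?x" using x by (simp add: consistent_def)
  from forced_agree[OF this assms(1)] forced_agree[OF x assms(1)] show False by simp
qed

definition active :: "nat \<Rightarrow> bool" where
  "active j \<longleftrightarrow> j < m \<and> lab j = 0"

text \<open>Two true inputs make a majority true exactly if it reads both of them, so testing pairs
  recovers its three inputs from evaluations alone.\<close>

definition essential :: "nat \<Rightarrow> nat \<Rightarrow> bool" where
  "essential j i \<longleftrightarrow> i < L \<and> j < m \<and> asg i = 0 \<and>
     (\<exists>k<L. k \<noteq> i \<and> asg k = 0 \<and> F (\<lambda>v. fill asg 1 i k v = 2) j)"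

lemma mono_deps:
  assumes "j < m" "\<And>i. i \<in> deps j \<Longrightarrow> x i \<Longrightarrow> x' i" "F x j"
  shows "F x' j"
proof -
  let ?x = "\<lambda>i. if i \<in> deps j then x i else x' i"
  have "F ?x j" using deps[OF assms(1), of x ?x] assms(3) by simp
  then show ?thesis by (rule mono[OF assms(1), rotated]) (use assms(2) in \<open>auto split: if_splits\<close>)
qed

context
  assumes no_dummy: "\<And>i. n \<le> i \<Longrightarrow> asg i = 0"
begin

definition rest :: "nat \<Rightarrow> nat set" where
  "rest j = {i \<in> deps j. asg i = 0}"

lemma finite_deps: "j < m \<Longrightarrow> finite (deps j)"
  using deps_real finite_subset by blast

lemma finite_rest: "j < m \<Longrightarrow> finite (rest j)"
  using finite_deps by (auto simp: rest_def)

text \<open>Stability means that no single true undetermined input makes the output true, and by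
  monotonicity nothing below such an input does. If \<open>k\<close> is not in
  \<open>rest j\<close>, the undetermined dummy \<open>n\<close> takes the role of the single true
  input; this covers outputs that depend on no undetermined input.\<close>

lemma not_one_true:
  assumes j: "active j" and x: "\<And>i. asg i \<noteq> 0 \<Longrightarrow> x i = (asg i = 2)"
    and one: "\<And>i. i \<in> rest j \<Longrightarrow> x i \<Longrightarrow> i = k"
  shows "\<not> F x j"
proof -
  have jm: "j < m" "lab j = 0" using j by (auto simp: active_def)
  have *: "\<not> F (\<lambda>v. fill asg 1 i i v = 2) j" if "i < L" "asg i = 0" for i
    using forced_stable[OF that(1), of j 1] that jm stretch L
    by (auto simp: force_def prod_eq_iff fun_eq_iff fun_upd_apply split: if_splits)
  show ?thesis
  proof (cases "k \<in> rest j")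
    case True
    then have "k < L" "asg k = 0" using deps_real[OF jm(1)] n_less_L by (auto simp: rest_def)
    have i1: "fill asg 1 k k v = 2" if "v \<in> deps j" "x v" for v
      using one[of v] x[of v] that by (auto simp: fill_def rest_def)
    show ?thesis
      by (rule notI, rule notE[OF *[OF \<open>k < L\<close> \<open>asg k = 0\<close>] mono_deps[OF jm(1) i1]])
  next
    case False
    then have r: "i \<notin> rest j \<or> \<not> x i" for i using one by blast
    have i1: "fill asg 1 n n v = 2" if "v \<in> deps j" "x v" for v
      using r[of v] x[of v] that by (auto simp: fill_def rest_def)
    show ?thesis
      by (rule notI, rule notE[OF *[OF n_less_L no_dummy] mono_deps[OF jm(1) i1]]) simp_all
  qed
qed

text \<open>Dual to \<open>not_one_true\<close>, from the tests with \<open>b = 2\<close>.\<close>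

lemma not_one_false:
  assumes j: "active j" and x: "\<And>i. asg i \<noteq> 0 \<Longrightarrow> x i = (asg i = 2)"
    and one: "\<And>i. i \<in> rest j \<Longrightarrow> \<not> x i \<Longrightarrow> i = k"
  shows "F x j"
proof -
  have jm: "j < m" "lab j = 0" using j by (auto simp: active_def)
  have *: "F (\<lambda>v. fill asg 2 i i v = 2) j" if "i < L" "asg i = 0" for i
    using forced_stable[OF that(1), of j 2] that jm stretch L
    by (auto simp: force_def prod_eq_iff fun_eq_iff fun_upd_apply split: if_splits)
  show ?thesis
  proof (cases "k \<in> rest j")
    case True
    then have "k < L" "asg k = 0" using deps_real[OF jm(1)] n_less_L by (auto simp: rest_def)
    have "x v" if "v \<in> deps j" "fill asg 2 k k v = 2" for v
      using one[of v] x[of v] that by (auto simp: fill_def rest_def split: if_splits)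
    from mono_deps[OF jm(1) this *[OF \<open>k < L\<close> \<open>asg k = 0\<close>]] show ?thesis by simp
  next
    case False
    then have r: "i \<notin> rest j \<or> x i" for i using one by blast
    have "x v" if "v \<in> deps j" "fill asg 2 n n v = 2" for v
      using r[of v] x[of v] that by (auto simp: fill_def rest_def split: if_splits)
    from mono_deps[OF jm(1) this *[OF n_less_L no_dummy]] show ?thesis by simp
  qed
qed

text \<open>If \<open>rest j\<close> were contained in a pair \<open>p\<close>, \<open>q\<close>,
  then making \<open>p\<close> the only true undetermined input would leave at most one true and at
  most one false input in \<open>rest j\<close>, and the two preceding lemmas would contradict each
  other.\<close>

lemma rest_three:
  assumes "active j"
  obtains p q s where "rest j = {p, q, s}" "p \<noteq> q" "p \<noteq> s" "q \<noteq> s"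
proof -
  have jm: "j < m" using assms by (auto simp: active_def)
  have "card (rest j) \<le> card (deps j)"
    by (rule card_mono[OF finite_deps[OF jm]]) (auto simp: rest_def)
  with card_deps[OF jm] have le: "card (rest j) \<le> 3" by simp
  have "\<not> card (rest j) \<le> 2"
  proof
    assume "card (rest j) \<le> 2"
    moreover have "\<exists>p q. rest j \<subseteq> {p, q}"
    proof -
      consider "card (rest j) = 0" | "card (rest j) = 1" | "card (rest j) = 2"
        using calculation by linarith
      then show ?thesis
        using finite_rest[OF jm] by cases (auto simp: card_1_singleton_iff card_2_iff)
    qed
    then obtain p q where pq: "rest j \<subseteq> {p, q}" by blast
    let ?x = "\<lambda>v. if asg v = 0 then v = p else asg v = 2"
    have "\<not> F ?x j"
      by (rule not_one_true[OF assms, of ?x p]) (auto simp: rest_def)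
    moreover have "F ?x j"
      by (rule not_one_false[OF assms, of ?x q]) (use pq in \<open>auto simp: rest_def\<close>)
    ultimately show False by blast
  qed
  with le have "card (rest j) = 3" by simp
  then show ?thesis using that by (auto simp: card_3_iff)
qed

text \<open>Two true inputs out of three leave one false, so \<open>not_one_false\<close> applies.
  If \<open>i\<close> lies outside \<open>rest j\<close>, at most \<open>k\<close> is true inside,
  and \<open>not_one_true\<close> applies.\<close>

lemma essential_eq_rest:
  assumes "active j"
  shows "essential j i \<longleftrightarrow> i \<in> rest j"
proof -
  have jm: "j < m" using assms by (auto simp: active_def)
  obtain p q s where r: "rest j = {p, q, s}" "p \<noteq> q" "p \<noteq> s" "q \<noteq> s"
    using rest_three[OF assms] .
  show ?thesis
  proof
    assume "essential j i"
    then obtain k where k: "k \<noteq> i" "asg k = 0" "asg i = 0" "F (\<lambda>v. fill asg 1 i k v = 2) j"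
      by (auto simp: essential_def)
    show "i \<in> rest j"
    proof (rule ccontr)
      assume "i \<notin> rest j"
      then have "\<not> F (\<lambda>v. fill asg 1 i k v = 2) j"
        by (intro not_one_true[OF assms, of _ k]) (auto simp: fill_def rest_def split: if_splits)
      with k show False by simp
    qed
  next
    assume i: "i \<in> rest j"
    then consider "i = p" | "i = q" | "i = s" using r(1) by blast
    then obtain k k' where k: "k \<noteq> i" "rest j = {i, k, k'}"
    proof cases
      case 1
      with r show ?thesis by (intro that[of q s]) auto
    next
      case 2
      with r show ?thesis by (intro that[of p s]) auto
    next
      case 3
      with r show ?thesis by (intro that[of p q]) auto
    qed
    have "F (\<lambda>v. fill asg 1 i k v = 2) j"
      by (rule not_one_false[OF assms, of _ k'])
        (use k in \<open>auto simp: fill_def rest_def split: if_splits\<close>)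
    moreover have "v < L \<and> asg v = 0" if "v \<in> rest j" for v
      using that deps_real[OF jm] n_less_L by (auto simp: rest_def)
    ultimately show "essential j i" using i k jm unfolding essential_def by blast
  qed
qed

lemma card_free_less_card_active:
  "card {i. i < n \<and> asg i = 0} < card {j. active j}"
proof -
  have inv: "card {i. asg i \<noteq> 0} = card {j. lab j \<noteq> 0}"
    using force_inv_forced by (simp add: force_inv_def)
  have "{i. i < n \<and> asg i = 0} = {..<n} - {i. asg i \<noteq> 0}" by auto
  moreover have sub1: "{i. asg i \<noteq> 0} \<subseteq> {..<n}"
    by (rule subsetI, rule ccontr) (simp add: no_dummy)
  ultimately have 1: "card {i. i < n \<and> asg i = 0} = n - card {i. asg i \<noteq> 0}"
    by (simp add: card_Diff_subset finite_subset)
  have "{j. active j} = {..<m} - {j. lab j \<noteq> 0}" by (auto simp: active_def)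
  moreover have sub2: "{j. lab j \<noteq> 0} \<subseteq> {..<m}" using forced_less by auto
  ultimately have 2: "card {j. active j} = m - card {j. lab j \<noteq> 0}"
    by (simp add: card_Diff_subset finite_subset)
  have "card {i. asg i \<noteq> 0} \<le> n" using card_mono[OF _ sub1] by simp
  with 1 2 inv stretch show ?thesis by simp
qed

text \<open>A sum of three signs is odd, so it jumps from -1 to 1. This gap provides the margin
  required by \<open>sign_pattern_infeasible\<close>.\<close>

lemma majority:
  assumes "active j" and x: "consistent lab x"
  shows "F x j \<longleftrightarrow> (\<Sum>i<L. of_bool (essential j i) * (if x i then 1 else - 1)) \<ge> (1::int)"
    and "\<not> F x j \<longleftrightarrow> (\<Sum>i<L. of_bool (essential j i) * (if x i then 1 else - 1)) \<le> (-1::int)"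
proof -
  have jm: "j < m" using assms by (auto simp: active_def)
  obtain p q s where r: "rest j = {p, q, s}" "p \<noteq> q" "p \<noteq> s" "q \<noteq> s"
    using rest_three[OF assms(1)] .
  have sub: "rest j \<subseteq> {..<L}" using deps_real[OF jm] n_less_L by (auto simp: rest_def)
  define \<sigma> where "\<sigma> = (\<lambda>i. if x i then 1 else - 1 :: int)"
  have "(\<Sum>i<L. of_bool (essential j i) * \<sigma> i) = (\<Sum>i\<in>rest j. \<sigma> i)"
    by (rule sum.mono_neutral_cong_right) (use sub essential_eq_rest[OF assms(1)] in auto)
  also have "\<dots> = \<sigma> p + \<sigma> q + \<sigma> s" using r by simp
  finally have sum: "(\<Sum>i<L. of_bool (essential j i) * \<sigma> i) = \<sigma> p + \<sigma> q + \<sigma> s" .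
  have agree: "\<And>i. asg i \<noteq> 0 \<Longrightarrow> x i = (asg i = 2)" using forced_agree[OF x] .
  have "F x j \<longleftrightarrow> \<sigma> p + \<sigma> q + \<sigma> s \<ge> 1 \<and> \<not> \<sigma> p + \<sigma> q + \<sigma> s \<le> -1"
  proof (cases "F x j")
    case True
    have "\<not> \<sigma> p + \<sigma> q + \<sigma> s \<le> -1"
    proof
      assume "\<sigma> p + \<sigma> q + \<sigma> s \<le> -1"
      then have "\<exists>k. \<forall>i\<in>rest j. x i \<longrightarrow> i = k"
        by (cases "x p"; cases "x q"; cases "x s") (auto simp: \<sigma>_def r)
      with not_one_true[OF assms(1) agree] True show False by blast
    qed
    moreover have "\<sigma> p + \<sigma> q + \<sigma> s \<le> -1 \<or> \<sigma> p + \<sigma> q + \<sigma> s \<ge> 1" by (simp add: \<sigma>_def)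
    ultimately show ?thesis using True by blast
  next
    case False
    have "\<not> \<sigma> p + \<sigma> q + \<sigma> s \<ge> 1"
    proof
      assume "\<sigma> p + \<sigma> q + \<sigma> s \<ge> 1"
      then have "\<exists>k. \<forall>i\<in>rest j. \<not> x i \<longrightarrow> i = k"
        by (cases "x p"; cases "x q"; cases "x s") (auto simp: \<sigma>_def r)
      with not_one_false[OF assms(1) agree] False show False by blast
    qed
    with False show ?thesis by blast
  qed
  moreover have "\<sigma> p + \<sigma> q + \<sigma> s \<le> -1 \<or> \<sigma> p + \<sigma> q + \<sigma> s \<ge> 1" by (simp add: \<sigma>_def)
  ultimately have *: "F x j \<longleftrightarrow> \<sigma> p + \<sigma> q + \<sigma> s \<ge> 1" "\<not> F x j \<longleftrightarrow> \<sigma> p + \<sigma> q + \<sigma> s \<le> -1"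
    by linarith+
  show "F x j \<longleftrightarrow> (\<Sum>i<L. of_bool (essential j i) * (if x i then 1 else - 1)) \<ge> (1::int)"
    and "\<not> F x j \<longleftrightarrow> (\<Sum>i<L. of_bool (essential j i) * (if x i then 1 else - 1)) \<le> (-1::int)"
    using * sum unfolding \<sigma>_def by simp_all
qed

end

section \<open>The labelling by the signs of the perceptron, and why no input attains it\<close>

section \<open>The string outside the range\<close>

abbreviation "row j i \<equiv> of_bool (essential j i) :: int"

definition vec :: "nat \<Rightarrow> nat \<Rightarrow> nat \<Rightarrow> int" where
  "vec j0 t = perceptron row {..<L} {j. active j} j0 t"

text \<open>Extended by 0 to the outputs that are not active, so that sums can run over all
  \<open>j < L\<close>, as the loops of the program do.\<close>

definition sig :: "nat \<Rightarrow> nat \<Rightarrow> nat \<Rightarrow> int" where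
  "sig j0 t j = (if active j then perceptron_sign row {..<L} j0 (vec j0 t) j else 0)"

definition total :: "nat \<Rightarrow> nat \<Rightarrow> int" where
  "total j0 j = (\<Sum>t<L ^ 4. sig j0 t j)"

definition success :: "nat \<Rightarrow> bool" where
  "success j0 \<longleftrightarrow> (\<Sum>i<L. \<bar>vec j0 (L ^ 4) i\<bar>) < (\<Sum>j<L. \<bar>total j0 j\<bar>)"

text \<open>The first successful guess decides: afterwards no active output has the label 0, and
  later guesses find nothing to write.\<close>

definition assign :: "nat \<Rightarrow> (nat \<Rightarrow> nat) \<Rightarrow> nat \<Rightarrow> nat" where
  "assign j0 l = (if success j0 then \<lambda>j. if active j \<and> l j = 0 then if total j0 j > 0 then 2 else 1 else l j else l)"

definition chosen :: "nat \<Rightarrow> nat" where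
  "chosen = fold assign [0..<L] lab"

text \<open>The default 1 is used only if no guess succeeds. By \<open>exists_success\<close> some
  dummy is then determined, and the labels from forcing alone exclude every input.\<close>

definition final :: "nat \<Rightarrow> nat" where
  "final j = (if j < m \<and> chosen j = 0 then 1 else chosen j)"

lemma active_less: "active j \<Longrightarrow> j < L"
  using L by (auto simp: active_def)

lemma finite_active: "finite {j. active j}"
  by (auto simp: active_def)

lemma vec_eq_sum: "vec j0 t i = (\<Sum>\<tau><t. \<Sum>j<L. sig j0 \<tau> j * row j i)"
  by (subst vec_def, subst perceptron_eq_sum, intro sum.cong refl sum.mono_neutral_cong_left) (auto simp: sig_def vec_def active_less)

lemma vec_eq_total: "vec j0 (L ^ 4) i = (\<Sum>j<L. total j0 j * row j i)"
  unfolding vec_eq_sum total_def sum_distrib_right by (rule sum.swap)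

lemma chosen_cases:
  "(\<forall>j0<L. \<not> success j0) \<and> chosen = lab \<or>
   (\<exists>j0<L. success j0 \<and> chosen = (\<lambda>j. if active j then if total j0 j > 0 then 2 else 1 else lab j))"
proof -
  have "(\<forall>j0<k. \<not> success j0) \<and> fold assign [0..<k] lab = lab \<or>
   (\<exists>j0<k. success j0 \<and> fold assign [0..<k] lab = (\<lambda>j. if active j then if total j0 j > 0 then 2 else 1 else lab j))" for k
  proof (induction k)
    case (Suc k)
    have act: "lab j = 0" if "active j" for j using that by (simp add: active_def)
    from Suc show ?case
    proof (elim disjE conjE exE)
      assume a: "\<forall>j0<k. \<not> success j0" "fold assign [0..<k] lab = lab"
      show ?thesis
      proof (cases "success k")
        case True
        then have "fold assign [0..<Suc k] lab = (\<lambda>j. if active j then if total k j > 0 then 2 else 1 else lab j)"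
          using a act by (auto simp: assign_def fun_eq_iff)
        with True show ?thesis by blast
      next
        case False
        then have "fold assign [0..<Suc k] lab = lab" using a by (simp add: assign_def)
        moreover have "\<forall>j0<Suc k. \<not> success j0" using a False by (simp add: less_Suc_eq)
        ultimately show ?thesis by blast
      qed
    next
      fix j0
      assume a: "j0 < k" "success j0"
        "fold assign [0..<k] lab = (\<lambda>j. if active j then if total j0 j > 0 then 2 else 1 else lab j)"
      then have "fold assign [0..<Suc k] lab = (\<lambda>j. if active j then if total j0 j > 0 then 2 else 1 else lab j)"
        by (auto simp: assign_def fun_eq_iff)
      with a show ?thesis by (meson less_SucI)
    qed
  qed simp
  then show ?thesis by (simp add: chosen_def)
qed

lemma exists_success:
  assumes no_dummy: "\<And>i. n \<le> i \<Longrightarrow> asg i = 0"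
  shows "\<exists>j0<L. success j0"
proof -
  let ?J = "{j. active j}"
  have row3: "(\<Sum>i<L. \<bar>row j i\<bar>) \<le> 3" if "j \<in> ?J" for j
  proof -
    have j: "active j" "j < m" using that by (auto simp: active_def)
    obtain p q s where r: "rest j = {p, q, s}" "p \<noteq> q" "p \<noteq> s" "q \<noteq> s"
      using rest_three[OF no_dummy j(1)] .
    have "rest j \<subseteq> {..<L}" using deps_real[OF j(2)] n_less_L by (auto simp: rest_def[OF no_dummy])
    then have "(\<Sum>i<L. \<bar>row j i\<bar>) = (\<Sum>i\<in>rest j. 1)"
      by (intro sum.mono_neutral_cong_right) (use essential_eq_rest[OF no_dummy j(1)] in auto)
    then show ?thesis using r by simp
  qed
  have cm: "card ?J \<le> m"
    using card_mono[of "{..<m}" ?J] by (auto simp: active_def)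
  have "int (card {..<L}) * (int (card ?J) * 3)\<^sup>2 \<le> int L * (int m * 3)\<^sup>2"
    by (auto intro!: mult_left_mono power_mono cm)
  also have "\<dots> < int (L ^ 4)"
  proof -
    have "m \<ge> 1" using stretch by simp
    \<comment> \<open>The number of rounds is settled here: 9 m^2 < 32 m^2 = 8 (2m)^2, and
      \<open>8 \<le> L\<close> and \<open>2 * m < L\<close> bound this by the cube of
      \<open>L\<close>. The factor 3 is the 1-norm of a row.\<close>
    then have "(m * 3)\<^sup>2 < 8 * ((2 * m) * (2 * m))"
      by (simp add: power2_eq_square)
    also have "\<dots> \<le> L * (L * L)"
      using L by (intro mult_le_mono) auto
    finally have "L * (m * 3)\<^sup>2 < L * (L * (L * L))"
      using L by simp
    also have "\<dots> = L ^ 4" by (simp add: power4_eq_xxxx mult.assoc)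
    finally have "int (L * (m * 3)\<^sup>2) < int (L ^ 4)" by (simp only: of_nat_less_iff)
    then show ?thesis by simp
  qed
  finally have T: "int (card {..<L}) * (int (card ?J) * 3)\<^sup>2 < int (L ^ 4)" .
  obtain j0 where j0: "j0 \<in> ?J" "(\<Sum>i<L. \<bar>perceptron row {..<L} ?J j0 (L ^ 4) i\<bar>) <
     (\<Sum>j\<in>?J. \<bar>\<Sum>\<tau><L ^ 4. perceptron_sign row {..<L} j0 (perceptron row {..<L} ?J j0 \<tau>) j\<bar>)"
  proof (rule perceptron_succeeds[of "{..<L}" ?J "{i. i < n \<and> asg i = 0}" row 3 "L ^ 4"])
    show "row j i = 0" if "j \<in> ?J" "i \<in> {..<L}" "i \<notin> {i. i < n \<and> asg i = 0}" for j i
      using that essential_eq_rest[OF no_dummy, of j i] deps_real[of j]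
      by (auto simp: rest_def[OF no_dummy] active_def)
  qed (use finite_active n_less_L card_free_less_card_active[OF no_dummy] row3 T in auto)
  have "(\<Sum>j\<in>?J. \<bar>\<Sum>\<tau><L ^ 4. perceptron_sign row {..<L} j0 (perceptron row {..<L} ?J j0 \<tau>) j\<bar>)
      = (\<Sum>j<L. \<bar>total j0 j\<bar>)"
    by (rule sum.mono_neutral_cong_left)
      (auto simp: active_less total_def sig_def vec_def)
  with j0 have "success j0" by (simp add: success_def vec_def)
  with j0 show ?thesis using active_less by blast
qed

theorem final_avoids: "\<exists>j<m. F x j \<noteq> (final j = 2)"
proof (rule ccontr)
  assume "\<not> (\<exists>j<m. F x j \<noteq> (final j = 2))"
  then have x: "F x j = (final j = 2)" if "j < m" for j using that by blast
  have keep: "final j = lab j" if "lab j \<noteq> 0" for j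
    using chosen_cases that by (auto simp: final_def active_def)
  have cons: "consistent lab x" unfolding consistent_def using x keep by auto
  show False
  \<comment> \<open>A determined dummy means that the labels from forcing are contradictory in
    themselves; otherwise the signs from the perceptron exclude \<open>x\<close>.\<close>
  proof (cases "\<exists>i\<ge>n. asg i \<noteq> 0")
    case True
    then show ?thesis using dummy_contradiction cons by blast
  next
    case False
    then have no_dummy: "\<And>i. n \<le> i \<Longrightarrow> asg i = 0" by blast
    obtain j0 where j0: "success j0"
      and ch: "chosen = (\<lambda>j. if active j then if total j0 j > 0 then 2 else 1 else lab j)"
      using exists_success[OF no_dummy] chosen_cases by blast
    have fin: "final j = (if total j0 j > 0 then 2 else 1)" if "active j" for j
      using that by (simp add: final_def ch)
    have nz: "active j" if "total j0 j \<noteq> 0" for j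
      by (rule ccontr) (use that in \<open>simp add: total_def sig_def\<close>)
    show False
    proof (rule sign_pattern_infeasible[where I = "{..<L}" and J = "{..<L}" and r = row and S = "total j0"
        and x = "\<lambda>i. if x i then 1 else -1"])
      show "(\<Sum>i<L. \<bar>\<Sum>j<L. total j0 j * row j i\<bar>) < (\<Sum>j<L. \<bar>total j0 j\<bar>)"
        using j0 by (simp add: success_def vec_eq_total)
    next
      fix j assume "total j0 j > 0"
      then show "1 \<le> (\<Sum>i<L. row j i * (if x i then 1 else - 1))"
        using majority(1)[OF no_dummy nz cons, of j] x[of j] fin[OF nz, of j] nz[of j]
        by (auto simp: active_def)
    next
      fix j assume "total j0 j < 0"
      then show "(\<Sum>i<L. row j i * (if x i then 1 else - 1)) \<le> -1"
        using majority(2)[OF no_dummy nz cons, of j] x[of j] fin[OF nz, of j] nz[of j]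
        by (auto simp: active_def)
    qed auto
  qed
qed

lemma final_symbols: "j < m \<Longrightarrow> final j \<in> {1, 2}" "j \<ge> m \<Longrightarrow> final j = 0"
proof -
  have "chosen j \<le> 2" using chosen_cases forced_le(2)[of j] by auto
  then have "chosen j = 0 \<or> chosen j = 1 \<or> chosen j = 2"
    by linarith
  then show "j < m \<Longrightarrow> final j \<in> {1, 2}"
    by (auto simp: final_def)
  assume j: "j \<ge> m"
  then have "lab j = 0" using forced_less[of j] by (cases "lab j = 0") auto
  then show "final j = 0"
    using j chosen_cases by (auto simp: final_def active_def)
qed

end

section \<open>Idioms of the loop language: indexed loops, comparison, addressing, integers\<close>

section \<open>Derived program constructs\<close>

declare fun_upd_apply [simp del] fun_upd_same [simp] fun_upd_other [simp]

text \<open>With explicit pairs the rules cannot rewrite the partially applied semantics inside iterations.\<close>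

declare sem.simps [simp del]

lemma sem_pair [simp]:
  "sem L Skip (c, a) = (c, a)"
  "sem L (Inc x) (c, a) = (c(x := Suc (c x)), a)"
  "sem L (Dec x) (c, a) = (c(x := c x - 1), a)"
  "sem L (Clear x) (c, a) = (c(x := 0), a)"
  "sem L (Copy x y) (c, a) = (c(x := c y), a)"
  "sem L (Put A x v) (c, a) = (c, a(A := (a A)(c x := v)))"
  "sem L (IfZ x p q) (c, a) = (if c x = 0 then sem L p (c, a) else sem L q (c, a))"
  "sem L (IfA A x v p q) (c, a) = (if a A (c x) = v then sem L p (c, a) else sem L q (c, a))"
  "sem L (p ;; q) (c, a) = sem L q (sem L p (c, a))"
  "sem L (Loop p) (c, a) = (sem L p ^^ L) (c, a)"
  by (simp_all add: sem.simps)

fun LoopN :: "nat \<Rightarrow> com \<Rightarrow> com" where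
  "LoopN 0 p = p"
| "LoopN (Suc e) p = Loop (LoopN e p)"

lemma sem_Loop: "sem L (Loop p) = sem L p ^^ L"
  by (simp add: fun_eq_iff)

lemma sem_LoopN: "sem L (LoopN e p) = sem L p ^^ (L ^ e)"
proof (induction e)
  case (Suc e)
  have "sem L (LoopN (Suc e) p) = (sem L p ^^ (L ^ e)) ^^ L"
    by (simp only: LoopN.simps sem_Loop Suc)
  then show ?case by (simp add: funpow_mult mult.commute)
qed simp

definition For :: "nat \<Rightarrow> com \<Rightarrow> com" where
  "For x p = Clear x ;; Loop (p ;; Inc x) ;; Clear x"

lemma sem_For:
  assumes "\<And>i. i < L \<Longrightarrow> sem L p ((g i)(x := i), f i) = ((g (Suc i))(x := i), f (Suc i))"
    and "g 0 x = 0" "g L x = 0"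
  shows "sem L (For x p) (g 0, f 0) = (g L, f L)"
proof -
  have "(sem L (p ;; Inc x) ^^ i) ((g 0)(x := 0), f 0) = ((g i)(x := i), f i)" if "i \<le> L" for i
    using that
  proof (induction i)
    case (Suc i)
    then show ?case using assms(1)[of i] by simp
  qed simp
  from this[of L] show ?thesis
    using assms(3) by (simp add: For_def fun_upd_idem)
qed

text \<open>The arrays are described by an invariant instead of a function of the iteration, because
  evaluations leave unspecified scratch contents behind.\<close>

lemma sem_For_clean:
  assumes "\<And>i a. i < L \<Longrightarrow> I i a \<Longrightarrow> \<exists>a'. sem L p (c(x := i), a) = (c(x := i), a') \<and> I (Suc i) a'"
    and "I 0 a" "c x = 0"
  shows "\<exists>a'. sem L (For x p) (c, a) = (c, a') \<and> I L a'"
proof -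
  have "\<exists>a'. (sem L (p ;; Inc x) ^^ i) (c(x := 0), a) = (c(x := i), a') \<and> I i a'" if "i \<le> L" for i
    using that
  proof (induction i)
    case 0
    then show ?case using assms(2) by auto
  next
    case (Suc i)
    then obtain a1 where a1: "(sem L (p ;; Inc x) ^^ i) (c(x := 0), a) = (c(x := i), a1)" "I i a1"
      by auto
    with assms(1)[of i a1] Suc.prems show ?case by auto
  qed
  from this[of L] show ?thesis
    using assms(3) by (auto simp: For_def fun_upd_idem)
qed

text \<open>Combined with a loop of sufficiently many iterations, this runs p as often as r says.\<close>

definition Drain :: "nat \<Rightarrow> com \<Rightarrow> com" where
  "Drain r p = IfZ r Skip (Dec r ;; p)"

lemma sem_Drain:
  assumes "\<And>i. i < v \<Longrightarrow> sem L p ((g i)(r := v - Suc i), f i) = ((g (Suc i))(r := v - Suc i), f (Suc i))"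
    and "v \<le> N"
  shows "(sem L (Drain r p) ^^ N) ((g 0)(r := v), f 0) = ((g v)(r := 0), f v)"
proof -
  have 1: "(sem L (Drain r p) ^^ i) ((g 0)(r := v), f 0) = ((g i)(r := v - i), f i)" if "i \<le> v" for i
    using that
  proof (induction i)
    case (Suc i)
    have "v - i \<noteq> 0" "v - i - 1 = v - Suc i" using Suc by auto
    then show ?case using assms(1)[of i] Suc by (simp add: Drain_def)
  qed simp
  have 2: "(sem L (Drain r p) ^^ i) ((g v)(r := 0), f v) = ((g v)(r := 0), f v)" for i
    by (induction i) (auto simp: Drain_def)
  have "(sem L (Drain r p) ^^ ((N - v) + v)) ((g 0)(r := v), f 0) = ((g v)(r := 0), f v)"
    by (simp add: funpow_add 1 2)
  then show ?thesis using assms(2) by simp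
qed

lemma sem_Loop_Inc: "(sem L (Inc r) ^^ n) (c, a) = (c(r := c r + n), a)"
  by (induction n) auto

abbreviation (input) "rT1 \<equiv> 2 :: nat"
abbreviation (input) "rT2 \<equiv> 3 :: nat"

definition IfEq :: "nat \<Rightarrow> nat \<Rightarrow> com \<Rightarrow> com \<Rightarrow> com" where
  "IfEq x y p q =
     Copy rT1 x ;; Copy rT2 y ;; Loop (IfZ rT1 Skip (IfZ rT2 Skip (Dec rT1 ;; Dec rT2))) ;;
     IfZ rT1 (IfZ rT2 p (Clear rT2 ;; q)) (Clear rT1 ;; q)"

text \<open>Both copies are decremented together until one is exhausted, which happens within
  \<open>L\<close> rounds because \<open>c x \<le> L\<close>. Equality holds exactly if both copies
  end at 0.\<close>

lemma sem_IfEq: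
  assumes "c x \<le> L" "c rT1 = 0" "c rT2 = 0" "y \<noteq> rT1"
  shows "sem L (IfEq x y p q) (c, a) = (if c x = c y then sem L p (c, a) else sem L q (c, a))"
proof -
  have *: "(sem L (IfZ rT1 Skip (IfZ rT2 Skip (Dec rT1 ;; Dec rT2))) ^^ n) (c(rT1 := u, rT2 := v), a)
     = (c(rT1 := u - min n v, rT2 := v - min n u), a)" for n u v
  proof (induction n arbitrary: u v)
    case (Suc n)
    have "sem L (IfZ rT1 Skip (IfZ rT2 Skip (Dec rT1 ;; Dec rT2))) (c(rT1 := u, rT2 := v), a)
      = (if u = 0 \<or> v = 0 then (c(rT1 := u, rT2 := v), a) else (c(rT1 := u - 1, rT2 := v - 1), a))"
      by (auto simp: fun_eq_iff fun_upd_apply)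
    then show ?case
      by (cases u; cases v) (auto simp add: funpow_Suc_right Suc.IH simp del: funpow.simps)
  qed simp
  have "c(rT1 := 0, rT2 := 0) = c" using assms by (auto simp: fun_eq_iff fun_upd_apply)
  with *[of L "c x" "c y"] assms show ?thesis
    by (cases "c x < c y") (auto simp: IfEq_def fun_upd_twist)
qed

text \<open>Matrices are stored row by row with rows of length \<open>L\<close>, so this is the
  address of entry \<open>(i, j)\<close>. The exponent \<open>e\<close> leaves room for row indices
  up to \<open>L ^ e\<close>.\<close>

definition Addr :: "nat \<Rightarrow> nat \<Rightarrow> nat \<Rightarrow> nat \<Rightarrow> com" where
  "Addr e r i j = Copy rT1 i ;; LoopN e (Drain rT1 (Loop (Inc r))) ;; Copy rT1 j ;; Loop (Drain rT1 (Inc r))"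

lemma sem_Addr:
  assumes "c i \<le> L ^ e" "c j \<le> L" "c rT1 = 0" "c r = 0" "r \<noteq> rT1" "j \<noteq> rT1" "j \<noteq> r"
  shows "sem L (Addr e r i j) (c, a) = (c(r := c i * L + c j), a)"
proof -
  have 1: "(sem L (Drain rT1 (Loop (Inc r))) ^^ (L ^ e)) ((c(r := 0 * L))(rT1 := c i), a) =
      ((c(r := c i * L))(rT1 := 0), a)"
    by (rule sem_Drain[where g = "\<lambda>k. c(r := k * L)" and f = "\<lambda>_. a"])
      (use assms in \<open>auto simp: sem_Loop_Inc fun_eq_iff fun_upd_apply\<close>)
  have 2: "(sem L (Drain rT1 (Inc r)) ^^ L) ((c(r := c i * L + 0))(rT1 := c j), a) =
      ((c(r := c i * L + c j))(rT1 := 0), a)"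
    by (rule sem_Drain[where g = "\<lambda>k. c(r := c i * L + k)" and f = "\<lambda>_. a"])
      (use assms in \<open>auto simp: fun_eq_iff fun_upd_apply\<close>)
  have "c(r := 0, rT1 := c i) = c(rT1 := c i)" "c(r := c i * L, rT1 := 0) = c(r := c i * L)"
    "c(r := c i * L + c j, rT1 := 0) = c(r := c i * L + c j)"
    using assms by (auto simp: fun_eq_iff fun_upd_apply)
  with 1 2 show ?thesis using assms
    by (simp add: Addr_def sem_LoopN)
qed

text \<open>Integers are represented by two counters, at least one of which is 0.\<close>

definition acc :: "nat \<Rightarrow> nat \<Rightarrow> (nat \<Rightarrow> nat) \<Rightarrow> int \<Rightarrow> nat \<Rightarrow> nat" where
  "acc P N c z = c(P := nat z, N := nat (- z))"

definition IncI :: "nat \<Rightarrow> nat \<Rightarrow> com" where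
  "IncI P N = IfZ N (Inc P) (Dec N)"

definition DecI :: "nat \<Rightarrow> nat \<Rightarrow> com" where
  "DecI P N = IfZ P (Inc N) (Dec P)"

lemma sem_IncI: "P \<noteq> N \<Longrightarrow> sem L (IncI P N) (acc P N c z, a) = (acc P N c (z + 1), a)"
  by (auto simp: IncI_def acc_def fun_eq_iff fun_upd_apply nat_add_distrib)

lemma sem_DecI: "P \<noteq> N \<Longrightarrow> sem L (DecI P N) (acc P N c z, a) = (acc P N c (z - 1), a)"
  by (auto simp: DecI_def acc_def fun_eq_iff fun_upd_apply nat_add_distrib nat_diff_distrib)

lemma acc_upd: "x \<noteq> P \<Longrightarrow> x \<noteq> N \<Longrightarrow> acc P N (c(x := v)) z = (acc P N c z)(x := v)"
  by (auto simp: acc_def fun_eq_iff fun_upd_apply)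

lemma acc_other [simp]: "x \<noteq> P \<Longrightarrow> x \<noteq> N \<Longrightarrow> acc P N c z x = c x"
  by (auto simp: acc_def)

lemma sem_For_sum:
  assumes "\<And>i z. i < L \<Longrightarrow> sem L p (acc P N (c(x := i)) z, a) = (acc P N (c(x := i)) (z + f i), a)"
    and "c x = 0" "x \<noteq> P" "x \<noteq> N"
  shows "sem L (For x p) (acc P N c z, a) = (acc P N c (z + (\<Sum>i<L. f i)), a)"
  using sem_For[of L p "\<lambda>i. acc P N c (z + (\<Sum>i<i. f i))" x "\<lambda>_. a"] assms
  by (simp add: acc_upd add.assoc)

section \<open>Evaluation of a circuit directly from its encoding on the input tape\<close>

section \<open>Circuit evaluation\<close>

definition bsym :: "bool \<Rightarrow> nat" where
  "bsym b = (if b then 2 else 1)"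

definition has :: "(nat \<Rightarrow> nat) \<Rightarrow> nat \<Rightarrow> bool list \<Rightarrow> bool" where
  "has f p u \<longleftrightarrow> (\<forall>i<length u. f (p + i) = bsym (u ! i))"

lemma has_append: "has f p (u @ v) \<longleftrightarrow> has f p u \<and> has f (p + length u) v"
proof -
  have "(\<forall>i<length u + length v. f (p + i) = bsym ((u @ v) ! i)) \<longleftrightarrow>
    (\<forall>i<length u. f (p + i) = bsym (u ! i)) \<and> (\<forall>i<length v. f (p + (length u + i)) = bsym (v ! i))"
    (is "?A \<longleftrightarrow> ?B")
  proof
    assume A: ?A
    have "f (p + i) = bsym (u ! i)" if "i < length u" for i
      using A[rule_format, of i] that by (simp add: nth_append)
    moreover have "f (p + (length u + i)) = bsym (v ! i)" if "i < length v" for i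
      using A[rule_format, of "length u + i"] that by (simp add: nth_append)
    ultimately show ?B by blast
  next
    assume B: ?B
    show ?A
    proof (intro allI impI)
      fix i assume "i < length u + length v"
      then show "f (p + i) = bsym ((u @ v) ! i)"
        using B[THEN conjunct2, rule_format, of "i - length u"] B
        by (cases "i < length u") (auto simp: nth_append)
    qed
  qed
  then show ?thesis by (simp add: has_def add.assoc)
qed

lemma has_Cons: "has f p (b # u) \<longleftrightarrow> f p = bsym b \<and> has f (Suc p) u"
  using has_append[of f p "[b]" u] by (simp add: has_def)

definition offset :: "('a \<Rightarrow> bool list) \<Rightarrow> 'a list \<Rightarrow> nat \<Rightarrow> nat" where
  "offset e xs k = length (concat (map e (take k xs)))"

lemma offset_0 [simp]: "offset e xs 0 = 0"
  by (simp add: offset_def)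

lemma offset_Suc: "k < length xs \<Longrightarrow> offset e xs (Suc k) = offset e xs k + length (e (xs ! k))"
  by (simp add: offset_def take_Suc_conv_app_nth)

lemma offset_length: "offset e xs (length xs) = length (concat (map e xs))"
  by (simp add: offset_def)

lemma has_element:
  assumes "has f p (concat (map e xs))" "k < length xs"
  shows "has f (p + offset e xs k) (e (xs ! k))"
proof -
  have "concat (map e xs) = concat (map e (take k xs)) @ e (xs ! k) @ concat (map e (drop (Suc k) xs))"
    by (subst id_take_nth_drop[OF assms(2)]) simp
  with assms(1) show ?thesis by (simp add: has_append offset_def)
qed

lemma length_element_le: "x \<in> set xs \<Longrightarrow> length (e x) \<le> length (concat (map e xs))"
  by (induction xs) auto

abbreviation (input) "rPos \<equiv> 4 :: nat"
abbreviation (input) "rR \<equiv> 5 :: nat"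
abbreviation (input) "rR2 \<equiv> 6 :: nat"
abbreviation (input) "rNum \<equiv> 7 :: nat"
abbreviation (input) "rP \<equiv> 8 :: nat"

text \<open>Array 0 is the input tape and array 1 the output tape: the output is built up in place from labels.\<close>

abbreviation (input) "aIn \<equiv> 0 :: nat"
abbreviation (input) "aLab \<equiv> 1 :: nat"
abbreviation (input) "aV \<equiv> 2 :: nat"
abbreviation (input) "aX \<equiv> 3 :: nat"
abbreviation (input) "aO \<equiv> 4 :: nat"

text \<open>A number in unary is no longer than the input, so \<open>L\<close> iterations suffice.
  Once the head is at the closing bit the surplus iterations idle, and the last increment steps over
  that bit.\<close>

definition ReadNat :: "nat \<Rightarrow> com" where
  "ReadNat x = Clear x ;; Loop (IfA aIn rPos 2 (Inc x ;; Inc rPos) Skip) ;; Inc rPos"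

lemma length_encode_nat [simp]: "length (encode_nat v) = Suc v"
  by (simp add: encode_nat_def)

lemma sem_ReadNat:
  assumes "has (a aIn) (c rPos) (encode_nat v)" "v \<le> L" "x \<noteq> rPos"
  shows "sem L (ReadNat x) (c, a) = (c(x := v, rPos := c rPos + Suc v), a)"
proof -
  let ?b = "IfA aIn rPos 2 (Inc x ;; Inc rPos) Skip"
  have bits: "a aIn (c rPos + i) = 2" if "i < v" for i
    using assms(1) that by (auto simp: has_def encode_nat_def nth_append bsym_def)
  have stop: "a aIn (c rPos + v) = 1"
    using assms(1) by (auto simp: has_def encode_nat_def nth_append bsym_def dest: spec[of _ v])
  have 1: "(sem L ?b ^^ i) (c(x := 0), a) = (c(x := i, rPos := c rPos + i), a)" if "i \<le> v" for i
    using that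
  proof (induction i)
    case 0
    then show ?case using assms(3) by (simp add: fun_eq_iff fun_upd_apply)
  next
    case (Suc i)
    then show ?case using assms(3) bits[of i] by (auto simp: fun_eq_iff fun_upd_apply)
  qed
  have 2: "(sem L ?b ^^ i) (c(x := v, rPos := c rPos + v), a) = (c(x := v, rPos := c rPos + v), a)" for i
    by (induction i) (use stop in auto)
  have "(sem L ?b ^^ ((L - v) + v)) (c(x := 0), a) = (c(x := v, rPos := c rPos + v), a)"
    by (simp add: funpow_add 1 2)
  then show ?thesis using assms(2,3) by (simp add: ReadNat_def)
qed

definition AndArg :: com where
  "AndArg = ReadNat rNum ;; IfA aV rNum 2 Skip (Put aV rP 1) ;; Clear rNum"

definition OrArg :: com where
  "OrArg = ReadNat rNum ;; IfA aV rNum 2 (Put aV rP 2) Skip ;; Clear rNum"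

text \<open>The cell of the gate is preset to the neutral element of its operation, which is also
  the value of a gate without arguments; each argument may then overwrite it.\<close>

definition EvalGate :: com where
  "EvalGate =
     IfA aIn rPos 2
       (Inc rPos ;; IfA aIn rPos 2
         (Inc rPos ;; Put aV rP 1 ;; ReadNat rR2 ;; Loop (Drain rR2 OrArg))
         (Inc rPos ;; Put aV rP 2 ;; ReadNat rR2 ;; Loop (Drain rR2 AndArg)))
       (Inc rPos ;; ReadNat rNum ;; IfA aX rNum 2 (Put aV rP 2) (Put aV rP 1) ;; Clear rNum)"

text \<open>Common to both operations: \<open>val j\<close> stands for the value of the gate cut
  down to its first \<open>j\<close> arguments.\<close>

lemma sem_gate_args:
  fixes b :: "bool \<Rightarrow> bool \<Rightarrow> bool" and val :: "nat \<Rightarrow> bool"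
  assumes arg: "\<And>c f j. c rP = v0 \<Longrightarrow> has (a aIn) (c rPos) (encode_nat (js ! j)) \<Longrightarrow> j < length js \<Longrightarrow> js ! j \<le> L \<Longrightarrow>
      js ! j < v0 \<Longrightarrow> c rNum = 0 \<Longrightarrow>
      sem L p (c, a(aV := (a aV)(v0 := bsym (val j)))) =
      (c(rPos := c rPos + Suc (js ! j)), a(aV := (a aV)(v0 := bsym (val (Suc j)))))"
    and enc: "has (a aIn) (c rPos) (encode_list encode_nat js)" "length (encode_list encode_nat js) \<le> L"
    and c: "c rP = v0" "c rNum = 0" "c rR2 = 0" and lt: "\<forall>j\<in>set js. j < v0"
  shows "sem L (ReadNat rR2 ;; Loop (Drain rR2 p)) (c, a(aV := (a aV)(v0 := bsym (val 0)))) =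
    (c(rPos := c rPos + length (encode_list encode_nat js)), a(aV := (a aV)(v0 := bsym (val (length js)))))"
proof -
  let ?a = "\<lambda>i. a(aV := (a aV)(v0 := bsym (val i)))"
  let ?q = "c rPos + Suc (length js)"
  have has: "has (a aIn) (c rPos) (encode_nat (length js))" "has (a aIn) ?q (concat (map encode_nat js))"
    using enc by (auto simp: encode_list_def has_append)
  have len: "length js \<le> L" using enc by (simp add: encode_list_def)
  have elem: "js ! i \<le> L" if "i < length js" for i
    using length_element_le[of "js ! i" js encode_nat] that enc by (simp add: encode_list_def)
  have 1: "sem L (ReadNat rR2) (c, ?a 0) = ((c(rPos := ?q))(rR2 := length js), ?a 0)"
    by (subst sem_ReadNat) (use has len in \<open>auto simp: fun_eq_iff fun_upd_apply\<close>)
  have 2: "(sem L (Drain rR2 p) ^^ L) ((c(rPos := ?q + offset encode_nat js 0))(rR2 := length js), ?a 0) =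
    ((c(rPos := ?q + offset encode_nat js (length js)))(rR2 := 0), ?a (length js))"
  proof (rule sem_Drain[where g = "\<lambda>i. c(rPos := ?q + offset encode_nat js i)"])
    fix i assume i: "i < length js"
    have "sem L p ((c(rPos := ?q + offset encode_nat js i))(rR2 := length js - Suc i), ?a i) =
      ((c(rPos := ?q + offset encode_nat js i))(rR2 := length js - Suc i,
         rPos := ((c(rPos := ?q + offset encode_nat js i))(rR2 := length js - Suc i)) rPos + Suc (js ! i)), ?a (Suc i))"
      by (rule arg) (use i c lt elem has_element[OF has(2) i] in auto)
    then show "sem L p ((c(rPos := ?q + offset encode_nat js i))(rR2 := length js - Suc i), ?a i) =
      ((c(rPos := ?q + offset encode_nat js (Suc i)))(rR2 := length js - Suc i), ?a (Suc i))"
      using i by (simp add: offset_Suc fun_upd_twist add.assoc)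
  qed (rule len)
  show ?thesis using 1 2 c(3)
    by (simp add: offset_length encode_list_def fun_eq_iff fun_upd_apply)
qed

lemma sem_EvalGate:
  assumes "has (a aIn) (c rPos) (encode_gate g)" "length (encode_gate g) \<le> L"
    and "wf_gate n (length vs) g" "c rP = length vs" "c rNum = 0" "c rR2 = 0"
    and V: "\<And>i. i < length vs \<Longrightarrow> a aV i = bsym (vs ! i)" and X: "\<And>i. i < n \<Longrightarrow> a aX i = bsym (x ! i)"
  shows "sem L EvalGate (c, a) =
    (c(rPos := c rPos + length (encode_gate g)), a(aV := (a aV)(length vs := bsym (gate_value x vs g))))"
proof (cases g)
  case (Input i)
  have "a aIn (c rPos) = 1" "has (a aIn) (Suc (c rPos)) (encode_nat i)" "i \<le> L"
    using assms(1,2) Input by (auto simp: has_Cons bsym_def)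
  then show ?thesis using assms Input
    by (simp add: EvalGate_def sem_ReadNat) (auto simp: bsym_def fun_eq_iff fun_upd_apply)
next
  case (And js)
  have h: "a aIn (c rPos) = 2" "a aIn (Suc (c rPos)) = 1"
    "has (a aIn) (Suc (Suc (c rPos))) (encode_list encode_nat js)"
    using assms(1) And by (auto simp: has_Cons bsym_def)
  let ?c = "c(rPos := Suc (Suc (c rPos)))"
  let ?val = "\<lambda>k. \<forall>j\<in>set (take k js). vs ! j"
  have "sem L (ReadNat rR2 ;; Loop (Drain rR2 AndArg)) (?c, a(aV := (a aV)(length vs := bsym (?val 0)))) =
    (?c(rPos := ?c rPos + length (encode_list encode_nat js)), a(aV := (a aV)(length vs := bsym (?val (length js)))))"
  proof (rule sem_gate_args)
    fix c' j
    assume "c' rP = length vs" "has (a aIn) (c' rPos) (encode_nat (js ! j))" "j < length js" "js ! j \<le> L"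
      "js ! j < length vs" "c' rNum = (0::nat)"
    then show "sem L AndArg (c', a(aV := (a aV)(length vs := bsym (?val j)))) =
      (c'(rPos := c' rPos + Suc (js ! j)), a(aV := (a aV)(length vs := bsym (?val (Suc j)))))"
      by (simp add: AndArg_def sem_ReadNat take_Suc_conv_app_nth V) (auto simp: bsym_def fun_eq_iff fun_upd_apply)
  qed (use assms And h in auto)
  with h assms And show ?thesis
    by (simp add: EvalGate_def bsym_def fun_upd_twist)
next
  case (Or js)
  have h: "a aIn (c rPos) = 2" "a aIn (Suc (c rPos)) = 2"
    "has (a aIn) (Suc (Suc (c rPos))) (encode_list encode_nat js)"
    using assms(1) Or by (auto simp: has_Cons bsym_def)
  let ?c = "c(rPos := Suc (Suc (c rPos)))"
  let ?val = "\<lambda>k. \<exists>j\<in>set (take k js). vs ! j"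
  have "sem L (ReadNat rR2 ;; Loop (Drain rR2 OrArg)) (?c, a(aV := (a aV)(length vs := bsym (?val 0)))) =
    (?c(rPos := ?c rPos + length (encode_list encode_nat js)), a(aV := (a aV)(length vs := bsym (?val (length js)))))"
  proof (rule sem_gate_args)
    fix c' j
    assume "c' rP = length vs" "has (a aIn) (c' rPos) (encode_nat (js ! j))" "j < length js" "js ! j \<le> L"
      "js ! j < length vs" "c' rNum = (0::nat)"
    then show "sem L OrArg (c', a(aV := (a aV)(length vs := bsym (?val j)))) =
      (c'(rPos := c' rPos + Suc (js ! j)), a(aV := (a aV)(length vs := bsym (?val (Suc j)))))"
      by (simp add: OrArg_def sem_ReadNat take_Suc_conv_app_nth V) (auto simp: bsym_def fun_eq_iff fun_upd_apply)
  qed (use assms Or h in auto)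
  with h assms Or show ?thesis
    by (simp add: EvalGate_def bsym_def fun_upd_twist)
qed

lemma gate_values_snoc:
  "gate_values x (gs @ [g]) = gate_values x gs @ [gate_value x (gate_values x gs) g]"
  by (simp add: gate_values_def)

lemma length_gate_values [simp]: "length (gate_values x gs) = length gs"
  by (induction gs rule: rev_induct) (simp_all add: gate_values_snoc, simp add: gate_values_def)

lemma take_gate_values: "k \<le> length gs \<Longrightarrow> gate_values x (take k gs) = take k (gate_values x gs)"
proof (induction gs rule: rev_induct)
  case (snoc g gs)
  then show ?case by (cases "k \<le> length gs") (auto simp: gate_values_snoc le_Suc_eq)
qed (simp add: gate_values_def)

lemma nth_gate_values:
  assumes "k < length gs"
  shows "gate_values x gs ! k = gate_value x (take k (gate_values x gs)) (gs ! k)"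
proof -
  have "gate_values x gs ! k = gate_values x (take (Suc k) gs) ! k"
    using assms by (simp add: take_gate_values)
  also have "\<dots> = gate_value x (gate_values x (take k gs)) (gs ! k)"
    using assms by (simp add: take_Suc_conv_app_nth gate_values_snoc nth_append)
  finally show ?thesis using assms by (simp add: take_gate_values)
qed

definition EvalOutput :: com where
  "EvalOutput = ReadNat rNum ;; IfA aV rNum 2 (Put aO rP 2) (Put aO rP 1) ;; Clear rNum ;; Inc rP"

definition Eval :: com where
  "Eval = ReadNat rNum ;; Clear rNum ;; ReadNat rR ;; Loop (Drain rR (EvalGate ;; Inc rP)) ;; Clear rP ;;
     ReadNat rR ;; Loop (Drain rR EvalOutput) ;; Clear rP ;; Clear rPos"

text \<open>The gate values \<open>V\<close> are scratch. Array \<open>aO\<close> is changed only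
  below the number of outputs; its zeros beyond serve later as the test whether an index is an
  output.\<close>

lemma sem_Eval:
  assumes "wf_circuit C" "has (a aIn) 0 (encode_circuit C)" "length (encode_circuit C) \<le> L"
    and X: "\<And>i. i < num_inputs C \<Longrightarrow> a aX i = bsym (x ! i)"
    and c: "c rPos = 0" "c rNum = 0" "c rR = 0" "c rR2 = 0" "c rP = 0"
  shows "\<exists>V. sem L Eval (c, a) = (c, a(aV := V,
    aO := (\<lambda>j. if j < num_outputs C then bsym (circuit_eval C x ! j) else a aO j)))"
proof -
  obtain n gs os where C: "C = Circuit n gs os" by (cases C)
  define vs where "vs = gate_values x gs"
  let ?G = "concat (map encode_gate gs)" and ?O = "concat (map encode_nat os)"
  define q1 where "q1 = Suc n + Suc (length gs)"
  define q2 where "q2 = q1 + length ?G + Suc (length os)"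
  have h: "has (a aIn) 0 (encode_nat n)" "has (a aIn) (Suc n) (encode_nat (length gs))"
    "has (a aIn) q1 ?G" "has (a aIn) (q1 + length ?G) (encode_nat (length os))" "has (a aIn) q2 ?O"
    using assms(2) by (auto simp: C encode_circuit_def encode_list_def has_append q1_def q2_def add.assoc)
  have le: "n \<le> L" "length gs \<le> L" "length ?G \<le> L" "length os \<le> L" "length ?O \<le> L"
    using assms(3) by (auto simp: C encode_circuit_def encode_list_def)
  have wfg: "wf_gate n k (gs ! k)" if "k < length gs" for k
    using assms(1) that by (simp add: C wf_circuit_def)
  have wfo: "os ! k < length gs" if "k < length os" for k
    using assms(1) that by (simp add: C wf_circuit_def)
  define W where "W = (\<lambda>k i. if i < k then bsym (vs ! i) else a aV i)"
  have 1: "(sem L (Drain rR (EvalGate ;; Inc rP)) ^^ L)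
      ((c(rPos := q1 + offset encode_gate gs 0, rP := 0))(rR := length gs), a(aV := W 0)) =
      ((c(rPos := q1 + offset encode_gate gs (length gs), rP := length gs))(rR := 0), a(aV := W (length gs)))"
  proof (rule sem_Drain[where g = "\<lambda>i. c(rPos := q1 + offset encode_gate gs i, rP := i)" and f = "\<lambda>i. a(aV := W i)"])
    fix i assume i: "i < length gs"
    let ?c = "(c(rPos := q1 + offset encode_gate gs i, rP := i))(rR := length gs - Suc i)"
    have "sem L EvalGate (?c, a(aV := W i)) = (?c(rPos := ?c rPos + length (encode_gate (gs ! i))),
        (a(aV := W i))(aV := ((a(aV := W i)) aV)(length (take i vs) := bsym (gate_value x (take i vs) (gs ! i)))))"
    proof (rule sem_EvalGate)
      show "length (encode_gate (gs ! i)) \<le> L"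
        using length_element_le[of "gs ! i" gs encode_gate] i le by simp
    qed (use i wfg[of i] c has_element[OF h(3) i] X in \<open>auto simp: W_def vs_def C\<close>)
    then show "sem L (EvalGate ;; Inc rP) (?c, a(aV := W i)) =
        ((c(rPos := q1 + offset encode_gate gs (Suc i), rP := Suc i))(rR := length gs - Suc i), a(aV := W (Suc i)))"
      using i nth_gate_values[of i gs x]
      by (auto simp: offset_Suc vs_def W_def fun_eq_iff fun_upd_apply min_def less_Suc_eq)
  qed (rule le)
  define U where "U = (\<lambda>k j. if j < k then bsym (vs ! (os ! j)) else a aO j)"
  let ?a = "\<lambda>k. a(aV := W (length gs), aO := U k)"
  have 2: "(sem L (Drain rR EvalOutput) ^^ L)
      ((c(rPos := q2 + offset encode_nat os 0, rP := 0))(rR := length os), ?a 0) =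
      ((c(rPos := q2 + offset encode_nat os (length os), rP := length os))(rR := 0), ?a (length os))"
  proof (rule sem_Drain[where g = "\<lambda>i. c(rPos := q2 + offset encode_nat os i, rP := i)"])
    fix i assume i: "i < length os"
    let ?c = "(c(rPos := q2 + offset encode_nat os i, rP := i))(rR := length os - Suc i)"
    have "os ! i \<le> L" using length_element_le[of "os ! i" os encode_nat] i le by simp
    then have "sem L (ReadNat rNum) (?c, ?a i) = (?c(rNum := os ! i, rPos := ?c rPos + Suc (os ! i)), ?a i)"
      by (intro sem_ReadNat) (use has_element[OF h(5) i] in auto)
    moreover have "?a i aV (os ! i) = bsym (vs ! (os ! i))"
      using wfo[OF i] by (simp add: W_def)
    moreover have "(U i)(i := bsym (vs ! (os ! i))) = U (Suc i)"
      by (auto simp: U_def fun_eq_iff fun_upd_apply less_Suc_eq)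
    ultimately show "sem L EvalOutput (?c, ?a i) =
        ((c(rPos := q2 + offset encode_nat os (Suc i), rP := Suc i))(rR := length os - Suc i), ?a (Suc i))"
      using i c by (auto simp: EvalOutput_def offset_Suc bsym_def fun_eq_iff fun_upd_apply split: if_splits)
  qed (rule le)
  have e1: "sem L (ReadNat rNum) (c, a) = (c(rNum := n, rPos := Suc n), a)"
    by (subst sem_ReadNat[where v = n]) (use h le c in auto)
  have e2: "sem L (ReadNat rR) (c(rPos := Suc n), a) = (c(rR := length gs, rPos := q1), a)"
    by (subst sem_ReadNat[where v = "length gs"]) (use h le c in \<open>auto simp: q1_def fun_eq_iff fun_upd_apply\<close>)
  have e3: "sem L (ReadNat rR) (c(rPos := q1 + length ?G), a(aV := W (length gs))) =
      (c(rR := length os, rPos := q2), a(aV := W (length gs)))"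
    by (subst sem_ReadNat[where v = "length os"]) (use h le c in \<open>auto simp: q2_def fun_eq_iff fun_upd_apply\<close>)
  have W0: "a(aV := W 0) = a" "a(aV := W (length gs), aO := U 0) = a(aV := W (length gs))"
    by (auto simp: W_def U_def fun_eq_iff fun_upd_apply)
  have n1: "c(rNum := n, rPos := Suc n, rNum := 0) = c(rPos := Suc n)"
    "(c(rPos := q1 + offset encode_gate gs 0, rP := 0))(rR := length gs) = c(rR := length gs, rPos := q1)"
    "(c(rPos := q1 + offset encode_gate gs (length gs), rP := length gs))(rR := 0, rP := 0) = c(rPos := q1 + length ?G)"
    "(c(rPos := q2 + offset encode_nat os 0, rP := 0))(rR := length os) = c(rR := length os, rPos := q2)"
    "((c(rPos := q2 + offset encode_nat os (length os), rP := length os))(rR := 0))(rP := 0, rPos := 0) = c"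
    using c by (auto simp: fun_eq_iff fun_upd_apply offset_length)
  have res: "U (length os) = (\<lambda>j. if j < num_outputs C then bsym (circuit_eval C x ! j) else a aO j)"
    by (auto simp: U_def C circuit_eval_def vs_def fun_eq_iff fun_upd_apply)
  have "sem L Eval (c, a) = (c, ?a (length os))"
    unfolding Eval_def
    by (simp only: sem_pair e1 n1 e2 1[unfolded n1 W0] e3 2[unfolded n1 W0])
  then show ?thesis using res by auto
qed

section \<open>The algorithm as a loop program\<close>

section \<open>The program\<close>

abbreviation (input) "aAsg \<equiv> 5 :: nat"
abbreviation (input) "aD \<equiv> 6 :: nat"
abbreviation (input) "aAct \<equiv> 7 :: nat"
abbreviation (input) "aTmp \<equiv> 8 :: nat"
abbreviation (input) "aH \<equiv> 9 :: nat"

abbreviation (input) "rA \<equiv> 9 :: nat"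
abbreviation (input) "rPa \<equiv> 10 :: nat"
abbreviation (input) "rNa \<equiv> 11 :: nat"
abbreviation (input) "rPz \<equiv> 12 :: nat"
abbreviation (input) "rNz \<equiv> 13 :: nat"
abbreviation (input) "rQ \<equiv> 14 :: nat"
abbreviation (input) "rT \<equiv> 15 :: nat"
abbreviation (input) "rI \<equiv> 16 :: nat"
abbreviation (input) "rJ \<equiv> 17 :: nat"
abbreviation (input) "rK \<equiv> 18 :: nat"
abbreviation (input) "rJ' \<equiv> 19 :: nat"
abbreviation (input) "rJ0 \<equiv> 20 :: nat"
abbreviation (input) "rV \<equiv> 21 :: nat"

definition FillEval :: "nat \<Rightarrow> nat \<Rightarrow> nat \<Rightarrow> com" where
  "FillEval b k k' =
     For rV (IfA aAsg rV 0
       (IfEq rV k (Put aX rV (3 - b)) (IfEq rV k' (Put aX rV (3 - b)) (Put aX rV b)))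
       (IfA aAsg rV 1 (Put aX rV 1) (Put aX rV 2))) ;;
     Eval"

text \<open>Since \<open>aO\<close> is 0 beyond the outputs and \<open>3 - b\<close> is a bit, the
  comparison also checks \<open>j < m\<close>.\<close>

definition ForceStep :: "nat \<Rightarrow> com" where
  "ForceStep b = IfA aAsg rI 0 (IfA aLab rJ 0
     (FillEval b rI rI ;; IfA aO rJ (3 - b) (Put aLab rJ b ;; Put aAsg rI b) Skip) Skip) Skip"

definition Force :: com where
  "Force = Loop (For rI (For rJ (ForceStep 1 ;; ForceStep 2)))"

text \<open>One evaluation for the pair \<open>rI\<close>, \<open>rK\<close> serves all outputs at
  once.\<close>

definition Essential :: com where
  "Essential = For rI (For rK (IfA aAsg rI 0 (IfA aAsg rK 0 (IfEq rI rK Skip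
     (FillEval 1 rI rK ;;
      For rJ (IfA aO rJ 2 (Addr 1 rA rJ rI ;; Put aD rA 2 ;; Clear rA) Skip))) Skip) Skip))"

text \<open>The values computed do not matter: the evaluation makes \<open>aO\<close> nonzero
  exactly at the outputs, also if \<open>Force\<close> has evaluated nothing.\<close>

definition Active :: com where
  "Active = FillEval 1 rI rI ;; For rJ (IfA aO rJ 0 Skip (IfA aLab rJ 0 (Put aAct rJ 1) Skip))"

text \<open>The signs of round t are stored in the array aH from position t * L on.\<close>

definition AddSign :: com where
  "AddSign = IfA aH rQ 2 (IncI rPa rNa) (IfA aH rQ 1 (DecI rPa rNa) Skip)"

text \<open>\<open>rQ\<close> is advanced through both loops and never reset between rounds, so it
  equals the address t * L + j without any multiplication.\<close>

definition Scan :: "com \<Rightarrow> com" where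
  "Scan p = LoopN 4 (For rJ' (p ;; Inc rQ)) ;; Clear rQ"

text \<open>The inner product of row \<open>rJ\<close> with u, where u is expanded into the stored
  signs times their rows.\<close>

definition InnerProduct :: com where
  "InnerProduct = Scan (For rI (Addr 1 rA rJ rI ;;
     IfA aD rA 2 (Clear rA ;; Addr 1 rA rJ' rI ;; IfA aD rA 2 AddSign Skip) Skip ;; Clear rA))"

definition SumTotal :: com where
  "SumTotal = Scan (IfEq rJ rJ' AddSign Skip)"

definition SumVec :: com where
  "SumVec = Scan (Addr 1 rA rJ' rI ;; IfA aD rA 2 AddSign Skip ;; Clear rA)"

text \<open>The new signs go to \<open>aTmp\<close> first: writing them to the history at once would
  let them enter the remaining inner products of the same round.\<close>

definition Round :: com where
  "Round =
     For rJ (IfA aAct rJ 1 (IfEq rJ rJ0 (Put aTmp rJ 2)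
       (InnerProduct ;; IfZ rPa (Put aTmp rJ 2) (Put aTmp rJ 1) ;; Clear rPa ;; Clear rNa)) Skip) ;;
     For rJ (Addr 4 rA rT rJ ;; IfA aTmp rJ 2 (Put aH rA 2) (IfA aTmp rJ 1 (Put aH rA 1) Skip) ;; Clear rA)"

text \<open>The history left by the previous guess has to be erased; it occupies
  \<open>L ^ 4\<close> rounds of \<open>L\<close> cells.\<close>

definition Rounds :: com where
  "Rounds = LoopN 5 (Put aH rQ 0 ;; Inc rQ) ;; Clear rQ ;; LoopN 4 (Round ;; Inc rT) ;; Clear rT"

text \<open>Draining both counters of an integer into the same operation takes its absolute value,
  as at most one of them is nonzero. The number of iterations is justified by
  \<open>abs_total_le\<close> and \<open>abs_vec_le\<close>.\<close>

definition Absorb :: "com \<Rightarrow> com" where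
  "Absorb p = LoopN 5 (Drain rPa p) ;; LoopN 5 (Drain rNa p)"

text \<open>The difference of the two 1-norms is accumulated, so \<open>rPz\<close> is positive
  afterwards exactly if the guess succeeds.\<close>

definition Compare :: com where
  "Compare = For rJ (SumTotal ;; Absorb (IncI rPz rNz)) ;; For rI (SumVec ;; Absorb (DecI rPz rNz))"

definition Assign :: com where
  "Assign = IfZ rPz Skip (For rJ (IfA aAct rJ 1 (IfA aLab rJ 0
     (SumTotal ;; IfZ rPa (Put aLab rJ 1) (Put aLab rJ 2) ;; Clear rPa ;; Clear rNa) Skip) Skip)) ;;
     Clear rPz ;; Clear rNz"

definition Finish :: com where
  "Finish = For rJ (IfA aO rJ 0 Skip (IfA aLab rJ 0 (Put aLab rJ 1) Skip))"

definition Avoid :: com where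
  "Avoid = Force ;; Essential ;; Active ;; For rJ0 (Rounds ;; Compare ;; Assign) ;; Finish"

text \<open>10 arrays and 22 counters are in use; 20 is a generous bound on the nesting of
  loops.\<close>

lemma wf_Avoid: "wf_com 10 22 20 Avoid"
  by (simp add: Avoid_def Force_def Essential_def Active_def Rounds_def Compare_def Assign_def Finish_def
      ForceStep_def FillEval_def Round_def InnerProduct_def SumTotal_def SumVec_def Scan_def Absorb_def
      AddSign_def IncI_def DecI_def Addr_def IfEq_def For_def Drain_def Eval_def EvalOutput_def EvalGate_def
      ReadNat_def AndArg_def OrArg_def eval_nat_numeral)

text \<open>The scratch counters. The outer loop indices and the pair \<open>rPz\<close>,
  \<open>rNz\<close> are left out because they are live while subprograms run.\<close>

definition idle :: "(nat \<Rightarrow> nat) \<Rightarrow> bool" where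
  "idle c \<longleftrightarrow> c rT1 = 0 \<and> c rT2 = 0 \<and> c rPos = 0 \<and> c rR = 0 \<and> c rR2 = 0 \<and> c rNum = 0 \<and> c rP = 0 \<and>
     c rA = 0 \<and> c rPa = 0 \<and> c rNa = 0 \<and> c rQ = 0 \<and> c rV = 0"

definition frame :: "nat set \<Rightarrow> (nat \<Rightarrow> nat \<Rightarrow> nat) \<Rightarrow> (nat \<Rightarrow> nat \<Rightarrow> nat) \<Rightarrow> bool" where
  "frame S a a' \<longleftrightarrow> (\<forall>A. A \<notin> S \<longrightarrow> a' A = a A)"

lemma gate_values_mono:
  assumes "\<And>p. p < length gs \<Longrightarrow> wf_gate n p (gs ! p)" "\<And>i. i < n \<Longrightarrow> x ! i \<Longrightarrow> x' ! i"
  shows "p < length gs \<Longrightarrow> gate_values x gs ! p \<Longrightarrow> gate_values x' gs ! p"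
proof (induction p rule: less_induct)
  case (less p)
  have IH: "gate_values x' gs ! q" if "q < p" "gate_values x gs ! q" for q
    using less.IH[OF that(1) _ that(2)] that(1) less.prems(1) by simp
  note eqs = nth_gate_values[OF less.prems(1), of x] nth_gate_values[OF less.prems(1), of x']
  have val: "gate_value x (take p (gate_values x gs)) (gs ! p)" using less.prems(2) eqs(1) by simp
  have "gate_value x' (take p (gate_values x' gs)) (gs ! p)"
  proof (cases "gs ! p")
    case (Input i)
    then show ?thesis using val assms(1)[OF less.prems(1)] assms(2)[of i] by simp
  next
    case (And js)
    then have "\<forall>j\<in>set js. j < p" using assms(1)[OF less.prems(1)] by simp
    then show ?thesis using And val IH by auto
  next
    case (Or js)
    then have "\<forall>j\<in>set js. j < p" using assms(1)[OF less.prems(1)] by simp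
    then show ?thesis using Or val IH by auto
  qed
  then show ?case using eqs(2) by simp
qed

lemma index_eq:
  fixes l :: nat
  assumes "i < l" "i' < l"
  shows "j * l + i = j' * l + i' \<longleftrightarrow> j = j' \<and> i = i'"
proof
  assume h: "j * l + i = j' * l + i'"
  have "(j * l + i) div l = j" "(j' * l + i') div l = j'" using assms by auto
  with h show "j = j' \<and> i = i'" by simp
qed simp

section \<open>Correctness of the program on a fixed circuit\<close>

locale avoid_instance =
  fixes C :: circuit and d f :: nat
  assumes circuit: "monotone_NC0 3 d f C" and more_outputs: "num_inputs C < num_outputs C"
begin

definition F :: "(nat \<Rightarrow> bool) \<Rightarrow> nat \<Rightarrow> bool" where
  "F x j = circuit_eval C (map x [0..<num_inputs C]) ! j"

abbreviation "L \<equiv> length (encode_circuit C)"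
abbreviation "m \<equiv> num_outputs C"
abbreviation "n \<equiv> num_inputs C"

lemma wf: "wf_circuit C" and fan: "j < m \<Longrightarrow> card (dependencies C j) \<le> 3"
  using circuit by (auto simp: monotone_NC0_def)

lemma F_cong: "(\<And>i. i < n \<Longrightarrow> x i = x' i) \<Longrightarrow> F x j = F x' j"
proof -
  assume "\<And>i. i < n \<Longrightarrow> x i = x' i"
  then have "map x [0..<n] = map x' [0..<n]" by simp
  then show ?thesis by (simp only: F_def)
qed

lemma F_flip: "j < m \<Longrightarrow> i \<notin> dependencies C j \<Longrightarrow> F (x(i := \<not> x i)) j = F x j"
proof (cases "i < n")
  case True
  assume "i \<notin> dependencies C j"
  then have "\<forall>y. length y = n \<longrightarrow> circuit_eval C (y[i := \<not> y ! i]) ! j = circuit_eval C y ! j"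
    using True unfolding dependencies_def by blast
  then have "circuit_eval C ((map x [0..<n])[i := \<not> map x [0..<n] ! i]) ! j = circuit_eval C (map x [0..<n]) ! j"
    by (rule allE[of _ "map x [0..<n]"]) simp
  moreover have "map (x(i := \<not> x i)) [0..<n] = (map x [0..<n])[i := \<not> map x [0..<n] ! i]"
    using True by (auto simp: list_eq_iff_nth_eq nth_list_update fun_upd_apply)
  ultimately show ?thesis by (simp only: F_def)
next
  case False
  then show ?thesis by (intro F_cong) auto
qed

text \<open>Dependence is defined by flips of single inputs, so \<open>x\<close> is turned into
  \<open>x'\<close> one position at a time.\<close>

lemma F_deps:
  assumes "j < m" "\<And>i. i \<in> dependencies C j \<Longrightarrow> x i = x' i"
  shows "F x j = F x' j"
proof -
  have "F (\<lambda>i. if i < k then x' i else x i) j = F x j" for k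
  proof (induction k)
    case (Suc k)
    let ?x = "\<lambda>i. if i < k then x' i else x i"
    have *: "(\<lambda>i. if i < Suc k then x' i else x i) = (if x k = x' k then ?x else ?x(k := \<not> ?x k))"
      by (auto simp: fun_eq_iff fun_upd_apply less_Suc_eq)
    show ?case
    proof (cases "x k = x' k")
      case True
      then show ?thesis using Suc by (simp add: *)
    next
      case False
      then have "F (?x(k := \<not> ?x k)) j = F ?x j" using assms by (intro F_flip) auto
      then show ?thesis using Suc False by (simp add: *)
    qed
  qed simp
  from this[of n] show ?thesis using F_cong[of "\<lambda>i. if i < n then x' i else x i" x' j] by simp
qed

text \<open>Each output contributes at least two bits, one to the length of the list and one to its
  own code. At least six more come from the number of inputs, the end of the list length, and a
  gate, which exists because some output refers to it.\<close>

lemma encoding_length: "2 * m < L" "8 \<le> L"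
proof -
  obtain k gs os where C: "C = Circuit k gs os" by (cases C)
  have os: "length os \<ge> 1" using more_outputs C by auto
  then have "hd os \<in> set os" by (cases os) auto
  then have gs: "length gs \<ge> 1" using wf C by (fastforce simp: wf_circuit_def)
  have "2 \<le> length (encode_gate g)" for g by (cases g) (auto simp: encode_list_def)
  moreover have "length (encode_gate (hd gs)) \<le> length (concat (map encode_gate gs))"
    using gs by (cases gs) auto
  ultimately have 1: "2 \<le> length (concat (map encode_gate gs))" by (meson order_trans)
  have 2: "length os \<le> length (concat (map encode_nat os))"
    by (induction os) auto
  show "2 * m < L" "8 \<le> L"
    using 1 2 os gs by (auto simp: C encode_circuit_def encode_list_def)
qed

sublocale monotone_system F n m L "dependencies C"
proof
  show "F x' j" if "j < m" "\<And>i. x i \<Longrightarrow> x' i" "F x j" for j x x'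
  proof -
    obtain k gs os where C: "C = Circuit k gs os" by (cases C)
    have p: "os ! j < length gs" using wf that(1) by (simp add: C wf_circuit_def)
    have "gate_values (map x [0..<k]) gs ! (os ! j)"
      using that(1,3) unfolding F_def by (simp add: C circuit_eval_def)
    from gate_values_mono[OF _ _ p this, of k "map x' [0..<k]"]
    show ?thesis using wf that unfolding F_def by (auto simp: C circuit_eval_def wf_circuit_def)
  qed
  show "F x j = F x' j" if "j < m" "\<And>i. i \<in> dependencies C j \<Longrightarrow> x i = x' i" for j x x'
    by (rule F_deps[OF that])
  show "dependencies C j \<subseteq> {..<n}" for j by (auto simp: dependencies_def)
qed (fact fan more_outputs encoding_length)+

lemma final_outside: "map (\<lambda>j. final j = 2) [0..<m] \<notin> circuit_range C"
proof
  assume "map (\<lambda>j. final j = 2) [0..<m] \<in> circuit_range C"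
  then obtain x where x: "length x = n" "map (\<lambda>j. final j = 2) [0..<m] = circuit_eval C x"
    by (auto simp: circuit_range_def)
  have "map (\<lambda>i. x ! i) [0..<n] = x" using x(1) by (metis map_nth)
  then have "F (\<lambda>i. x ! i) j = circuit_eval C x ! j" for j by (simp add: F_def)
  then have "F (\<lambda>i. x ! i) j = (final j = 2)" if "j < m" for j
    using that by (simp add: x(2)[symmetric])
  with final_avoids[of "\<lambda>i. x ! i"] show False by blast
qed

definition base :: "(nat \<Rightarrow> nat \<Rightarrow> nat) \<Rightarrow> bool" where
  "base a \<longleftrightarrow> has (a aIn) 0 (encode_circuit C) \<and> (\<forall>j\<ge>m. a aO j = 0) \<and> (\<forall>v. a aAsg v \<le> 2)"

lemma sem_FillEval:
  assumes b: "b \<in> {1, 2}" and "base a" "idle c" and k: "k \<noteq> rT1" "k \<noteq> rV" "k' \<noteq> rT1" "k' \<noteq> rV"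
  shows "\<exists>a'. sem L (FillEval b k k') (c, a) = (c, a') \<and> base a' \<and> frame {aV, aX, aO} a a' \<and>
    (\<forall>j. a' aO j = (if j < m then bsym (F (\<lambda>v. fill (a aAsg) b (c k) (c k') v = 2) j) else 0))"
proof -
  let ?fill = "fill (a aAsg) b (c k) (c k')"
  define X where "X = (\<lambda>i v. if v < i then ?fill v else a aX v)"
  let ?p = "IfA aAsg rV 0
       (IfEq rV k (Put aX rV (3 - b)) (IfEq rV k' (Put aX rV (3 - b)) (Put aX rV b)))
       (IfA aAsg rV 1 (Put aX rV 1) (Put aX rV 2))"
  have asg: "a aAsg v \<le> 2" for v using assms(2) by (simp add: base_def)
  have idle: "c rT1 = 0" "c rT2 = 0" using assms(3) by (simp_all add: idle_def)
  have "sem L (For rV ?p) (c, a(aX := X 0)) = (c, a(aX := X L))"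
  proof (rule sem_For[where g = "\<lambda>_. c" and f = "\<lambda>i. a(aX := X i)"])
    fix i assume i: "i < L"
    let ?a = "a(aX := X i)"
    have X: "(X i)(i := ?fill i) = X (Suc i)"
      by (auto simp: X_def fun_eq_iff fun_upd_apply less_Suc_eq)
    have "sem L ?p (c(rV := i), ?a) = (c(rV := i), ?a(aX := (?a aX)(i := ?fill i)))"
    proof (cases "a aAsg i = 0")
      case True
      then show ?thesis using i idle k by (simp add: sem_IfEq fill_def)
    next
      case False
      then have "a aAsg i = 1 \<or> a aAsg i = 2" using asg[of i] by linarith
      then show ?thesis by (auto simp: fill_def)
    qed
    then show "sem L ?p (c(rV := i), ?a) = (c(rV := i), a(aX := X (Suc i)))"
      by (simp add: X)
  qed (use assms in \<open>auto simp: idle_def\<close>)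
  moreover have "a(aX := X 0) = a" by (auto simp: X_def fun_eq_iff fun_upd_apply)
  ultimately have 1: "sem L (For rV ?p) (c, a) = (c, a(aX := X L))" by simp
  let ?x = "map (\<lambda>v. ?fill v = 2) [0..<n]"
  have fill12: "?fill v = bsym (?fill v = 2)" for v
    using b asg[of v] by (auto simp: fill_def bsym_def)
  obtain V where V: "sem L Eval (c, a(aX := X L)) = (c, (a(aX := X L))(aV := V,
      aO := (\<lambda>j. if j < m then bsym (circuit_eval C ?x ! j) else (a(aX := X L)) aO j)))"
    using sem_Eval[OF wf, of "a(aX := X L)" L ?x c] assms(2,3) fill12 n_less_L
    by (auto simp: base_def idle_def X_def)
  let ?a = "(a(aX := X L))(aV := V, aO := (\<lambda>j. if j < m then bsym (circuit_eval C ?x ! j) else (a(aX := X L)) aO j))"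
  have "sem L (FillEval b k k') (c, a) = (c, ?a)"
    by (simp only: FillEval_def sem_pair 1 V)
  moreover have "base ?a" using assms(2) by (auto simp: base_def fun_upd_apply)
  moreover have "frame {aV, aX, aO} a ?a" by (auto simp: frame_def fun_upd_apply)
  moreover have "?a aO j = (if j < m then bsym (F (\<lambda>v. ?fill v = 2) j) else 0)" for j
    using assms(2) by (simp add: F_def base_def)
  ultimately show ?thesis by blast
qed

lemma frame_trans: "frame S a a' \<Longrightarrow> frame S a' a'' \<Longrightarrow> frame S a a''"
  by (simp add: frame_def)

lemma frame_mono: "frame S a a' \<Longrightarrow> S \<subseteq> S' \<Longrightarrow> frame S' a a'"
  by (auto simp: frame_def)

lemma frame_refl: "frame S a a"
  by (simp add: frame_def)

abbreviation "labels a \<equiv> (a aAsg, a aLab)"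

lemma sem_ForceStep:
  assumes b: "b \<in> {1, 2}" and a: "base a" and c: "idle c"
  shows "\<exists>a'. sem L (ForceStep b) (c, a) = (c, a') \<and> base a' \<and> frame {aV, aX, aO, aAsg, aLab} a a' \<and>
    labels a' = force (c rI) (c rJ) b (labels a)"
proof (cases "a aAsg (c rI) = 0 \<and> a aLab (c rJ) = 0")
  case True
  obtain a1 where a1: "sem L (FillEval b rI rI) (c, a) = (c, a1)" "base a1" "frame {aV, aX, aO} a a1"
    "\<And>j. a1 aO j = (if j < m then bsym (F (\<lambda>v. fill (a aAsg) b (c rI) (c rI) v = 2) j) else 0)"
    using sem_FillEval[OF b a c, of rI rI] by auto
  have same: "a1 aAsg = a aAsg" "a1 aLab = a aLab" using a1(3) by (auto simp: frame_def)
  show ?thesis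
  proof (cases "a1 aO (c rJ) = 3 - b")
    case eq: True
    let ?a = "a1(aLab := (a1 aLab)(c rJ := b), aAsg := (a1 aAsg)(c rI := b))"
    have "sem L (ForceStep b) (c, a) = (c, ?a)"
      using True eq by (simp add: ForceStep_def a1(1))
    moreover have "c rJ < m \<and> F (\<lambda>v. fill (a aAsg) b (c rI) (c rI) v = 2) (c rJ) = (b = 1)"
      using eq b by (auto simp: a1(4) bsym_def split: if_splits)
    moreover have "base ?a" using a1(2) b by (auto simp: base_def fun_upd_apply)
    moreover have "frame {aV, aX, aO, aAsg, aLab} a ?a" using a1(3) by (auto simp: frame_def)
    ultimately show ?thesis using True same by (auto simp: force_def)
  next
    case neq: False
    have "sem L (ForceStep b) (c, a) = (c, a1)"
      using True neq by (simp add: ForceStep_def a1(1))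
    moreover have "\<not> (c rJ < m \<and> F (\<lambda>v. fill (a aAsg) b (c rI) (c rI) v = 2) (c rJ) = (b = 1))"
      using neq b by (auto simp: a1(4) bsym_def split: if_splits)
    moreover have "frame {aV, aX, aO, aAsg, aLab} a a1" using a1(3) by (rule frame_mono) auto
    ultimately show ?thesis using same a1(2) by (auto simp: force_def)
  qed
next
  case False
  then have "sem L (ForceStep b) (c, a) = (c, a)" by (auto simp: ForceStep_def)
  then show ?thesis using False a by (auto simp: force_def frame_refl)
qed

lemma fold_upt_Suc: "fold g [0..<Suc i] s = g i (fold g [0..<i] s)"
  by simp

lemma sem_Force:
  assumes "base a" "idle c" "c rI = 0" "c rJ = 0" "labels a = (\<lambda>_. 0, \<lambda>_. 0)"
  shows "\<exists>a'. sem L Force (c, a) = (c, a') \<and> base a' \<and> frame {aV, aX, aO, aAsg, aLab} a a' \<and> labels a' = forced"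
proof -
  let ?fr = "frame {aV, aX, aO, aAsg, aLab}"
  let ?step = "\<lambda>i j s. force i j 2 (force i j 1 s)"
  have inner: "\<exists>a'. sem L (ForceStep 1 ;; ForceStep 2) (c, a) = (c, a') \<and> base a' \<and> ?fr a a' \<and>
      labels a' = ?step (c rI) (c rJ) (labels a)" if hyp: "base a" "idle c" for a c
  proof -
    obtain a1 where a1: "sem L (ForceStep 1) (c, a) = (c, a1)" "base a1" "?fr a a1"
      "labels a1 = force (c rI) (c rJ) 1 (labels a)"
      using sem_ForceStep[of 1 a c, OF _ hyp] by blast
    obtain a2 where a2: "sem L (ForceStep 2) (c, a1) = (c, a2)" "base a2" "?fr a1 a2"
      "labels a2 = force (c rI) (c rJ) 2 (labels a1)"
      using sem_ForceStep[of 2 a1 c, OF _ a1(2) hyp(2)] by blast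
    show ?thesis using a1 a2 frame_trans[OF a1(3) a2(3)] by simp
  qed
  have row: "\<exists>a'. sem L (For rJ (ForceStep 1 ;; ForceStep 2)) (c, a) = (c, a') \<and> (base a' \<and> ?fr a a' \<and>
      labels a' = fold (?step (c rI)) [0..<L] (labels a))" if "base a" "idle c" "c rJ = 0" for a c
  proof (rule sem_For_clean[where I = "\<lambda>k a'. base a' \<and> ?fr a a' \<and> labels a' = fold (?step (c rI)) [0..<k] (labels a)"])
    fix k a1 assume a1: "base a1 \<and> ?fr a a1 \<and> labels a1 = fold (?step (c rI)) [0..<k] (labels a)"
    have "idle (c(rJ := k))" using that by (simp add: idle_def)
    with inner[of a1 "c(rJ := k)"] a1
    show "\<exists>a'. sem L (ForceStep 1 ;; ForceStep 2) (c(rJ := k), a1) = (c(rJ := k), a') \<and>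
        base a' \<and> ?fr a a' \<and> labels a' = fold (?step (c rI)) [0..<Suc k] (labels a)"
      unfolding fold_upt_Suc by (auto intro: frame_trans)
  qed (use that in \<open>auto simp: frame_refl\<close>)
  have all: "\<exists>a'. sem L (For rI (For rJ (ForceStep 1 ;; ForceStep 2))) (c, a) = (c, a') \<and> (base a' \<and> ?fr a a' \<and>
      labels a' = pass (labels a))" if "base a" for a
    unfolding pass_def
  proof (rule sem_For_clean[where I = "\<lambda>k a'. base a' \<and> ?fr a a' \<and>
        labels a' = fold (\<lambda>i. fold (?step i) [0..<L]) [0..<k] (labels a)"])
    fix k a1 assume a1: "base a1 \<and> ?fr a a1 \<and> labels a1 = fold (\<lambda>i. fold (?step i) [0..<L]) [0..<k] (labels a)"
    have "idle (c(rI := k))" "(c(rI := k)) rJ = 0" using assms by (simp_all add: idle_def)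
    with row[of a1 "c(rI := k)"] a1
    show "\<exists>a'. sem L (For rJ (ForceStep 1 ;; ForceStep 2)) (c(rI := k), a1) = (c(rI := k), a') \<and>
        base a' \<and> ?fr a a' \<and> labels a' = fold (\<lambda>i. fold (?step i) [0..<L]) [0..<Suc k] (labels a)"
      unfolding fold_upt_Suc by (auto intro: frame_trans)
  qed (use that assms in \<open>auto simp: frame_refl\<close>)
  have "\<exists>a'. (sem L (For rI (For rJ (ForceStep 1 ;; ForceStep 2))) ^^ k) (c, a) = (c, a') \<and> base a' \<and> ?fr a a' \<and>
      labels a' = (pass ^^ k) (labels a)" for k
  proof (induction k)
    case 0
    then show ?case using assms by (auto simp: frame_refl)
  next
    case (Suc k)
    then obtain a1 where a1: "(sem L (For rI (For rJ (ForceStep 1 ;; ForceStep 2))) ^^ k) (c, a) = (c, a1)"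
      "base a1" "?fr a a1" "labels a1 = (pass ^^ k) (labels a)" by blast
    with all[OF a1(2)] show ?case by (auto intro: frame_trans)
  qed
  from this[of L] show ?thesis using assms(5) by (simp add: Force_def forced_def)
qed

lemma sem_mark_row:
  assumes "c rT1 = 0" "c rA = 0" "c rJ = 0" "c rI < L"
  shows "sem L (For rJ (IfA aO rJ 2 (Addr 1 rA rJ rI ;; Put aD rA 2 ;; Clear rA) Skip)) (c, a) =
    (c, a(aD := (\<lambda>p. if \<exists>j<L. p = j * L + c rI \<and> a aO j = 2 then 2 else a aD p)))"
proof -
  let ?D = "\<lambda>k p. if \<exists>j<k. p = j * L + c rI \<and> a aO j = 2 then 2 else a aD p"
  let ?p = "IfA aO rJ 2 (Addr 1 rA rJ rI ;; Put aD rA 2 ;; Clear rA) Skip"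
  have "sem L (For rJ ?p) (c, a(aD := ?D 0)) = (c, a(aD := ?D L))"
  proof (rule sem_For[where g = "\<lambda>_. c" and f = "\<lambda>k. a(aD := ?D k)"])
    fix k assume k: "k < L"
    have upd: "c(rJ := k, rA := 0) = c(rJ := k)" using assms by (simp add: fun_upd_idem)
    have D: "(?D k)(k * L + c rI := 2) = ?D (Suc k)" if "a aO k = 2"
      using that by (auto simp: fun_eq_iff fun_upd_apply less_Suc_eq)
    have D': "?D (Suc k) = ?D k" if "a aO k \<noteq> 2"
      using that by (auto simp: fun_eq_iff less_Suc_eq)
    show "sem L ?p (c(rJ := k), a(aD := ?D k)) = (c(rJ := k), a(aD := ?D (Suc k)))"
    proof (cases "a aO k = 2")
      case True
      then show ?thesis using k assms by (simp add: sem_Addr upd D del: fun_upd_upd)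
    next
      case False
      then show ?thesis by (simp add: D')
    qed
  qed (use assms in auto)
  then show ?thesis by (simp add: fun_upd_idem)
qed

lemma sem_Essential:
  assumes "base a" "idle c" "c rI = 0" "c rJ = 0" "c rK = 0" and asg: "a aAsg = asg" and D: "a aD = (\<lambda>_. 0)"
  shows "\<exists>a'. sem L Essential (c, a) = (c, a') \<and> base a' \<and> frame {aV, aX, aO, aD} a a' \<and>
    (\<forall>j<L. \<forall>i<L. a' aD (j * L + i) = 2 \<longleftrightarrow> essential j i)"
proof -
  let ?fr = "frame {aV, aX, aO, aD}"
  let ?wit = "\<lambda>j i k. k \<noteq> i \<and> asg k = 0 \<and> asg i = 0 \<and> j < m \<and> F (\<lambda>v. fill asg 1 i k v = 2) j"
  let ?body = "IfA aAsg rI 0 (IfA aAsg rK 0 (IfEq rI rK Skip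
     (FillEval 1 rI rK ;;
      For rJ (IfA aO rJ 2 (Addr 1 rA rJ rI ;; Put aD rA 2 ;; Clear rA) Skip))) Skip) Skip"
  have body: "\<exists>a'. sem L ?body (c, a1) = (c, a') \<and> base a' \<and> ?fr a1 a' \<and>
      (\<forall>j<L. \<forall>i<L. a' aD (j * L + i) = 2 \<longleftrightarrow> a1 aD (j * L + i) = 2 \<or> i = c rI \<and> ?wit j i (c rK))"
    if h: "base a1" "idle c" "c rJ = 0" "c rI < L" "a1 aAsg = asg" for c a1
  proof (cases "asg (c rI) = 0 \<and> asg (c rK) = 0 \<and> c rI \<noteq> c rK")
    case True
    obtain a2 where a2: "sem L (FillEval 1 rI rK) (c, a1) = (c, a2)" "base a2" "frame {aV, aX, aO} a1 a2"
      "\<forall>j. a2 aO j = (if j < m then bsym (F (\<lambda>v. fill (a1 aAsg) 1 (c rI) (c rK) v = 2) j) else 0)"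
      using sem_FillEval[of 1 a1 c rI rK] h(1,2) by auto
    let ?a = "a2(aD := (\<lambda>p. if \<exists>j<L. p = j * L + c rI \<and> a2 aO j = 2 then 2 else a2 aD p))"
    have idle: "c rT1 = 0" "c rT2 = 0" "c rA = 0" using h(2) by (auto simp: idle_def)
    have "sem L ?body (c, a1) = (c, ?a)"
      using True h(3-5) idle a2(1) sem_mark_row[of c a2] by (simp add: sem_IfEq)
    moreover have "base ?a" using a2(2) by (auto simp: base_def fun_upd_apply)
    moreover have "?fr a1 ?a" using a2(3) by (auto simp: frame_def fun_upd_apply)
    moreover have "?a aD (j * L + i) = 2 \<longleftrightarrow> a1 aD (j * L + i) = 2 \<or> i = c rI \<and> ?wit j i (c rK)"
      if "j < L" "i < L" for j i
    proof -
      have "(\<exists>j'<L. j * L + i = j' * L + c rI \<and> a2 aO j' = 2) \<longleftrightarrow> i = c rI \<and> a2 aO j = 2"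
        using that h(4) by (auto simp: index_eq)
      moreover have "a2 aD = a1 aD" using a2(3) by (simp add: frame_def)
      moreover have "a2 aO j = 2 \<longleftrightarrow> j < m \<and> F (\<lambda>v. fill asg 1 (c rI) (c rK) v = 2) j"
        using a2(4) h(5) by (simp add: bsym_def)
      ultimately show ?thesis using True by auto
    qed
    ultimately show ?thesis by blast
  next
    case False
    have "sem L ?body (c, a1) = (c, a1)"
      using False h by (auto simp: sem_IfEq idle_def)
    then show ?thesis using False h(1) by (auto simp: frame_refl)
  qed
  \<comment> \<open>Progress is lexicographic: the columns before \<open>i0\<close> are complete,
    and column \<open>i0\<close> reflects the witnesses below \<open>k\<close>.\<close>
  let ?Q = "\<lambda>i0 k a'. base a' \<and> ?fr a a' \<and> (\<forall>j<L. \<forall>i<L. a' aD (j * L + i) = 2 \<longleftrightarrow>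
       i < i0 \<and> essential j i \<or> i = i0 \<and> (\<exists>k'<k. ?wit j i k'))"
  have asg': "a' aAsg = asg" if "?fr a a'" for a' using that asg by (simp add: frame_def)
  have row: "\<exists>a'. sem L (For rK ?body) (c(rI := i0), a1) = (c(rI := i0), a') \<and> ?Q (Suc i0) 0 a'"
    if i0: "i0 < L" and a1: "?Q i0 0 a1" for i0 a1
  proof -
    have "\<exists>a'. sem L (For rK ?body) (c(rI := i0), a1) = (c(rI := i0), a') \<and> ?Q i0 L a'"
    proof (rule sem_For_clean[where I = "?Q i0"])
      fix k a2 assume k: "k < L" "?Q i0 k a2"
      let ?c = "c(rI := i0, rK := k)"
      have "idle ?c" using assms by (simp add: idle_def)
      then obtain a3 where a3: "sem L ?body (?c, a2) = (?c, a3)" "base a3" "?fr a2 a3"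
        "\<forall>j<L. \<forall>i<L. a3 aD (j * L + i) = 2 \<longleftrightarrow> a2 aD (j * L + i) = 2 \<or> i = i0 \<and> ?wit j i k"
        using body[of a2 ?c] k i0 asg'[of a2] assms by auto
      have "?Q i0 (Suc k) a3"
        using a3(2-4) k(2) frame_trans[of _ a a2 a3] by (auto simp: less_Suc_eq)
      with a3(1) show "\<exists>a'. sem L ?body (?c, a2) = (?c, a') \<and> ?Q i0 (Suc k) a'" by blast
    qed (use a1 assms in auto)
    then obtain a' where a': "sem L (For rK ?body) (c(rI := i0), a1) = (c(rI := i0), a')" "?Q i0 L a'" by blast
    have "essential j i0 \<longleftrightarrow> (\<exists>k'<L. ?wit j i0 k')" for j
      using i0 by (auto simp: essential_def)
    then have "?Q (Suc i0) 0 a'" using a'(2) by (auto simp: less_Suc_eq)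
    with a'(1) show ?thesis by blast
  qed
  have "\<exists>a'. sem L (For rI (For rK ?body)) (c, a) = (c, a') \<and> ?Q L 0 a'"
    by (rule sem_For_clean[where I = "\<lambda>i. ?Q i 0"]) (use row assms D in \<open>auto simp: frame_refl\<close>)
  then show ?thesis unfolding Essential_def by auto
qed

lemma sem_Active:
  assumes "base a" "idle c" "c rI = 0" "c rJ = 0" "labels a = forced" "a aAct = (\<lambda>_. 0)"
  shows "\<exists>a'. sem L Active (c, a) = (c, a') \<and> frame {aV, aX, aO, aAct} a a' \<and>
    (\<forall>j. a' aO j \<noteq> 0 \<longleftrightarrow> j < m) \<and> (\<forall>j. a' aAct j = of_bool (active j))"
proof -
  obtain a1 where a1: "sem L (FillEval 1 rI rI) (c, a) = (c, a1)" "base a1" "frame {aV, aX, aO} a a1"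
    "\<forall>j. a1 aO j = (if j < m then bsym (F (\<lambda>v. fill (a aAsg) 1 (c rI) (c rI) v = 2) j) else 0)"
    using sem_FillEval[of 1 a c rI rI] assms by auto
  let ?act = "\<lambda>k j. of_bool (j < k \<and> active j) :: nat"
  let ?p = "IfA aO rJ 0 Skip (IfA aLab rJ 0 (Put aAct rJ 1) Skip)"
  have O: "a1 aO j \<noteq> 0 \<longleftrightarrow> j < m" for j using a1(4) by (simp add: bsym_def)
  have lab: "a1 aLab = lab" using a1(3) assms(5) by (auto simp: frame_def prod_eq_iff)
  have "sem L (For rJ ?p) (c, a1(aAct := ?act 0)) = (c, a1(aAct := ?act L))"
  proof (rule sem_For[where g = "\<lambda>_. c" and f = "\<lambda>k. a1(aAct := ?act k)"])
    fix k assume "k < L"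
    have "?act (Suc k) = (if active k then (?act k)(k := 1) else ?act k)"
      by (auto simp: fun_eq_iff fun_upd_apply less_Suc_eq)
    then show "sem L ?p (c(rJ := k), a1(aAct := ?act k)) = (c(rJ := k), a1(aAct := ?act (Suc k)))"
      using O[of k] lab by (cases "a1 aO k = 0") (auto simp: active_def)
  qed (use assms in auto)
  moreover have "a1 aAct = (\<lambda>_. 0)" using a1(3) assms(6) by (simp add: frame_def)
  then have "a1(aAct := ?act 0) = a1" by (simp add: fun_upd_idem)
  ultimately have "sem L Active (c, a) = (c, a1(aAct := ?act L))"
    by (simp add: Active_def a1(1)[unfolded One_nat_def])
  moreover have "frame {aV, aX, aO, aAct} a (a1(aAct := ?act L))"
    using a1(3) by (auto simp: frame_def fun_upd_apply)
  moreover have "(j < L \<and> active j) = active j" for j using active_less by blast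
  ultimately show ?thesis using O by auto
qed

definition sg :: "nat \<Rightarrow> int" where
  "sg v = (if v = 2 then 1 else if v = 1 then - 1 else 0)"

definition env :: "(nat \<Rightarrow> nat \<Rightarrow> nat) \<Rightarrow> bool" where
  "env a \<longleftrightarrow> (\<forall>j<L. \<forall>i<L. a aD (j * L + i) = 2 \<longleftrightarrow> essential j i) \<and> (\<forall>j. a aAct j = of_bool (active j))"

abbreviation "acca \<equiv> acc rPa rNa"
abbreviation "accz \<equiv> acc rPz rNz"

lemma acc_0: "c P = 0 \<Longrightarrow> c N = 0 \<Longrightarrow> acc P N c 0 = c"
  by (simp add: acc_def fun_upd_idem)

lemma sem_AddSign: "sem L AddSign (acca c z, a) = (acca c (z + sg (a aH (c rQ))), a)"
  by (simp add: AddSign_def sem_IncI sem_DecI sg_def)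

lemma sem_Scan:
  assumes body: "\<And>\<tau> j z. \<tau> < L ^ 4 \<Longrightarrow> j < L \<Longrightarrow>
      sem L p (acca (c(rJ' := j, rQ := \<tau> * L + j)) z, a) = (acca (c(rJ' := j, rQ := \<tau> * L + j)) (z + g \<tau> j), a)"
    and c: "c rQ = 0" "c rJ' = 0"
  shows "sem L (Scan p) (acca c z, a) = (acca c (z + (\<Sum>\<tau><L ^ 4. \<Sum>j<L. g \<tau> j)), a)"
proof -
  have row: "sem L (For rJ' (p ;; Inc rQ)) (acca (c(rQ := \<tau> * L)) z, a) =
      (acca (c(rQ := Suc \<tau> * L)) (z + (\<Sum>j<L. g \<tau> j)), a)" if t: "\<tau> < L ^ 4" for \<tau> z
  proof -
    have "sem L (For rJ' (p ;; Inc rQ)) (acca (c(rQ := \<tau> * L + 0)) (z + (\<Sum>j<0. g \<tau> j)), a) =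
        (acca (c(rQ := \<tau> * L + L)) (z + (\<Sum>j<L. g \<tau> j)), a)"
    proof (rule sem_For[where g = "\<lambda>k. acca (c(rQ := \<tau> * L + k)) (z + (\<Sum>j<k. g \<tau> j))" and f = "\<lambda>_. a"])
      fix k assume k: "k < L"
      have eq: "(acca (c(rQ := \<tau> * L + k)) z)(rJ' := k) = acca (c(rJ' := k, rQ := \<tau> * L + k)) z" for z
        by (auto simp: acc_def fun_eq_iff fun_upd_apply)
      have eq': "(acca (c(rJ' := k, rQ := \<tau> * L + k)) z)(rQ := Suc (\<tau> * L + k)) =
          (acca (c(rQ := \<tau> * L + Suc k)) z)(rJ' := k)" for z
        by (auto simp: acc_def fun_eq_iff fun_upd_apply)
      show "sem L (p ;; Inc rQ) ((acca (c(rQ := \<tau> * L + k)) (z + (\<Sum>j<k. g \<tau> j)))(rJ' := k), a) =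
          ((acca (c(rQ := \<tau> * L + Suc k)) (z + (\<Sum>j<Suc k. g \<tau> j)))(rJ' := k), a)"
        unfolding eq sem_pair body[OF t k] using eq' by (simp add: add.assoc)
    qed (use c in auto)
    then show ?thesis by (simp add: add.commute)
  qed
  have "(sem L (For rJ' (p ;; Inc rQ)) ^^ k) (acca (c(rQ := 0)) z, a) =
      (acca (c(rQ := k * L)) (z + (\<Sum>\<tau><k. \<Sum>j<L. g \<tau> j)), a)" if "k \<le> L ^ 4" for k
    using that
  proof (induction k)
    case (Suc k)
    then show ?case using row[of k] by (simp add: add.assoc)
  qed simp
  from this[of "L ^ 4"] show ?thesis
    using c by (simp add: Scan_def sem_LoopN fun_upd_idem acc_upd[symmetric])
qed

lemma sem_InnerProduct:
  assumes "env a" "idle c" "c rI = 0" "c rJ' = 0" "c rJ = j" "j < L"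
  shows "sem L InnerProduct (acca c z, a) =
    (acca c (z + (\<Sum>\<tau><L ^ 4. \<Sum>j'<L. \<Sum>i<L. row j i * (row j' i * sg (a aH (\<tau> * L + j'))))), a)"
  unfolding InnerProduct_def
proof (rule sem_Scan)
  fix \<tau> j' z assume j': "j' < L"
  let ?c = "c(rJ' := j', rQ := \<tau> * L + j')"
  let ?p = "Addr 1 rA rJ rI ;;
     IfA aD rA 2 (Clear rA ;; Addr 1 rA rJ' rI ;; IfA aD rA 2 AddSign Skip) Skip ;; Clear rA"
  show "sem L (For rI ?p) (acca ?c z, a) =
    (acca ?c (z + (\<Sum>i<L. row j i * (row j' i * sg (a aH (\<tau> * L + j'))))), a)"
  proof (rule sem_For_sum)
    fix i z assume i: "i < L"
    let ?d = "?c(rI := i)"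
    have d: "?d rT1 = 0" "?d rA = 0" "?d rJ = j" "?d rJ' = j'" "?d rI = i" "?d rQ = \<tau> * L + j'"
      using assms by (auto simp: idle_def)
    have D: "a aD (j * L + i) = 2 \<longleftrightarrow> essential j i" "a aD (j' * L + i) = 2 \<longleftrightarrow> essential j' i"
      using assms(1,6) j' i by (auto simp: env_def)
    have clear: "(acca (?d(rA := v)) z)(rA := 0) = acca ?d z" for v z
      using d(2) by (auto simp: acc_def fun_eq_iff fun_upd_apply)
    have addr: "sem L (Addr 1 rA rJ rI) (acca ?d z, a) = (acca (?d(rA := j * L + i)) z, a)"
      "sem L (Addr 1 rA rJ' rI) (acca ?d z, a) = (acca (?d(rA := j' * L + i)) z, a)"
      using d i j' assms(6) by (simp_all add: sem_Addr acc_upd)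
    show "sem L ?p (acca ?d z, a) = (acca ?d (z + row j i * (row j' i * sg (a aH (\<tau> * L + j')))), a)"
      using D by (simp add: addr[unfolded One_nat_def] clear sem_AddSign)
  qed (use assms in auto)
qed (use assms in \<open>auto simp: idle_def\<close>)

lemma sem_SumTotal:
  assumes "idle c" "c rJ' = 0" "c rJ = j" "j < L"
  shows "sem L SumTotal (acca c z, a) = (acca c (z + (\<Sum>\<tau><L ^ 4. sg (a aH (\<tau> * L + j)))), a)"
proof -
  have "sem L SumTotal (acca c z, a) =
      (acca c (z + (\<Sum>\<tau><L ^ 4. \<Sum>j'<L. if j' = j then sg (a aH (\<tau> * L + j)) else 0)), a)"
    unfolding SumTotal_def
  proof (rule sem_Scan)
    fix \<tau> j' z assume j': "j' < L"
    let ?c = "c(rJ' := j', rQ := \<tau> * L + j')"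
    have "?c rT1 = 0" "?c rT2 = 0" "?c rJ = j" "?c rJ' = j'" "?c rQ = \<tau> * L + j'"
      using assms by (auto simp: idle_def)
    then show "sem L (IfEq rJ rJ' AddSign Skip) (acca ?c z, a) =
        (acca ?c (z + (if j' = j then sg (a aH (\<tau> * L + j)) else 0)), a)"
      using assms(4) by (auto simp: sem_IfEq sem_AddSign)
  qed (use assms in \<open>auto simp: idle_def\<close>)
  then show ?thesis using assms(4) by simp
qed

lemma sem_SumVec:
  assumes "env a" "idle c" "c rJ' = 0" "c rI = i" "i < L"
  shows "sem L SumVec (acca c z, a) =
    (acca c (z + (\<Sum>\<tau><L ^ 4. \<Sum>j<L. sg (a aH (\<tau> * L + j)) * row j i)), a)"
  unfolding SumVec_def
proof (rule sem_Scan)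
  fix \<tau> j z assume j: "j < L"
  let ?d = "c(rJ' := j, rQ := \<tau> * L + j)"
  have d: "?d rT1 = 0" "?d rA = 0" "?d rJ' = j" "?d rI = i" "?d rQ = \<tau> * L + j"
    using assms by (auto simp: idle_def)
  have D: "a aD (j * L + i) = 2 \<longleftrightarrow> essential j i"
    using assms(1,5) j by (auto simp: env_def)
  have clear: "(acca (?d(rA := v)) z)(rA := 0) = acca ?d z" for v z
    using d(2) by (auto simp: acc_def fun_eq_iff fun_upd_apply)
  have addr: "sem L (Addr 1 rA rJ' rI) (acca ?d z, a) = (acca (?d(rA := j * L + i)) z, a)"
    using d j assms(5) by (simp add: sem_Addr acc_upd)
  show "sem L (Addr 1 rA rJ' rI ;; IfA aD rA 2 AddSign Skip ;; Clear rA) (acca ?d z, a) =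
      (acca ?d (z + sg (a aH (\<tau> * L + j)) * row j i), a)"
    using D by (simp add: addr[unfolded One_nat_def] clear sem_AddSign)
qed (use assms in \<open>auto simp: idle_def\<close>)

definition code :: "int \<Rightarrow> nat" where
  "code z = (if z = 1 then 2 else if z = - 1 then 1 else 0)"

lemma sig_cases: "sig j0 t j \<in> {-1, 0, 1}"
  by (simp add: sig_def perceptron_sign_def)

lemma sg_code: "sg (code (sig j0 t j)) = sig j0 t j"
  using sig_cases[of j0 t j] by (auto simp: sg_def code_def)

text \<open>Zeros for the rounds from \<open>t\<close> on make them contribute nothing, so a scan
  over all \<open>L ^ 4\<close> rounds yields the vector after \<open>t\<close> rounds.\<close>

definition history :: "nat \<Rightarrow> nat \<Rightarrow> (nat \<Rightarrow> nat) \<Rightarrow> bool" where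
  "history j0 t H \<longleftrightarrow> (\<forall>\<tau><L ^ 4. \<forall>j<L. H (\<tau> * L + j) = (if \<tau> < t then code (sig j0 \<tau> j) else 0))"

lemma inner_product_history:
  assumes "history j0 t H" "t \<le> L ^ 4"
  shows "(\<Sum>\<tau><L ^ 4. \<Sum>j'<L. \<Sum>i<L. row j i * (row j' i * sg (H (\<tau> * L + j')))) =
    (\<Sum>i<L. row j i * vec j0 t i)"
proof -
  have "(\<Sum>\<tau><L ^ 4. \<Sum>j'<L. \<Sum>i<L. row j i * (row j' i * sg (H (\<tau> * L + j')))) =
      (\<Sum>\<tau><t. \<Sum>j'<L. \<Sum>i<L. row j i * (row j' i * sig j0 \<tau> j'))"
    by (rule sum.mono_neutral_cong_right)
      (use assms in \<open>auto simp: history_def sg_code sg_def[of 0] intro!: sum.cong\<close>)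
  also have "\<dots> = (\<Sum>\<tau><t. \<Sum>i<L. \<Sum>j'<L. row j i * (row j' i * sig j0 \<tau> j'))"
    by (intro sum.cong refl sum.swap)
  also have "\<dots> = (\<Sum>i<L. \<Sum>\<tau><t. \<Sum>j'<L. row j i * (row j' i * sig j0 \<tau> j'))"
    by (rule sum.swap)
  also have "\<dots> = (\<Sum>i<L. row j i * vec j0 t i)"
    unfolding vec_eq_sum sum_distrib_left by (intro sum.cong refl) (simp add: mult.commute)
  finally show ?thesis .
qed

lemma sem_Round:
  assumes "env a" "idle c" "c rI = 0" "c rJ = 0" "c rJ' = 0" "c rJ0 = j0" "j0 < L" "c rT = t" "t < L ^ 4"
    and H: "history j0 t (a aH)" and tmp: "\<forall>j. \<not> active j \<longrightarrow> a aTmp j = 0"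
  shows "\<exists>a'. sem L Round (c, a) = (c, a') \<and> frame {aTmp, aH} a a' \<and>
    history j0 (Suc t) (a' aH) \<and> (\<forall>j. \<not> active j \<longrightarrow> a' aTmp j = 0)"
proof -
  define T where "T = (\<lambda>k j. if j < k \<and> active j then code (sig j0 t j) else a aTmp j)"
  let ?p = "IfA aAct rJ 1 (IfEq rJ rJ0 (Put aTmp rJ 2)
       (InnerProduct ;; IfZ rPa (Put aTmp rJ 2) (Put aTmp rJ 1) ;; Clear rPa ;; Clear rNa)) Skip"
  have "sem L (For rJ ?p) (c, a(aTmp := T 0)) = (c, a(aTmp := T L))"
  proof (rule sem_For[where g = "\<lambda>_. c" and f = "\<lambda>k. a(aTmp := T k)"])
    fix k assume k: "k < L"
    let ?c = "c(rJ := k)" and ?a = "a(aTmp := T k)"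
    have idle: "idle ?c" "?c rPa = 0" "?c rNa = 0" "?c rT1 = 0" "?c rT2 = 0"
      using assms(2) by (auto simp: idle_def)
    have T_Suc: "T (Suc k) = (if active k then (T k)(k := code (sig j0 t k)) else T k)"
      by (auto simp: T_def fun_eq_iff fun_upd_apply less_Suc_eq)
    have env: "env ?a" using assms(1) by (simp add: env_def)
    let ?s = "\<Sum>i<L. row k i * vec j0 t i"
    have acc: "acca ?c 0 = ?c" by (rule acc_0) (fact idle)+
    have ip: "sem L InnerProduct (?c, ?a) = (acca ?c ?s, ?a)"
      using sem_InnerProduct[OF env idle(1), of k 0] inner_product_history[OF H, of k] assms k
      by (simp add: acc)
    have clear: "(acca ?c s)(rPa := 0, rNa := 0) = ?c" for s
      using idle(2,3) by (auto simp: acc_def fun_eq_iff fun_upd_apply)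
    show "sem L ?p (?c, ?a) = (?c, a(aTmp := T (Suc k)))"
    proof (cases "active k")
      case False
      then show ?thesis using assms(1) by (simp add: T_Suc env_def)
    next
      case True
      have act: "?a aAct (?c rJ) = 1" using True assms(1) by (simp add: env_def)
      show ?thesis
      proof (cases "k = j0")
        case eq: True
        have "code (sig j0 t k) = 2" using True eq by (simp add: sig_def perceptron_sign_def code_def)
        then show ?thesis using act eq[symmetric] idle k assms(6) True by (simp add: T_Suc sem_IfEq)
      next
        case neq: False
        \<comment> \<open>\<open>nat ?s\<close> is 0 exactly if the inner product is not positive,
          so testing \<open>rPa\<close> for 0 decides the sign.\<close>
        have "code (sig j0 t k) = (if nat ?s = 0 then 2 else 1)"
          using True neq by (simp add: sig_def perceptron_sign_def code_def)
        moreover have "acca ?c ?s rPa = nat ?s" by (simp add: acc_def)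
        ultimately show ?thesis using act neq idle k assms(6) True
          by (auto simp: T_Suc sem_IfEq ip clear)
      qed
    qed
  qed (use assms in auto)
  moreover have "a(aTmp := T 0) = a" by (simp add: T_def fun_upd_idem)
  ultimately have 1: "sem L (For rJ ?p) (c, a) = (c, a(aTmp := T L))" by simp
  define b where "b = a(aTmp := T L)"
  have T_val: "b aTmp j = code (sig j0 t j)" if "j < L" for j
    using that tmp by (auto simp: b_def T_def sig_def code_def)
  \<comment> \<open>Cells with a 0 in \<open>aTmp\<close> are skipped by the copy; they belong to
    outputs that are not active, and their history entries are 0 already.\<close>
  define G where "G = (\<lambda>k p. if t * L \<le> p \<and> p < t * L + k \<and> b aTmp (p - t * L) \<noteq> 0 then b aTmp (p - t * L) else b aH p)"
  let ?q = "Addr 4 rA rT rJ ;; IfA aTmp rJ 2 (Put aH rA 2) (IfA aTmp rJ 1 (Put aH rA 1) Skip) ;; Clear rA"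
  have "sem L (For rJ ?q) (c, b(aH := G 0)) = (c, b(aH := G L))"
  proof (rule sem_For[where g = "\<lambda>_. c" and f = "\<lambda>k. b(aH := G k)"])
    fix k assume k: "k < L"
    let ?c = "c(rJ := k)"
    have idle: "?c rT1 = 0" "?c rA = 0" using assms(2) by (auto simp: idle_def)
    have addr: "sem L (Addr 4 rA rT rJ) (?c, b(aH := G k)) = (?c(rA := t * L + k), b(aH := G k))"
      by (subst sem_Addr) (use idle assms(8,9) k in auto)
    have clear: "?c(rA := 0) = ?c" using idle(2) by (simp add: fun_upd_idem)
    have G_Suc: "G (Suc k) = (if b aTmp k = 0 then G k else (G k)(t * L + k := b aTmp k))"
    proof
      fix p
      show "G (Suc k) p = (if b aTmp k = 0 then G k else (G k)(t * L + k := b aTmp k)) p"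
        by (cases "p = t * L + k") (auto simp: G_def fun_upd_apply)
    qed
    have "b aTmp k = 0 \<or> b aTmp k = 1 \<or> b aTmp k = 2" by (simp add: T_val[OF k] code_def)
    then show "sem L ?q (?c, b(aH := G k)) = (?c, b(aH := G (Suc k)))"
      by (auto simp: addr clear G_Suc)
  qed (use assms in auto)
  moreover have "G 0 = b aH" by (auto simp: G_def fun_eq_iff)
  ultimately have 2: "sem L (For rJ ?q) (c, b) = (c, b(aH := G L))" by (simp add: fun_upd_idem)
  have "history j0 (Suc t) (G L)"
    unfolding history_def
  proof (intro allI impI)
    fix \<tau> j assume h: "\<tau> < L ^ 4" "j < L"
    have old: "b aH (\<tau> * L + j) = (if \<tau> < t then code (sig j0 \<tau> j) else 0)"
      using H h by (simp add: b_def history_def)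
    show "G L (\<tau> * L + j) = (if \<tau> < Suc t then code (sig j0 \<tau> j) else 0)"
    proof (cases "\<tau> = t")
      case True
      then show ?thesis using h old T_val[of j] by (simp add: G_def)
    next
      case False
      have "\<not> (t * L \<le> \<tau> * L + j \<and> \<tau> * L + j < t * L + L)"
      proof
        assume a: "t * L \<le> \<tau> * L + j \<and> \<tau> * L + j < t * L + L"
        define i where "i = \<tau> * L + j - t * L"
        have "i < L" "\<tau> * L + j = t * L + i" using a by (auto simp: i_def)
        with index_eq[of j L i \<tau> t] h(2) False show False by simp
      qed
      then show ?thesis using old False by (auto simp: G_def)
    qed
  qed
  moreover have "sem L Round (c, a) = (c, b(aH := G L))"
    using 1 2 by (simp add: Round_def b_def)
  moreover have "frame {aTmp, aH} a (b(aH := G L))"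
    by (auto simp: frame_def b_def fun_upd_apply)
  moreover have "\<forall>j. \<not> active j \<longrightarrow> (b(aH := G L)) aTmp j = 0"
    using tmp by (simp add: b_def T_def)
  ultimately show ?thesis by auto
qed

lemma sem_Rounds:
  assumes "env a" "idle c" "c rI = 0" "c rJ = 0" "c rJ' = 0" "c rJ0 = j0" "j0 < L" "c rT = 0"
    and tmp: "\<forall>j. \<not> active j \<longrightarrow> a aTmp j = 0"
  shows "\<exists>a'. sem L Rounds (c, a) = (c, a') \<and> frame {aTmp, aH} a a' \<and>
    history j0 (L ^ 4) (a' aH) \<and> (\<forall>j. \<not> active j \<longrightarrow> a' aTmp j = 0)"
proof -
  have 1: "(sem L (Put aH rQ 0 ;; Inc rQ) ^^ k) (c, a) = (c(rQ := k), a(aH := (\<lambda>p. if p < k then 0 else a aH p)))" for k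
  proof (induction k)
    case 0
    then show ?case using assms(2) by (simp add: fun_upd_idem idle_def)
  next
    case (Suc k)
    have "(\<lambda>p. if p < k then 0 else a aH p)(k := 0) = (\<lambda>p. if p < Suc k then 0 else a aH p)"
      by (auto simp: fun_eq_iff fun_upd_apply)
    then show ?case using Suc by simp
  qed
  define b where "b = a(aH := (\<lambda>p. if p < L ^ 5 then 0 else a aH p))"
  have H: "history j0 0 (b aH)"
    unfolding history_def
  proof (intro allI impI)
    fix \<tau> j assume h: "\<tau> < L ^ 4" "j < L"
    then have "\<tau> * L + j < Suc \<tau> * L" by simp
    also have "\<dots> \<le> L ^ 4 * L" using h(1) by (intro mult_le_mono1) simp
    also have "\<dots> = L ^ 5" by (simp add: power_Suc2[symmetric] del: power_Suc power_Suc2)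
    finally show "b aH (\<tau> * L + j) = (if \<tau> < 0 then code (sig j0 \<tau> j) else 0)" by (simp add: b_def)
  qed
  have "\<exists>a'. (sem L (Round ;; Inc rT) ^^ k) (c, b) = (c(rT := k), a') \<and> frame {aTmp, aH} a a' \<and>
    history j0 k (a' aH) \<and> (\<forall>j. \<not> active j \<longrightarrow> a' aTmp j = 0)" if "k \<le> L ^ 4" for k
    using that
  proof (induction k)
    case 0
    have "frame {aTmp, aH} a b" by (auto simp: frame_def b_def fun_upd_apply)
    moreover have "\<forall>j. \<not> active j \<longrightarrow> b aTmp j = 0" using tmp by (simp add: b_def)
    ultimately show ?case using H assms(8) by (auto simp: fun_upd_idem)
  next
    case (Suc k)
    then obtain a1 where a1: "(sem L (Round ;; Inc rT) ^^ k) (c, b) = (c(rT := k), a1)" "frame {aTmp, aH} a a1"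
      "history j0 k (a1 aH)" "\<forall>j. \<not> active j \<longrightarrow> a1 aTmp j = 0" by auto
    have "env a1" using assms(1) a1(2) by (simp add: env_def frame_def)
    moreover have "idle (c(rT := k))" using assms(2) by (simp add: idle_def)
    ultimately obtain a2 where "sem L Round (c(rT := k), a1) = (c(rT := k), a2)" "frame {aTmp, aH} a1 a2"
      "history j0 (Suc k) (a2 aH)" "\<forall>j. \<not> active j \<longrightarrow> a2 aTmp j = 0"
      using sem_Round[of a1 "c(rT := k)" j0 k] a1(3,4) Suc.prems assms by auto
    with a1 show ?case by (auto intro: frame_trans)
  qed
  from this[of "L ^ 4"] obtain a' where a': "(sem L (Round ;; Inc rT) ^^ (L ^ 4)) (c, b) = (c(rT := L ^ 4), a')"
    "frame {aTmp, aH} a a'" "history j0 (L ^ 4) (a' aH)" "\<forall>j. \<not> active j \<longrightarrow> a' aTmp j = 0" by auto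
  have "c(rQ := 0) = c" "c(rT := 0) = c" using assms(2,8) by (auto simp: idle_def fun_upd_idem)
  then have "sem L Rounds (c, a) = (c, a')"
    using 1[of "L ^ 5"] a'(1) by (simp add: Rounds_def sem_LoopN b_def)
  with a' show ?thesis by blast
qed

lemma sem_Absorb:
  assumes p: "\<And>c z. sem L p (accz c z, a) = (accz c (z + e), a)"
    and c: "c rPa = 0" "c rNa = 0" and s: "\<bar>s\<bar> \<le> int (L ^ 5)"
  shows "sem L (Absorb p) (acca (accz c z) s, a) = (accz c (z + e * \<bar>s\<bar>), a)"
proof -
  let ?d = "c(rNa := nat (- s))"
  have 1: "(sem L (Drain rPa p) ^^ (L ^ 5)) ((accz ?d (z + e * int 0))(rPa := nat s), a) =
      ((accz ?d (z + e * int (nat s)))(rPa := 0), a)"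
  proof (rule sem_Drain[where g = "\<lambda>k. accz ?d (z + e * int k)" and f = "\<lambda>_. a"])
    fix k
    show "sem L p ((accz ?d (z + e * int k))(rPa := nat s - Suc k), a) =
        ((accz ?d (z + e * int (Suc k)))(rPa := nat s - Suc k), a)"
      using p[of "?d(rPa := nat s - Suc k)" "z + e * int k"] by (simp add: acc_upd algebra_simps)
  qed (use s in linarith)
  have 2: "(sem L (Drain rNa p) ^^ (L ^ 5)) ((accz c (z + e * int (nat s) + e * int 0))(rNa := nat (- s)), a) =
      ((accz c (z + e * int (nat s) + e * int (nat (- s))))(rNa := 0), a)"
  proof (rule sem_Drain[where g = "\<lambda>k. accz c (z + e * int (nat s) + e * int k)" and f = "\<lambda>_. a"])
    fix k
    show "sem L p ((accz c (z + e * int (nat s) + e * int k))(rNa := nat (- s) - Suc k), a) =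
        ((accz c (z + e * int (nat s) + e * int (Suc k)))(rNa := nat (- s) - Suc k), a)"
      using p[of "c(rNa := nat (- s) - Suc k)" "z + e * int (nat s) + e * int k"] by (simp add: acc_upd algebra_simps)
  qed (use s in linarith)
  have i1: "(accz ?d (z + e * int 0))(rPa := nat s) = acca (accz c z) s"
    by (auto simp: acc_def fun_eq_iff fun_upd_apply)
  have i2: "(accz ?d (z + e * int (nat s)))(rPa := 0) = (accz c (z + e * int (nat s) + e * int 0))(rNa := nat (- s))"
    using c by (auto simp: acc_def fun_eq_iff fun_upd_apply)
  have "e * int (nat s) + e * int (nat (- s)) = e * \<bar>s\<bar>" by (cases "s \<ge> 0") auto
  then have i3: "(accz c (z + e * int (nat s) + e * int (nat (- s))))(rNa := 0) = accz c (z + e * \<bar>s\<bar>)"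
    using c by (auto simp: acc_def fun_eq_iff fun_upd_apply add.assoc)
  show ?thesis using 1[unfolded i1 i2] 2[unfolded i3]
    by (simp only: Absorb_def sem_pair sem_LoopN)
qed

lemma abs_total_le: "\<bar>total j0 j\<bar> \<le> int (L ^ 5)"
proof -
  have "\<bar>total j0 j\<bar> \<le> (\<Sum>t<L ^ 4. \<bar>sig j0 t j\<bar>)" unfolding total_def by (rule sum_abs)
  also have "\<dots> \<le> (\<Sum>t<L ^ 4. 1)"
  proof (rule sum_mono)
    fix t show "\<bar>sig j0 t j\<bar> \<le> 1" using sig_cases[of j0 t j] by auto
  qed
  also have "\<dots> \<le> int (L ^ 5)" using L by (simp add: power_increasing)
  finally show ?thesis .
qed

lemma abs_vec_le: "\<bar>vec j0 (L ^ 4) i\<bar> \<le> int (L ^ 5)"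
proof -
  have "\<bar>vec j0 (L ^ 4) i\<bar> \<le> (\<Sum>t<L ^ 4. \<bar>\<Sum>j<L. sig j0 t j * row j i\<bar>)"
    unfolding vec_eq_sum by (rule sum_abs)
  also have "\<dots> \<le> (\<Sum>t<L ^ 4. \<Sum>j<L. \<bar>sig j0 t j * row j i\<bar>)" by (intro sum_mono sum_abs)
  also have "\<dots> \<le> (\<Sum>t<L ^ 4. \<Sum>j<L. 1)"
  proof (intro sum_mono)
    fix t j show "\<bar>sig j0 t j * row j i\<bar> \<le> 1" using sig_cases[of j0 t j] by (auto simp: abs_mult)
  qed
  also have "\<dots> = int (L ^ 5)" by (simp add: power_Suc2[symmetric] del: power_Suc power_Suc2)
  finally show ?thesis .
qed

lemma history_total: "history j0 (L ^ 4) H \<Longrightarrow> j < L \<Longrightarrow> (\<Sum>\<tau><L ^ 4. sg (H (\<tau> * L + j))) = total j0 j"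
  by (simp add: history_def sg_code total_def)

lemma history_vec:
  "history j0 (L ^ 4) H \<Longrightarrow> (\<Sum>\<tau><L ^ 4. \<Sum>j<L. sg (H (\<tau> * L + j)) * row j i) = vec j0 (L ^ 4) i"
  by (simp add: history_def sg_code vec_eq_sum)

lemma idle_accz: "idle c \<Longrightarrow> idle (accz c z)"
  by (simp add: idle_def)

lemma sem_Compare:
  assumes "env a" "idle c" "c rI = 0" "c rJ = 0" "c rJ' = 0" "c rPz = 0" "c rNz = 0"
    and H: "history j0 (L ^ 4) (a aH)"
  shows "sem L Compare (c, a) = (accz c ((\<Sum>j<L. \<bar>total j0 j\<bar>) - (\<Sum>i<L. \<bar>vec j0 (L ^ 4) i\<bar>)), a)"
proof -
  have 1: "sem L (For rJ (SumTotal ;; Absorb (IncI rPz rNz))) (accz c z, a) =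
      (accz c (z + (\<Sum>j<L. \<bar>total j0 j\<bar>)), a)" for z
  proof (rule sem_For_sum)
    fix j z assume j: "j < L"
    let ?c = "c(rJ := j)"
    have "idle (accz ?c z)" using assms(2) by (intro idle_accz) (simp add: idle_def)
    then have "sem L SumTotal (acca (accz ?c z) 0, a) = (acca (accz ?c z) (total j0 j), a)"
      using sem_SumTotal[of "accz ?c z" j 0 a] j assms history_total[OF H j] by simp
    moreover have "acca (accz ?c z) 0 = accz ?c z"
      using assms(2) by (intro acc_0) (auto simp: idle_def)
    moreover have "sem L (Absorb (IncI rPz rNz)) (acca (accz ?c z) (total j0 j), a) =
        (accz ?c (z + 1 * \<bar>total j0 j\<bar>), a)"
      by (rule sem_Absorb) (use assms(2) abs_total_le in \<open>auto simp: sem_IncI idle_def\<close>)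
    ultimately show "sem L (SumTotal ;; Absorb (IncI rPz rNz)) (accz ?c z, a) = (accz ?c (z + \<bar>total j0 j\<bar>), a)"
      by simp
  qed (use assms in auto)
  have 2: "sem L (For rI (SumVec ;; Absorb (DecI rPz rNz))) (accz c z, a) =
      (accz c (z + (\<Sum>i<L. - \<bar>vec j0 (L ^ 4) i\<bar>)), a)" for z
  proof (rule sem_For_sum)
    fix i z assume i: "i < L"
    let ?c = "c(rI := i)"
    have "idle (accz ?c z)" using assms(2) by (intro idle_accz) (simp add: idle_def)
    then have "sem L SumVec (acca (accz ?c z) 0, a) = (acca (accz ?c z) (vec j0 (L ^ 4) i), a)"
      using sem_SumVec[of a "accz ?c z" i 0] i assms history_vec[OF H, of i] by simp
    moreover have "acca (accz ?c z) 0 = accz ?c z"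
      using assms(2) by (intro acc_0) (auto simp: idle_def)
    moreover have "sem L (Absorb (DecI rPz rNz)) (acca (accz ?c z) (vec j0 (L ^ 4) i), a) =
        (accz ?c (z + (-1) * \<bar>vec j0 (L ^ 4) i\<bar>), a)"
      by (rule sem_Absorb) (use assms(2) abs_vec_le in \<open>auto simp: sem_DecI idle_def\<close>)
    ultimately show "sem L (SumVec ;; Absorb (DecI rPz rNz)) (accz ?c z, a) = (accz ?c (z + - \<bar>vec j0 (L ^ 4) i\<bar>), a)"
      by simp
  qed (use assms in auto)
  show ?thesis using 1[of 0] 2 assms(6,7) by (simp add: Compare_def acc_0 sum_negf)
qed

lemma sem_Assign:
  assumes "env a" "idle c" "c rJ = 0" "c rJ' = 0" "c rPz = 0" "c rNz = 0"
    and H: "history j0 (L ^ 4) (a aH)" and Z: "Z > 0 \<longleftrightarrow> success j0"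
  shows "sem L Assign (accz c Z, a) = (c, a(aLab := assign j0 (a aLab)))"
proof -
  define W where "W = (\<lambda>k j. if j < k \<and> active j \<and> a aLab j = 0 then if total j0 j > 0 then 2 else 1 else a aLab j)"
  let ?p = "IfA aAct rJ 1 (IfA aLab rJ 0
     (SumTotal ;; IfZ rPa (Put aLab rJ 1) (Put aLab rJ 2) ;; Clear rPa ;; Clear rNa) Skip) Skip"
  have "sem L (For rJ ?p) (accz c Z, a(aLab := W 0)) = (accz c Z, a(aLab := W L))"
  proof (rule sem_For[where g = "\<lambda>_. accz c Z" and f = "\<lambda>k. a(aLab := W k)"])
    fix k assume k: "k < L"
    let ?c = "(accz c Z)(rJ := k)" and ?a = "a(aLab := W k)"
    have idle: "idle ?c" "?c rPa = 0" "?c rNa = 0"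
      using assms(2) by (auto simp: idle_def)
    have W_Suc: "W (Suc k) = (if active k \<and> a aLab k = 0 then (W k)(k := if total j0 k > 0 then 2 else 1) else W k)"
      by (auto simp: W_def fun_eq_iff fun_upd_apply less_Suc_eq)
    have W_k: "W k k = a aLab k" by (simp add: W_def)
    have acc: "acca ?c 0 = ?c" by (rule acc_0) (fact idle)+
    have sum: "sem L SumTotal (?c, ?a) = (acca ?c (total j0 k), ?a)"
      using sem_SumTotal[OF idle(1), of k 0 ?a] k assms history_total[OF H k] by (simp add: acc)
    have clear: "(acca ?c s)(rPa := 0, rNa := 0) = ?c" for s
      using idle(2,3) by (auto simp: acc_def fun_eq_iff fun_upd_apply)
    have "acca ?c (total j0 k) rPa = nat (total j0 k)" by (simp add: acc_def)
    then show "sem L ?p (?c, ?a) = (?c, a(aLab := W (Suc k)))"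
      using assms(1) by (auto simp: env_def W_Suc W_k sum[unfolded One_nat_def] clear)
  qed (use assms in auto)
  moreover have "W L = (\<lambda>j. if active j \<and> a aLab j = 0 then if total j0 j > 0 then 2 else 1 else a aLab j)"
    using active_less by (auto simp: W_def fun_eq_iff)
  moreover have "a(aLab := W 0) = a" by (simp add: W_def fun_upd_idem)
  ultimately have loop: "sem L (For rJ ?p) (accz c Z, a) =
      (accz c Z, a(aLab := (\<lambda>j. if active j \<and> a aLab j = 0 then if total j0 j > 0 then 2 else 1 else a aLab j)))"
    by simp
  have clear: "(accz c Z)(rPz := 0, rNz := 0) = c"
    using assms by (auto simp: acc_def fun_eq_iff fun_upd_apply)
  show ?thesis
  proof (cases "success j0")
    case True
    then have "accz c Z rPz \<noteq> 0" using Z by (simp add: acc_def)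
    then show ?thesis
      using True by (simp add: Assign_def loop[unfolded One_nat_def] clear assign_def[unfolded One_nat_def])
  next
    case False
    then have "accz c Z rPz = 0" using Z by (simp add: acc_def)
    then show ?thesis
      using False clear by (simp add: Assign_def assign_def fun_upd_idem)
  qed
qed

lemma sem_Avoid:
  assumes "has (a aIn) 0 (encode_circuit C)" "\<forall>A. A \<noteq> aIn \<longrightarrow> a A = (\<lambda>_. 0)"
  shows "snd (sem L Avoid (\<lambda>_. 0, a)) aLab = final"
proof -
  let ?c = "\<lambda>_. 0 :: nat"
  have idle: "idle ?c" by (simp add: idle_def)
  have base: "base a" using assms by (simp add: base_def)
  obtain a1 where a1: "sem L Force (?c, a) = (?c, a1)" "base a1" "frame {aV, aX, aO, aAsg, aLab} a a1"
    "labels a1 = forced"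
    using sem_Force[OF base idle] assms(2) by auto
  obtain a2 where a2: "sem L Essential (?c, a1) = (?c, a2)" "base a2" "frame {aV, aX, aO, aD} a1 a2"
    "\<forall>j<L. \<forall>i<L. a2 aD (j * L + i) = 2 \<longleftrightarrow> essential j i"
    using sem_Essential[OF a1(2) idle] a1(3,4) assms(2) by (auto simp: frame_def prod_eq_iff)
  obtain a3 where a3: "sem L Active (?c, a2) = (?c, a3)" "frame {aV, aX, aO, aAct} a2 a3"
    "\<forall>j. a3 aO j \<noteq> 0 \<longleftrightarrow> j < m" "\<forall>j. a3 aAct j = of_bool (active j)"
    using sem_Active[OF a2(2) idle] a1(3,4) a2(3) assms(2) by (auto simp: frame_def)
  have env3: "env a3" using a2(4) a3(2,4) by (simp add: env_def frame_def)
  \<comment> \<open>\<open>aTmp\<close> is not erased between guesses, so its zeros outside the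
    active outputs are part of the invariant; \<open>aO\<close> is preserved for
    \<open>Finish\<close>.\<close>
  let ?I = "\<lambda>k b. env b \<and> b aO = a3 aO \<and> (\<forall>j. \<not> active j \<longrightarrow> b aTmp j = 0) \<and> b aLab = fold assign [0..<k] lab"
  have "\<exists>a'. sem L (For rJ0 (Rounds ;; Compare ;; Assign)) (?c, a3) = (?c, a') \<and> ?I L a'"
  proof (rule sem_For_clean[where I = ?I])
    have "a3 aTmp = (\<lambda>_. 0)" "a3 aLab = lab"
      using a1(3,4) a2(3) a3(2) assms(2) by (auto simp: frame_def prod_eq_iff)
    with env3 show "?I 0 a3" by simp
  next
    fix k b assume k: "k < L" and b: "?I k b"
    let ?d = "?c(rJ0 := k)"
    have d: "idle ?d" "?d rI = 0" "?d rJ = 0" "?d rJ' = 0" "?d rT = 0" "?d rPz = 0" "?d rNz = 0" "?d rJ0 = k"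
      by (simp_all add: idle_def)
    obtain b1 where b1: "sem L Rounds (?d, b) = (?d, b1)" "frame {aTmp, aH} b b1" "history k (L ^ 4) (b1 aH)"
      "\<forall>j. \<not> active j \<longrightarrow> b1 aTmp j = 0"
      using sem_Rounds[of b ?d k] b k d by auto
    have env: "env b1" using b b1(2) by (simp add: env_def frame_def)
    let ?Z = "(\<Sum>j<L. \<bar>total k j\<bar>) - (\<Sum>i<L. \<bar>vec k (L ^ 4) i\<bar>)"
    have "sem L Compare (?d, b1) = (accz ?d ?Z, b1)"
      by (rule sem_Compare[OF env d(1-4,6,7) b1(3)])
    moreover have "sem L Assign (accz ?d ?Z, b1) = (?d, b1(aLab := assign k (b1 aLab)))"
      by (rule sem_Assign[OF env d(1,3,4,6,7) b1(3)]) (simp add: success_def)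
    moreover have "?I (Suc k) (b1(aLab := assign k (b1 aLab)))"
      using b b1(2,4) env by (simp add: frame_def env_def)
    ultimately show "\<exists>a'. sem L (Rounds ;; Compare ;; Assign) (?d, b) = (?d, a') \<and> ?I (Suc k) a'"
      using b1(1) by auto
  qed simp
  then obtain a4 where a4: "sem L (For rJ0 (Rounds ;; Compare ;; Assign)) (?c, a3) = (?c, a4)"
    "a4 aO = a3 aO" "a4 aLab = chosen" by (auto simp: chosen_def)
  define W where "W = (\<lambda>k j. if j < k then final j else chosen j)"
  let ?p = "IfA aO rJ 0 Skip (IfA aLab rJ 0 (Put aLab rJ 1) Skip)"
  have "sem L (For rJ ?p) (?c, a4(aLab := W 0)) = (?c, a4(aLab := W L))"
  proof (rule sem_For[where g = "\<lambda>_. ?c" and f = "\<lambda>k. a4(aLab := W k)"])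
    fix k
    have W_Suc: "W (Suc k) = (if k < m \<and> chosen k = 0 then (W k)(k := 1) else W k)"
      by (auto simp: W_def fun_eq_iff fun_upd_apply less_Suc_eq final_def)
    have W_k: "W k k = chosen k" by (simp add: W_def)
    show "sem L ?p (?c(rJ := k), a4(aLab := W k)) = (?c(rJ := k), a4(aLab := W (Suc k)))"
    proof (cases "k < m")
      case True
      then have "a4 aO k \<noteq> 0" using a3(3) a4(2) by simp
      then show ?thesis using True by (simp add: W_Suc W_k)
    next
      case False
      then have "a4 aO k = 0" using a3(3)[rule_format, of k] a4(2) by simp
      then show ?thesis using False by (simp add: W_Suc)
    qed
  qed auto
  moreover have "a4(aLab := W 0) = a4" using a4(3) by (simp add: W_def fun_upd_idem)
  moreover have "W L = final" using L by (auto simp: W_def fun_eq_iff final_def)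
  ultimately have "sem L Finish (?c, a4) = (?c, a4(aLab := final))" by (simp add: Finish_def)
  then have "sem L Avoid (?c, a) = (?c, a4(aLab := final))"
    by (simp only: Avoid_def sem_pair a1(1) a2(1) a3(1) a4(1))
  then show ?thesis by simp
qed

end

theorem mainTheorem4:
  "\<exists>k G M (p :: nat poly). turing_machine k G M \<and>
     (\<forall>d f C. monotone_NC0 3 d f C \<and> num_outputs C > num_inputs C \<longrightarrow>
        (\<exists>y. length y = num_outputs C \<and> y \<notin> circuit_range C \<and>
             outputs_within k M (encode_circuit C) y (poly p (length (encode_circuit C)))))"
proof -
  obtain k M p where M: "turing_machine k 3 M"
    "\<And>w y. snd (sem (length w) Avoid (init_state w)) 1 = (\<lambda>i. word_tape y (int i)) \<Longrightarrow>
       outputs_within k M w y (poly p (length w))"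
    using loop_program_machine[OF wf_Avoid] by auto
  have "\<exists>y. length y = num_outputs C \<and> y \<notin> circuit_range C \<and>
      outputs_within k M (encode_circuit C) y (poly p (length (encode_circuit C)))"
    if "monotone_NC0 3 d f C" "num_outputs C > num_inputs C" for d f C
  proof -
    interpret avoid_instance C d f
      using that by unfold_locales
    let ?y = "map (\<lambda>j. final j = 2) [0..<num_outputs C]"
    have "snd (sem L Avoid (init_state (encode_circuit C))) 1 = final"
      unfolding init_state_def
      by (rule sem_Avoid) (auto simp: has_def bsym_def word_tape_def)
    \<comment> \<open>Array 1 is the output tape; its cells from \<open>num_outputs C\<close> on are
      blank by \<open>final_symbols\<close>, so it holds exactly this word.\<close>
    also have "final = (\<lambda>i. word_tape ?y (int i))"
    proof
      fix i
      show "final i = word_tape ?y (int i)"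
        using final_symbols[of i] by (cases "i < num_outputs C") (auto simp: word_tape_def)
    qed
    finally have "outputs_within k M (encode_circuit C) ?y (poly p (length (encode_circuit C)))"
      by (rule M(2))
    then show ?thesis using final_outside by (intro exI[of _ ?y]) simp
  qed
  with M(1) show ?thesis by blast
qed

end
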